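(* Let $\beta$ be a generalised multinacci number and let $\mathcal A_\beta\subset[0,\frac{\lfloor\beta\rfloor}{\beta-1}]$ be the set of points with a unique $\beta$-expansion. If $x\in\mathcal A_\beta$, then $$d\big(\nu_\beta,(\omega,x)\big)=\frac{\log\lceil\beta\rceil+\log2}{\log\beta}\qquad\text{for all }\omega\in\Omega,$$ where the local dimension is taken with respect to the metric $\rho$. Moreover, the measure $\nu_\beta$ is multifractal.
   Context: **Generalised multinacci numbers.** For $\beta>1$ let $I=[0,\frac{\lfloor\beta\rfloor}{\beta-1}]$. The greedy map $T_\beta:I\to I$ is $T_\beta x=\beta x-a_1(x)$, where $a_1(x)=k$ if $x\in[\frac k\beta,\frac{k+1}\beta)$ for some $k\in\{0,\dots,\lfloor\beta\rfloor-1\}$, and $a_1(x)=\lfloor\beta\rfloor$ if $x\in[\frac{\lfloor\beta\rfloor}\beta,\frac{\lfloor\beta\rfloor}{\beta-1}]$. With $a_n(x)=a_1(T_\beta^{n-1}x)$ one has $x=\sum_{n\ge1}a_n(x)\beta^{-n}$, the greedy $\beta$-expansion of $x$. The number $\beta$ is a generalised multinacci number if the greedy expansion of $1$ is finite, $1=\frac{a_1}{\beta}+\cdots+\frac{a_n}{\beta^n}$, with $n\ge2$ and $a_j\ge1$ for all $1\le j\le n$. A $\beta$-expansion of $x\in I$ is any expression $x=\sum_{k\ge1}b_k\beta^{-k}$ with $b_k\in\{0,\dots,\lfloor\beta\rfloor\}$. **Random $\beta$-transformation.** Let $T_kx=\beta x-k$ for $0\le k\le\lfloor\beta\rfloor$,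 and $E_0=[0,\frac1\beta)$, $E_{\lfloor\beta\rfloor}=\big(\frac{\lfloor\beta\rfloor}{\beta(\beta-1)}+\frac{\lfloor\beta\rfloor-1}{\beta},\frac{\lfloor\beta\rfloor}{\beta-1}\big]$, $E_k=\big(\frac{\lfloor\beta\rfloor}{\beta(\beta-1)}+\frac{k-1}\beta,\frac{k+1}\beta\big)$ for $1\le k\le\lfloor\beta\rfloor-1$, $S_k=\big[\frac k\beta,\frac{\lfloor\beta\rfloor}{\beta(\beta-1)}+\frac{k-1}\beta\big]$ for $1\le k\le\lfloor\beta\rfloor$. Put $S=\bigcup_kS_k$ and $\Omega=\{0,1\}^{\mathbb N}$, with left shift $\sigma$. Define $K:\Omega\times I\to\Omega\times I$ by $K(\omega,x)=(\omega,T_kx)$ if $x\in E_k$, and $K(\omega,x)=(\sigma\omega,T_{k-1+\omega_1}x)$ if $x\in S_k$. Let $\pi(\omega,x)=x$. **The measure $\nu_\beta$.** Let $b_1(\omega,x)=k$ if $x\in E_k$, or if $x\in S_k$ and $\omega_1=1$; let $b_1(\omega,x)=k-1$ if $x\in S_k$ and $\omega_1=0$. Let $b_n(\omega,x)=b_1(K^{n-1}(\omega,x))$ and $\phi(\omega,x)=(b_n(\omega,x))_{n\ge1}\in\{0,\dots,\lfloor\beta\rfloor\}^{\mathbb N}$. Let $Z$ be the set of $(\omega,x)$ such that $\pi(K^n(\omega,x))\in S$ for infinitely many $n$; $\phi$ is a bimeasurable bijection from $Z$ onto its image. With $m$ the uniform Bernoulli measure on $\{0,\dots,\lfloor\beta\rfloor\}^{\mathbb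 N}$ (each digit has probability $1/(\lfloor\beta\rfloor+1)$), $\nu_\beta=m\circ\phi$, i.e. $\nu_\beta(A)=m(\phi(A\cap Z))$; it is a $K$-invariant probability measure with $\nu_\beta(Z)=1$. **Coding and metric.** For $\beta$ generalised multinacci the set $$F=\Big\{\pi(K^n(\omega,1)),\ \pi\big(K^n(\omega,\tfrac{\lfloor\beta\rfloor}{\beta-1}-1)\big):n\ge0,\ \omega\in\Omega\Big\}\cup\Big\{\tfrac k\beta,\ \tfrac{\lfloor\beta\rfloor}{\beta(\beta-1)}+\tfrac k\beta:0\le k\le\lfloor\beta\rfloor\Big\}$$ is finite (known). Let $C_1,\dots,C_L$ be the open intervals between consecutive points of $F$, numbered from left to right. Let $X=(\Omega\times I)\setminus\bigcup_{n\ge0}K^{-n}(\Omega\times F)$; then $\nu_\beta(X)=1$. For $(\omega,x)\in X$ and $j\ge1$ let $\alpha_j(\omega,x)=k$ if $\pi(K^{j-1}(\omega,x))\in C_k$. The two endpoints of $I$ (fixed by the dynamics) are coded by the adjacent intervals: $\alpha_j(\omega,0)=1$ and $\alpha_j(\omega,\frac{\lfloor\beta\rfloor}{\beta-1})=L$ for all $j\ge1$, $\omega\in\Omega$. Set $X^*=X\cup\big(\Omega\times\{0,\frac{\lfloor\beta\rfloor}{\beta-1}\}\big)$; then $\Omega\times\mathcal A_\beta\subset X^*$. The metric $\rho$ on $X^*$ is $$\rho\big((\omega,x),(\omega',x')\big)=\beta^{-\min\{k\ge0:\ \omega_{k+1}\ne\omega'_{k+1}\text{ or }\alpha_{k+1}(\omega,x)\ne\alpha_{k+1}(\omega',x')\}}$$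 for distinct points (and $0$ for equal points). **Local dimension and multifractality.** For a probability measure $\mu$ on a metric space, with $B(z,r)$ the open ball of radius $r$ around $z$, $d(\mu,z)=\lim_{r\downarrow0}\frac{\log\mu(B(z,r))}{\log r}$, when this limit exists. The measure $\nu_\beta$ is called multifractal if its local dimension takes more than one value on sets of positive Hausdorff dimension, i.e. there are at least two distinct values $t$ such that $\{z:d(\nu_\beta,z)=t\}$ has positive Hausdorff dimension (with respect to $\rho$). *)

theory Defs
  imports "HOL-Probability.Probability"
begin

text \<open>
  All sequences are indexed from 0: for a sequence \<open>s\<close>, the value \<open>s n\<close> is the term with index
  \<open>n + 1\<close> of the informal notation.  \<open>\<Omega> = {0,1}\<^sup>\<nat>\<close> is the full type \<open>nat \<Rightarrow> bool\<close>, with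
  \<open>True\<close> as 1; the left shift is \<open>\<lambda>n. \<omega> (Suc n)\<close>.
\<close>

section \<open>Generalised multinacci numbers and beta-expansions\<close>

definition max_digit :: "real \<Rightarrow> nat" where
  "max_digit \<beta> = nat \<lfloor>\<beta>\<rfloor>"

definition beta_interval :: "real \<Rightarrow> real set" where
  "beta_interval \<beta> = {0 .. max_digit \<beta> / (\<beta> - 1)}"

definition greedy_digit :: "real \<Rightarrow> real \<Rightarrow> nat" where
  "greedy_digit \<beta> x = (THE k. k \<le> max_digit \<beta> \<and>
     x \<in> (if k < max_digit \<beta> then {k / \<beta> ..< (k + 1) / \<beta>}
          else {k / \<beta> .. k / (\<beta> - 1)}))"

definition greedy_map :: "real \<Rightarrow> real \<Rightarrow> real" where
  "greedy_map \<beta> x = \<beta> * x - greedy_digit \<beta> x"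

definition greedy_expansion :: "real \<Rightarrow> real \<Rightarrow> nat \<Rightarrow> nat" where
  "greedy_expansion \<beta> x n = greedy_digit \<beta> ((greedy_map \<beta> ^^ n) x)"

definition generalised_multinacci :: "real \<Rightarrow> bool" where
  "generalised_multinacci \<beta> \<longleftrightarrow> \<beta> > 1 \<and>
     (\<exists>n\<ge>2. (\<forall>j<n. greedy_expansion \<beta> 1 j \<ge> 1) \<and>
            (\<forall>j\<ge>n. greedy_expansion \<beta> 1 j = 0) \<and>
            1 = (\<Sum>j<n. greedy_expansion \<beta> 1 j / \<beta> ^ (j + 1)))"

definition is_beta_expansion :: "real \<Rightarrow> real \<Rightarrow> (nat \<Rightarrow> nat) \<Rightarrow> bool" where
  "is_beta_expansion \<beta> x b \<longleftrightarrow>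
     (\<forall>k. b k \<le> max_digit \<beta>) \<and> (\<lambda>k. b k / \<beta> ^ (k + 1)) sums x"

definition unique_expansion_points :: "real \<Rightarrow> real set" where
  "unique_expansion_points \<beta> = {x \<in> beta_interval \<beta>. \<exists>!b. is_beta_expansion \<beta> x b}"


section \<open>The random beta-transformation\<close>

definition E_region :: "real \<Rightarrow> nat \<Rightarrow> real set" where
  "E_region \<beta> k =
     (let N = real (max_digit \<beta>) in
      if k = 0 then {0 ..< 1 / \<beta>}
      else if k = max_digit \<beta> then {N / (\<beta> * (\<beta> - 1)) + (N - 1) / \<beta> <.. N / (\<beta> - 1)}
      else {N / (\<beta> * (\<beta> - 1)) + (real k - 1) / \<beta> <..< (real k + 1) / \<beta>})"

definition S_region :: "real \<Rightarrow> nat \<Rightarrow> real set" where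
  "S_region \<beta> k = {k / \<beta> .. max_digit \<beta> / (\<beta> * (\<beta> - 1)) + (real k - 1) / \<beta>}"

definition switch_region :: "real \<Rightarrow> real set" where
  "switch_region \<beta> = (\<Union>k\<in>{1..max_digit \<beta>}. S_region \<beta> k)"

text \<open>
  The digit produced by one step at \<open>(\<omega>, x)\<close>: \<open>k\<close> on the \<open>k\<close>-th equality region, and
  \<open>k - 1 + \<omega>\<^sub>1\<close> on the \<open>k\<close>-th switch region.  The random map then applies
  \<open>x \<mapsto> \<beta> x - digit\<close> and consumes one coin toss exactly on the switch region.
\<close>

definition random_digit :: "real \<Rightarrow> (nat \<Rightarrow> bool) \<times> real \<Rightarrow> nat" where
  "random_digit \<beta> = (\<lambda>(\<omega>, x).
     if x \<in> switch_region \<beta>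
     then (THE k. k \<in> {1..max_digit \<beta>} \<and> x \<in> S_region \<beta> k) - 1 + of_bool (\<omega> 0)
     else (THE k. k \<le> max_digit \<beta> \<and> x \<in> E_region \<beta> k))"

definition random_map ::
    "real \<Rightarrow> (nat \<Rightarrow> bool) \<times> real \<Rightarrow> (nat \<Rightarrow> bool) \<times> real" where
  "random_map \<beta> = (\<lambda>(\<omega>, x).
     (if x \<in> switch_region \<beta> then (\<lambda>n. \<omega> (Suc n)) else \<omega>,
      \<beta> * x - random_digit \<beta> (\<omega>, x)))"


section \<open>The measure\<close>

definition random_expansion :: "real \<Rightarrow> (nat \<Rightarrow> bool) \<times> real \<Rightarrow> nat \<Rightarrow> nat" where
  "random_expansion \<beta> p n = random_digit \<beta> ((random_map \<beta> ^^ n) p)"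

definition recurrent_set :: "real \<Rightarrow> ((nat \<Rightarrow> bool) \<times> real) set" where
  "recurrent_set \<beta> = {p \<in> UNIV \<times> beta_interval \<beta>.
     infinite {n. snd ((random_map \<beta> ^^ n) p) \<in> switch_region \<beta>}}"

definition digit_bernoulli :: "real \<Rightarrow> (nat \<Rightarrow> nat) measure" where
  "digit_bernoulli \<beta> = PiM UNIV (\<lambda>_. uniform_count_measure {0..max_digit \<beta>})"

definition nu :: "real \<Rightarrow> ((nat \<Rightarrow> bool) \<times> real) measure" where
  "nu \<beta> = measure_of (UNIV \<times> beta_interval \<beta>)
     (sets (PiM UNIV (\<lambda>_. count_space UNIV) \<Otimes>\<^sub>M restrict_space borel (beta_interval \<beta>)))
     (\<lambda>A. emeasure (digit_bernoulli \<beta>) (random_expansion \<beta> ` (A \<inter> recurrent_set \<beta>)))"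


section \<open>Coding and metric\<close>

definition F_set :: "real \<Rightarrow> real set" where
  "F_set \<beta> =
     {snd ((random_map \<beta> ^^ n) (\<omega>, 1)) | n \<omega>. True} \<union>
     {snd ((random_map \<beta> ^^ n) (\<omega>, max_digit \<beta> / (\<beta> - 1) - 1)) | n \<omega>. True} \<union>
     {real k / \<beta> | k. k \<le> max_digit \<beta>} \<union>
     {max_digit \<beta> / (\<beta> * (\<beta> - 1)) + real k / \<beta> | k. k \<le> max_digit \<beta>}"

definition num_intervals :: "real \<Rightarrow> nat" where
  "num_intervals \<beta> = card (F_set \<beta>) - 1"

text \<open>The intervals are numbered from 1 to \<open>num_intervals \<beta>\<close>, from left to right.\<close>

definition C_interval :: "real \<Rightarrow> nat \<Rightarrow> real set" where
  "C_interval \<beta> k =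
     {sorted_list_of_set (F_set \<beta>) ! (k - 1) <..< sorted_list_of_set (F_set \<beta>) ! k}"

definition X_set :: "real \<Rightarrow> ((nat \<Rightarrow> bool) \<times> real) set" where
  "X_set \<beta> = (UNIV \<times> beta_interval \<beta>) - (\<Union>n. (random_map \<beta> ^^ n) -` (UNIV \<times> F_set \<beta>))"

definition X_star :: "real \<Rightarrow> ((nat \<Rightarrow> bool) \<times> real) set" where
  "X_star \<beta> = X_set \<beta> \<union> UNIV \<times> {0, max_digit \<beta> / (\<beta> - 1)}"

definition alpha :: "real \<Rightarrow> (nat \<Rightarrow> bool) \<times> real \<Rightarrow> nat \<Rightarrow> nat" where
  "alpha \<beta> p j =
     (if snd p = 0 then 1
      else if snd p = max_digit \<beta> / (\<beta> - 1) then num_intervals \<beta>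
      else (THE k. k \<in> {1..num_intervals \<beta>} \<and>
                   snd ((random_map \<beta> ^^ j) p) \<in> C_interval \<beta> k))"

definition rho :: "real \<Rightarrow> (nat \<Rightarrow> bool) \<times> real \<Rightarrow> (nat \<Rightarrow> bool) \<times> real \<Rightarrow> real" where
  "rho \<beta> p q = (if p = q then 0
     else \<beta> powr - real (LEAST k. fst p k \<noteq> fst q k \<or> alpha \<beta> p k \<noteq> alpha \<beta> q k))"


section \<open>Hausdorff dimension, local dimension and multifractality\<close>

text \<open>
  The metric space is given by a carrier \<open>M\<close> and a distance \<open>d\<close>, as in the locale
  \<open>Metric_space\<close>.  Covering sets have diameter at most the real number \<open>\<delta>\<close>, so
  \<open>enn2real\<close> loses nothing below; and only exponents \<open>s > 0\<close> are used, so that sets of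
  diameter 0 contribute \<open>0 powr s = 0\<close>.
\<close>

definition set_diam :: "('a \<Rightarrow> 'a \<Rightarrow> real) \<Rightarrow> 'a set \<Rightarrow> ennreal" where
  "set_diam d U = (SUP x\<in>U. SUP y\<in>U. ennreal (d x y))"

definition hausdorff_premeasure ::
    "'a set \<Rightarrow> ('a \<Rightarrow> 'a \<Rightarrow> real) \<Rightarrow> real \<Rightarrow> real \<Rightarrow> 'a set \<Rightarrow> ennreal" where
  "hausdorff_premeasure M d s \<delta> A =
     (INF U \<in> {U :: nat \<Rightarrow> 'a set.
                 (\<forall>i. U i \<subseteq> M \<and> set_diam d (U i) \<le> ennreal \<delta>) \<and> A \<subseteq> (\<Union>i. U i)}.
        \<Sum>i. ennreal (enn2real (set_diam d (U i)) powr s))"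

definition hausdorff_measure ::
    "'a set \<Rightarrow> ('a \<Rightarrow> 'a \<Rightarrow> real) \<Rightarrow> real \<Rightarrow> 'a set \<Rightarrow> ennreal" where
  "hausdorff_measure M d s A = (SUP \<delta>\<in>{0<..}. hausdorff_premeasure M d s \<delta> A)"

definition hausdorff_dim :: "'a set \<Rightarrow> ('a \<Rightarrow> 'a \<Rightarrow> real) \<Rightarrow> 'a set \<Rightarrow> ennreal" where
  "hausdorff_dim M d A = (INF s \<in> {s. 0 < s \<and> hausdorff_measure M d s A = 0}. ennreal s)"

text \<open>
  The local dimension of \<open>\<mu>\<close> at \<open>z\<close> exists and equals the real number \<open>t\<close>.  The positivity
  conjunct is needed because \<open>ln 0 = 0\<close> in HOL, whereas a ball of measure 0 should make the
  quotient infinite.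
\<close>

definition has_local_dim ::
    "'a set \<Rightarrow> ('a \<Rightarrow> 'a \<Rightarrow> real) \<Rightarrow> 'a measure \<Rightarrow> 'a \<Rightarrow> real \<Rightarrow> bool" where
  "has_local_dim M d \<mu> z t \<longleftrightarrow>
     (\<forall>r>0. 0 < measure \<mu> (Metric_space.mball M d z r)) \<and>
     ((\<lambda>r. ln (measure \<mu> (Metric_space.mball M d z r)) / ln r) \<longlongrightarrow> t) (at_right 0)"

definition multifractal :: "'a set \<Rightarrow> ('a \<Rightarrow> 'a \<Rightarrow> real) \<Rightarrow> 'a measure \<Rightarrow> bool" where
  "multifractal M d \<mu> \<longleftrightarrow>
     (\<exists>s t. s \<noteq> t \<and>
        0 < hausdorff_dim M d {z \<in> M. has_local_dim M d \<mu> z s} \<and>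
        0 < hausdorff_dim M d {z \<in> M. has_local_dim M d \<mu> z t})"

end

theory Submission
  imports Defs
begin

text \<open>
  A digit sequence \<open>b\<close> determines the point \<open>x = \<Sum>b\<^sub>k \<beta>\<^sup>-\<^sup>k\<close>, its orbit (the values of the shifts of
  \<open>b\<close>) and, at the visits of the orbit to the switch region, the coin tosses; this inverts \<open>\<phi>\<close> and
  turns \<open>\<nu>\<^sub>\<beta>\<close> into the uniform Bernoulli measure. For a generalised multinacci number the finite set
  \<open>F\<close> is mapped into itself by all admissible branches, so the gaps of \<open>F\<close> form a Markov partition, and
  each switch region is the closure of a single gap. Its two images are reflections of each other,
  hence the coins are fair and independent of the initial gap. Consequently the ball of radius about
  \<open>\<beta>\<^sup>-\<^sup>n\<close> around a point has measure comparable to \<open>(N + 1)\<^sup>-\<^sup>n 2\<^sup>-\<^sup>(\<^sup>n\<^sup>-\<^sup>v\<^sup>)\<close>, where \<open>v\<close> is the number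
  of visits to the switch region before time \<open>n\<close>. Points with a unique expansion have \<open>v = 0\<close>. A
  second value of the local dimension comes from digit sequences with exactly one digit \<open>1\<close> in each
  block of a fixed length \<open>l\<close>, in one of two positions: then \<open>v \<sim> n / l\<close>, and the choices give a set
  of positive Hausdorff dimension, as \<open>\<Omega> \<times> {0}\<close> does for the first value.
\<close>

section \<open>Uniform random sequences\<close>

text \<open>The multinacci hypothesis acts through the positivity of the digits of \<open>1\<close>:
  it keeps the greedy orbit of \<open>1\<close> above \<open>1 / \<beta>\<close> until it reaches
  \<open>0\<close>, and applied to the second digit it gives
  \<open>overlap \<le> 1 / \<beta>\<close>. This inequality is what keeps the points of
  \<open>F\<close> out of the interior of the switch regions. The exponent of the ball measure
  counts free choices. A ball fixes about n gaps and n coins. Gaps and coins determine the digits,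
  each of probability \<open>1 / (N + 1)\<close>; the digits in turn determine the v coins tossed so
  far, so only the other n - v coins, which belong to later visits, cost a further factor 1/2 each.
  The obstacle is that coins are not coordinates of the digit sequence: when a coin is tossed
  depends on the whole tail through \<open>bval\<close>. Their distribution is therefore computed
  given the gap of the starting point. That is enough, since a gap is all that a ball records about
  the last orbit point, and it needs an induction over a class of starting sets that is stable under
  the inverse branches.\<close>

lemma INFM_shift: "(\<exists>\<^sub>\<infinity>n. P (n + m)) \<longleftrightarrow> (\<exists>\<^sub>\<infinity>n::nat. P n)"
proof -
  have "(\<forall>k. \<exists>n\<ge>k. P (n + m)) \<longleftrightarrow> (\<forall>k. \<exists>n\<ge>k. P n)"
  proof (intro iffI allI)
    fix k assume *: "\<forall>k. \<exists>n\<ge>k. P n"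
    then obtain n where "n \<ge> k + m" "P n" by blast
    then show "\<exists>n\<ge>k. P (n + m)" by (intro exI[of _ "n - m"]) auto
  next
    fix k assume "\<forall>k. \<exists>n\<ge>k. P (n + m)"
    then show "\<exists>n\<ge>k. P n" using le_add1 le_trans by meson
  qed
  then show ?thesis by (simp add: INFM_nat_le)
qed

text \<open>Generic because it is used twice: with \<open>{0..N}\<close> for digit sequences, and
  with \<open>UNIV :: bool set\<close> as the mass spread over a set in
  \<open>hausdorff_dim_pos\<close>.\<close>

definition uniform_seqs :: "'a set \<Rightarrow> (nat \<Rightarrow> 'a) measure" where
  "uniform_seqs A = PiM UNIV (\<lambda>_. uniform_count_measure A)"

definition drop_seq :: "nat \<Rightarrow> (nat \<Rightarrow> 'a) \<Rightarrow> nat \<Rightarrow> 'a" where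
  "drop_seq n b = (\<lambda>k. b (k + n))"

lemma drop_seq_nth [simp]: "drop_seq n b k = b (k + n)" by (simp add: drop_seq_def)
lemma drop_seq_0 [simp]: "drop_seq 0 b = b" by (simp add: drop_seq_def)
lemma drop_seq_drop_seq [simp]: "drop_seq m (drop_seq n b) = drop_seq (m + n) b"
  by (simp add: drop_seq_def ac_simps)

locale uniform_seq_space =
  fixes A :: "'a set"
  assumes fin: "finite A" and ne: "A \<noteq> {}"
begin

abbreviation D where "D \<equiv> uniform_seqs A"

sublocale sequence_space "uniform_count_measure A"
proof -
  interpret M: prob_space "uniform_count_measure A" by (rule prob_space_uniform_count_measure[OF fin ne])
  show "sequence_space (uniform_count_measure A)" by unfold_locales
qed

lemma D_eq: "D = S" by (simp add: uniform_seqs_def)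

lemma space_D: "space D = {b. \<forall>i. b i \<in> A}"
  by (auto simp: D_eq space_PiM space_uniform_count_measure)

lemma prob_space_D: "prob_space D" unfolding D_eq by (rule prob_space_PiM) unfold_locales

lemma measurable_nth [measurable]: "(\<lambda>b. b i) \<in> D \<rightarrow>\<^sub>M count_space UNIV"
proof -
  have "(\<lambda>b. b i) \<in> D \<rightarrow>\<^sub>M uniform_count_measure A" unfolding D_eq by measurable
  moreover have "(\<lambda>x. x) \<in> uniform_count_measure A \<rightarrow>\<^sub>M count_space UNIV"
    by (auto simp: measurable_def space_uniform_count_measure sets_uniform_count_measure)
  ultimately show ?thesis by (rule measurable_compose)
qed

lemma measurable_into_D:
  assumes "\<And>i. (\<lambda>x. f x i) \<in> M \<rightarrow>\<^sub>M count_space UNIV" "\<And>x i. x \<in> space M \<Longrightarrow> f x i \<in> A"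
  shows "f \<in> M \<rightarrow>\<^sub>M D"
  unfolding D_eq
proof (rule measurable_PiM_single')
  fix i
  have "(\<lambda>x. f x i) -` X \<inter> space M \<in> sets M" for X
    using measurable_sets[OF assms(1)[of i], of X] by simp
  then show "(\<lambda>x. f x i) \<in> M \<rightarrow>\<^sub>M uniform_count_measure A"
    using assms(2) by (intro measurableI) (auto simp: space_uniform_count_measure)
qed (use assms(2) in \<open>auto simp: space_uniform_count_measure\<close>)

lemma measurable_drop_seq [measurable]: "drop_seq n \<in> D \<rightarrow>\<^sub>M D"
  by (rule measurable_into_D) (auto simp: space_D)

text \<open>The product measure is the image of one factor times itself under prefixing a digit, and
  the event pulls back to the rectangle \<open>{a} \<times> X\<close>.\<close>

lemma emeasure_first_digit:
  assumes "a \<in> A" "X \<in> sets D"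
  shows "emeasure D {b \<in> space D. b 0 = a \<and> drop_seq 1 b \<in> X} = ennreal (1 / card A) * emeasure D X"
proof -
  let ?U = "uniform_count_measure A"
  have X: "X \<in> sets S" using assms D_eq by simp
  define Y where "Y = {b \<in> space D. b 0 = a \<and> drop_seq 1 b \<in> X}"
  have m: "Y \<in> sets S"
    unfolding Y_def D_eq[symmetric] using assms by measurable
  have "emeasure S Y = emeasure (?U \<Otimes>\<^sub>M S) ((\<lambda>(s, \<omega>). case_nat s \<omega>) -` Y \<inter> space (?U \<Otimes>\<^sub>M S))"
    by (subst PiM_iter[symmetric], subst emeasure_distr) (use m in measurable)
  also have "(\<lambda>(s, \<omega>). case_nat s \<omega>) -` Y \<inter> space (?U \<Otimes>\<^sub>M S) = {a} \<times> X"
  proof -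
    have *: "drop_seq (Suc 0) (case_nat s \<omega>) = \<omega>" for s :: 'a and \<omega> by (auto simp: drop_seq_def)
    have "X \<subseteq> space S" using sets.sets_into_space[OF X] .
    then show ?thesis using assms(1) unfolding Y_def
      by (auto simp: space_pair_measure * space_uniform_count_measure space_D D_eq[symmetric] split: nat.splits)
  qed
  also have "emeasure (?U \<Otimes>\<^sub>M S) ({a} \<times> X) = emeasure ?U {a} * emeasure S X"
    using assms X by (intro P.emeasure_pair_measure_Times) (auto simp: sets_uniform_count_measure)
  also have "emeasure ?U {a} = ennreal (1 / card A)"
    using assms fin by (simp add: emeasure_uniform_count_measure ennreal_divide_numeral)
  finally show ?thesis by (simp add: D_eq Y_def)
qed

lemma emeasure_prefix:
  assumes "\<And>i. i < n \<Longrightarrow> d i \<in> A" "X \<in> sets D"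
  shows "emeasure D {b \<in> space D. (\<forall>i<n. b i = d i) \<and> drop_seq n b \<in> X} = ennreal ((1 / card A) ^ n) * emeasure D X"
  using assms(1)
proof (induction n arbitrary: d)
  case 0
  have "{b \<in> space D. (\<forall>i<0. b i = d i) \<and> drop_seq 0 b \<in> X} = X"
    using sets.sets_into_space[OF assms(2)] by auto
  then show ?case by simp
next
  case (Suc n)
  define Y where "Y = {b \<in> space D. (\<forall>i<n. b i = d (Suc i)) \<and> drop_seq n b \<in> X}"
  have [measurable]: "X \<in> sets D" by fact
  have Y: "Y \<in> sets D" unfolding Y_def by measurable
  have "{b \<in> space D. (\<forall>i<Suc n. b i = d i) \<and> drop_seq (Suc n) b \<in> X}
    = {b \<in> space D. b 0 = d 0 \<and> drop_seq 1 b \<in> Y}"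
    unfolding Y_def by (auto simp: space_D less_Suc_eq_0_disj)
  then have "emeasure D {b \<in> space D. (\<forall>i<Suc n. b i = d i) \<and> drop_seq (Suc n) b \<in> X} =
     ennreal (1 / card A) * emeasure D Y" using Suc.prems Y emeasure_first_digit[of "d 0" Y] by simp
  also have "emeasure D Y = ennreal ((1 / card A) ^ n) * emeasure D X"
    unfolding Y_def using Suc.prems by (intro Suc.IH) auto
  also have "ennreal (1 / card A) * (ennreal ((1 / card A) ^ n) * emeasure D X) = ennreal ((1 / card A) ^ Suc n) * emeasure D X"
    by (simp only: power_Suc ennreal_mult' zero_le_divide_1_iff of_nat_0_le_iff mult.assoc)
  finally show ?case .
qed

lemma emeasure_cylinder:
  assumes "\<And>i. i < n \<Longrightarrow> d i \<in> A"
  shows "emeasure D {b \<in> space D. \<forall>i<n. b i = d i} = ennreal ((1 / card A) ^ n)"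
proof -
  interpret D: prob_space D by (rule prob_space_D)
  have "{b \<in> space D. \<forall>i<n. b i = d i} = {b \<in> space D. (\<forall>i<n. b i = d i) \<and> drop_seq n b \<in> space D}"
    by (auto simp: space_D)
  then show ?thesis using emeasure_prefix[of n d "space D"] assms by (simp add: D.emeasure_space_1)
qed

lemma emeasure_split_first:
  assumes "X \<in> sets D"
  shows "emeasure D X = (\<Sum>a\<in>A. emeasure D {b \<in> X. b 0 = a})"
proof -
  have [measurable]: "X \<in> sets D" by fact
  have s: "X \<subseteq> space D" using sets.sets_into_space[OF assms] .
  have m: "{b \<in> X. b 0 = a} \<in> sets D" for a
  proof -
    have "{b \<in> X. b 0 = a} = {b \<in> space D. b \<in> X \<and> b 0 = a}" using s by auto
    also have "\<dots> \<in> sets D" by measurable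
    finally show ?thesis .
  qed
  have "X = (\<Union>a\<in>A. {b \<in> X. b 0 = a})" using s by (auto simp: space_D)
  then have "emeasure D X = emeasure D (\<Union>a\<in>A. {b \<in> X. b 0 = a})" by simp
  also have "\<dots> = (\<Sum>a\<in>A. emeasure D {b \<in> X. b 0 = a})"
    by (rule sum_emeasure[symmetric]) (auto simp: fin m disjoint_family_on_def)
  finally show ?thesis .
qed

lemma emeasure_drop_seq:
  assumes "X \<in> sets D"
  shows "emeasure D {b \<in> space D. drop_seq n b \<in> X} = emeasure D X"
proof (induction n)
  case 0
  have "{b \<in> space D. drop_seq 0 b \<in> X} = X"
    using sets.sets_into_space[OF assms] by auto
  then show ?case by simp
next
  case (Suc n)
  have [measurable]: "X \<in> sets D" by fact
  define Y where "Y = {b \<in> space D. drop_seq n b \<in> X}"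
  have Y[measurable]: "Y \<in> sets D" unfolding Y_def by measurable
  have card: "card A > 0" using fin ne by (simp add: card_gt_0_iff)
  have "{b \<in> space D. drop_seq (Suc n) b \<in> X} = {b \<in> space D. drop_seq 1 b \<in> Y}"
    by (auto simp: Y_def space_D)
  then have "emeasure D {b \<in> space D. drop_seq (Suc n) b \<in> X} = emeasure D {b \<in> space D. drop_seq 1 b \<in> Y}"
    by simp
  also have "\<dots> = (\<Sum>a\<in>A. emeasure D {b \<in> {b \<in> space D. drop_seq 1 b \<in> Y}. b 0 = a})"
    by (rule emeasure_split_first) measurable
  also have "\<dots> = (\<Sum>a\<in>A. emeasure D {b \<in> space D. b 0 = a \<and> drop_seq 1 b \<in> Y})"
    by (intro sum.cong arg_cong[where f="emeasure D"]) auto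
  also have "\<dots> = (\<Sum>a\<in>A. ennreal (1 / card A) * emeasure D Y)"
    using emeasure_first_digit Y by (intro sum.cong) auto
  also have "\<dots> = ennreal (card A * (1 / card A)) * emeasure D Y"
    by (simp only: sum_constant ennreal_of_nat_eq_real_of_nat ennreal_mult' of_nat_0_le_iff mult.assoc)
  also have "\<dots> = emeasure D Y" using card by simp
  finally show ?case using Suc by (simp only: Y_def)
qed

text \<open>The set of sequences avoiding the word at all positions \<open>0, n, 2n, \<dots>\<close> has measure \<open>x\<close>
  with \<open>x \<le> x - p x\<close>, where \<open>p > 0\<close> is the probability of the word.\<close>

lemma AE_word_infinitely_often:
  assumes "\<And>i. i < n \<Longrightarrow> d i \<in> A"
  shows "AE b in D. \<exists>\<^sub>\<infinity>k. \<forall>i<n. b (i + k) = d i"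
proof -
  interpret D: prob_space D by (rule prob_space_D)
  define W where "W = {b \<in> space D. \<forall>i<n. b i = d i}"
  define X where "X = {b \<in> space D. \<forall>j. \<not> (\<forall>i<n. b (i + j * n) = d i)}"
  have X[measurable]: "X \<in> sets D" unfolding X_def by measurable
  define p where "p = (1 / real (card A)) ^ n"
  have card: "card A > 0" using fin ne by (simp add: card_gt_0_iff)
  then have p: "p > 0" by (simp add: p_def)
  let ?Y = "{b \<in> space D. drop_seq n b \<in> X}"
  let ?Z = "{b \<in> space D. (\<forall>i<n. b i = d i) \<and> drop_seq n b \<in> X}"
  \<comment> \<open>Two disjoint sets inside the shift preimage of \<open>X\<close>, which has the
    measure of \<open>X\<close>; hence no mass is left for \<open>?Z\<close>.\<close>
  have sub: "X \<union> ?Z \<subseteq> ?Y"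
  proof -
    have "drop_seq n b \<in> X" if "b \<in> X" for b
    proof -
      have "\<not> (\<forall>i<n. drop_seq n b (i + j * n) = d i)" for j
      proof -
        have "\<not> (\<forall>i<n. b (i + Suc j * n) = d i)" using that unfolding X_def by blast
        then show ?thesis by (simp add: ac_simps)
      qed
      then show ?thesis using that by (auto simp: X_def space_D)
    qed
    then show ?thesis by (auto simp: X_def)
  qed
  have disj: "X \<inter> ?Z = {}" by (auto simp: X_def dest: spec[of _ 0])
  have Zm: "?Z \<in> sets D" "?Y \<in> sets D" by measurable
  have "measure D X + measure D ?Z = measure D (X \<union> ?Z)"
    using disj Zm by (intro D.finite_measure_Union[symmetric]) auto
  also have "\<dots> \<le> measure D ?Y" using sub Zm by (intro D.finite_measure_mono) auto
  also have "\<dots> = measure D X" using emeasure_drop_seq[OF X, of n] by (simp add: measure_def)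
  finally have "measure D ?Z \<le> 0" by simp
  moreover have "measure D ?Z = p * measure D X"
    using emeasure_prefix[OF assms X] p by (simp add: measure_def p_def enn2real_mult)
  ultimately have "measure D X = 0" using p measure_nonneg[of D X] by (simp add: mult_le_0_iff)
  then have X0: "emeasure D X = 0" by (simp add: D.emeasure_eq_measure)
  have "AE b in D. drop_seq m b \<notin> X" for m
  proof (rule AE_I')
    show "{b \<in> space D. drop_seq m b \<in> X} \<in> null_sets D"
      using emeasure_drop_seq[OF X, of m] X0 by (auto intro!: null_setsI)
  qed auto
  then have "AE b in D. \<forall>m. drop_seq m b \<notin> X" by (simp add: AE_all_countable)
  then show ?thesis
  proof (rule AE_mp, intro AE_I2 impI)
    fix b assume b: "b \<in> space D" "\<forall>m. drop_seq m b \<notin> X"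
    show "\<exists>\<^sub>\<infinity>k. \<forall>i<n. b (i + k) = d i"
      unfolding INFM_nat_le
    proof
      fix m
      have "drop_seq m b \<in> space D" using b by (auto simp: space_D)
      with b obtain j where j: "\<forall>i<n. drop_seq m b (i + j * n) = d i" unfolding X_def by blast
      then show "\<exists>k\<ge>m. \<forall>i<n. b (i + k) = d i" by (intro exI[of _ "j * n + m"]) (auto simp: ac_simps)
    qed
  qed
qed

text \<open>Meant for the digit reflection \<open>a \<mapsto> N - a\<close>. By uniqueness of
  product measures only the factors matter, and there a bijection preserves cardinalities.\<close>

lemma emeasure_map_bij:
  assumes g: "bij_betw g A A" and X: "X \<in> sets D"
  shows "emeasure D {b \<in> space D. (\<lambda>i. g (b i)) \<in> X} = emeasure D X"
proof -
  let ?U = "uniform_count_measure A"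
  have gA: "g a \<in> A" if "a \<in> A" for a using g that by (auto simp: bij_betw_def)
  have m: "(\<lambda>b i. g (b i)) \<in> D \<rightarrow>\<^sub>M D"
  proof (rule measurable_into_D)
    show "(\<lambda>b. g (b i)) \<in> D \<rightarrow>\<^sub>M count_space UNIV" for i
      by (rule measurable_compose[OF measurable_nth]) simp
  qed (auto simp: space_D gA)
  have "distr D D (\<lambda>b i. g (b i)) = S"
  proof (rule PiM_eq)
    fix J E assume J: "finite J" "J \<subseteq> (UNIV :: nat set)" "\<And>j. j \<in> J \<Longrightarrow> E j \<in> sets ?U"
    have E: "E j \<subseteq> A" if "j \<in> J" for j using J(3)[OF that] by (simp add: sets_uniform_count_measure)
    let ?E' = "\<lambda>j. g -` E j \<inter> A"
    have card_eq: "card (?E' j) = card (E j)" if "j \<in> J" for j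
    proof -
      have "g ` ?E' j = E j"
      proof
        show "E j \<subseteq> g ` ?E' j"
        proof
          fix x assume x: "x \<in> E j"
          then have "x \<in> g ` A" using g E[OF that] by (auto simp: bij_betw_def)
          then show "x \<in> g ` ?E' j" using x by auto
        qed
      qed auto
      moreover have "inj_on g (?E' j)" using g by (auto simp: bij_betw_def intro: inj_on_subset)
      ultimately show ?thesis by (metis card_image)
    qed
    have "emeasure (distr D D (\<lambda>b i. g (b i))) (prod_emb UNIV (\<lambda>_. ?U) J (Pi\<^sub>E J E))
       = emeasure D ((\<lambda>b i. g (b i)) -` (prod_emb UNIV (\<lambda>_. ?U) J (Pi\<^sub>E J E)) \<inter> space D)"
      using m J by (intro emeasure_distr) (auto simp: D_eq intro!: sets_PiM_I)
    also have "(\<lambda>b i. g (b i)) -` (prod_emb UNIV (\<lambda>_. ?U) J (Pi\<^sub>E J E)) \<inter> space D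
       = prod_emb UNIV (\<lambda>_. ?U) J (Pi\<^sub>E J ?E')"
      by (auto simp: prod_emb_def space_D PiE_iff space_uniform_count_measure gA)
    also have "emeasure D \<dots> = (\<Prod>j\<in>J. emeasure ?U (?E' j))"
      unfolding D_eq using J by (intro emeasure_PiM_emb) (auto simp: sets_uniform_count_measure)
    also have "\<dots> = (\<Prod>j\<in>J. emeasure ?U (E j))"
      using card_eq E fin by (intro prod.cong) (auto simp: emeasure_uniform_count_measure)
    finally show "emeasure (distr D D (\<lambda>b i. g (b i))) (prod_emb UNIV (\<lambda>_. ?U) J (Pi\<^sub>E J E)) = (\<Prod>j\<in>J. emeasure ?U (E j))" .
  qed (simp add: D_eq)
  then have "emeasure D X = emeasure (distr D D (\<lambda>b i. g (b i))) X" by (simp add: D_eq)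
  also have "\<dots> = emeasure D ((\<lambda>b i. g (b i)) -` X \<inter> space D)" using m X by (rule emeasure_distr)
  also have "(\<lambda>b i. g (b i)) -` X \<inter> space D = {b \<in> space D. (\<lambda>i. g (b i)) \<in> X}" by auto
  finally show ?thesis by simp
qed

end

section \<open>A lower bound for the Hausdorff dimension\<close>

text \<open>Mass distribution principle: the fair coin measure of the preimage of a covering set is at most
  a constant times a power of its diameter.\<close>

lemma hausdorff_dim_pos:
  fixes g :: "(nat \<Rightarrow> bool) \<Rightarrow> 'a" and d :: "'a \<Rightarrow> 'a \<Rightarrow> real"
  assumes gA: "\<And>s. g s \<in> A" and c: "0 < c" and q: "0 < q" "q < 1"
    and sep: "\<And>s t n. s n \<noteq> t n \<Longrightarrow> (\<And>i. i < n \<Longrightarrow> s i = t i) \<Longrightarrow> c * q ^ n \<le> d (g s) (g t)"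
  shows "0 < hausdorff_dim M d A"
proof -
  interpret U: uniform_seq_space "UNIV :: bool set" by unfold_locales auto
  let ?D = "uniform_seqs (UNIV :: bool set)"
  interpret P: prob_space ?D by (rule U.prob_space_D)
  have sp: "space ?D = UNIV" by (simp add: U.space_D)
  \<comment> \<open>The exponent with \<open>q powr s0 = 1 / 2\<close>: it converts the scale
    \<open>q ^ n\<close> into the mass of a coin cylinder of length \<open>n\<close>.\<close>
  define s0 where "s0 = ln 2 / - ln q"
  have lnq: "ln q < 0" using q by simp
  have s0: "s0 > 0" unfolding s0_def using lnq by (intro divide_pos_pos) auto
  have half: "(q ^ n) powr s0 = (1 / 2) ^ n" for n
  proof -
    have "q powr s0 = 1 / 2" unfolding s0_def powr_def using lnq q by (simp add: exp_minus field_simps)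
    moreover have "(q ^ n) powr s0 = (q powr s0) ^ n"
    proof (induction n)
      case (Suc n)
      have "(q ^ Suc n) powr s0 = q powr s0 * (q ^ n) powr s0" using q by (simp only: power_Suc powr_mult zero_le_power less_imp_le)
      then show ?case using Suc by (simp only: power_Suc)
    qed simp
    ultimately show ?thesis by (simp only:)
  qed
  have cyl: "{b :: nat \<Rightarrow> bool. \<forall>i<n. b i = s i} \<in> sets ?D" "emeasure ?D {b. \<forall>i<n. b i = s i} = ennreal ((1 / 2) ^ n)" for s n
  proof -
    have "{b \<in> space ?D. \<forall>i<n. b i = s i} \<in> sets ?D" by measurable
    then show "{b :: nat \<Rightarrow> bool. \<forall>i<n. b i = s i} \<in> sets ?D" by (simp add: sp)
    show "emeasure ?D {b. \<forall>i<n. b i = s i} = ennreal ((1 / 2) ^ n)"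
      using U.emeasure_cylinder[of n s] by (simp add: sp)
  qed
  \<comment> \<open>A covering set is arbitrary, so its preimage under \<open>g\<close> may fail to
    be measurable; the mass bound is stated for a measurable superset.\<close>
  have cover: "\<exists>Y\<in>sets ?D. g -` W \<subseteq> Y \<and> emeasure ?D Y \<le> ennreal (c powr - e) * ennreal (enn2real (set_diam d W) powr e)"
    if W: "set_diam d W \<le> ennreal \<delta>" and e: "0 < e" "e \<le> s0" for W \<delta> e
  proof -
    define r where "r = enn2real (set_diam d W)"
    have fin: "set_diam d W < top" using W by (simp add: le_less_trans[OF _ ennreal_less_top])
    have r: "0 \<le> r" "set_diam d W = ennreal r" using fin by (simp_all add: r_def)
    have dr: "d x y \<le> r" if "x \<in> W" "y \<in> W" for x y
    proof -
      have "ennreal (d x y) \<le> set_diam d W" unfolding set_diam_def using that by (intro SUP_upper2[of x] SUP_upper2[of y]) auto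
      then show ?thesis using r by simp
    qed
    have diff: "\<exists>n. s n \<noteq> t n \<and> (\<forall>i<n. s i = t i)" if "s \<noteq> t" for s t :: "nat \<Rightarrow> bool"
      using that exists_least_iff[of "\<lambda>n. s n \<noteq> t n"] by auto
    have agree: "s i = t i" if "s \<in> g -` W" "t \<in> g -` W" "i < n" "\<And>k. k < n \<Longrightarrow> r < c * q ^ k" for s t i n
    proof (rule ccontr)
      assume "s i \<noteq> t i"
      then obtain k where k: "s k \<noteq> t k" "\<forall>i<k. s i = t i" using diff[of s t] by auto
      have "k \<le> i" using k \<open>s i \<noteq> t i\<close> by (meson not_le)
      then have "r < c * q ^ k" using that by simp
      then show False using sep[of s k t] k dr[of "g s" "g t"] that by force
    qed
    have goal: "\<exists>Y\<in>sets ?D. g -` W \<subseteq> Y \<and> emeasure ?D Y \<le> ennreal ((r / c) powr e)"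
    proof (cases "g -` W = {}")
      case True
      then show ?thesis by (intro bexI[of _ "{}"]) auto
    next
      case False
      then obtain s where s: "s \<in> g -` W" by blast
      consider "r = 0" | "r \<ge> c" | "0 < r" "r < c" using r(1) by linarith
      then show ?thesis
      proof cases
        case 1
        \<comment> \<open>Diameter 0: all preimages agree with \<open>s\<close> at every index, and
          a single coin sequence has mass 0.\<close>
        define Y where "Y = (\<Inter>n. {b :: nat \<Rightarrow> bool. \<forall>i<n. b i = s i})"
        have Y: "Y \<in> sets ?D" unfolding Y_def using cyl(1) by (intro sets.countable_INT) auto
        have "emeasure ?D Y \<le> ennreal ((1 / 2) ^ n)" for n
          unfolding cyl(2)[of n s, symmetric] by (rule emeasure_mono[OF _ cyl(1)]) (auto simp: Y_def)
        moreover have "(\<lambda>n. ennreal ((1 / 2) ^ n)) \<longlonglongrightarrow> ennreal 0"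
          by (intro tendsto_ennrealI LIMSEQ_realpow_zero) auto
        ultimately have "emeasure ?D Y \<le> ennreal 0" by (intro LIMSEQ_le_const) auto
        moreover have "g -` W \<subseteq> Y"
          using agree[OF _ s] 1 c q unfolding Y_def by auto
        ultimately show ?thesis using Y by (intro bexI[of _ Y]) auto
      next
        case 2
        have "1 \<le> (r / c) powr e" using 2 c e by (intro ge_one_powr_ge_zero) auto
        then have "emeasure ?D UNIV \<le> ennreal ((r / c) powr e)"
          using P.emeasure_space_1 by (simp add: sp ennreal_leI[of 1, simplified])
        then show ?thesis using sets.top[of ?D] by (intro bexI[of _ UNIV]) (auto simp: sp)
      next
        case 3
        have "(\<lambda>n. c * q ^ n) \<longlonglongrightarrow> c * 0" using q by (intro tendsto_intros LIMSEQ_realpow_zero) auto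
        then have "\<forall>\<^sub>F n in sequentially. c * q ^ n < r" using 3 by (intro order_tendstoD) auto
        then obtain n0 where n0: "c * q ^ n0 < r" using eventually_happens' sequentially_bot by blast
        \<comment> \<open>The first scale not exceeding the diameter. At all earlier scales the
          separation is larger than \<open>r\<close>, so the preimages agree on their first
          \<open>n\<close> coins.\<close>
        define n where "n = (LEAST n. c * q ^ n \<le> r)"
        have n: "c * q ^ n \<le> r" unfolding n_def by (rule LeastI[of "\<lambda>n. c * q ^ n \<le> r", OF less_imp_le[OF n0]])
        have n': "r < c * q ^ k" if "k < n" for k
          using not_less_Least[of k "\<lambda>n. c * q ^ n \<le> r", folded n_def, OF that] by simp
        have "(1 / 2) ^ n = (q ^ n) powr s0" using half by simp
        also have "\<dots> \<le> (r / c) powr s0" using n c q s0 by (intro powr_mono2) (auto simp: field_simps)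
        also have "\<dots> \<le> (r / c) powr e" using 3 c e by (intro powr_mono') (auto simp: field_simps)
        finally have "emeasure ?D {b. \<forall>i<n. b i = s i} \<le> ennreal ((r / c) powr e)" unfolding cyl(2) by (rule ennreal_leI)
        moreover have "g -` W \<subseteq> {b. \<forall>i<n. b i = s i}"
        proof
          fix t assume "t \<in> g -` W"
          then show "t \<in> {b. \<forall>i<n. b i = s i}" using agree[of t s _ n] s n' by blast
        qed
        ultimately show ?thesis using cyl(1) by blast
      qed
    qed
    have "ennreal ((r / c) powr e) = ennreal (c powr - e) * ennreal (r powr e)"
    proof -
      have "(r / c) powr e = c powr - e * r powr e" using r(1) c by (simp add: powr_divide powr_minus_divide)
      then show ?thesis by (simp add: ennreal_mult')
    qed
    then show ?thesis using goal unfolding r_def by simp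
  qed
  have nonzero: "hausdorff_measure M d e A \<noteq> 0" if e: "0 < e" "e \<le> s0" for e
  proof -
    have low: "ennreal (c powr e) \<le> (\<Sum>i. ennreal (enn2real (set_diam d (W i)) powr e))"
      if W: "\<And>i. set_diam d (W i) \<le> ennreal 1" "A \<subseteq> (\<Union>i. W i)" for W :: "nat \<Rightarrow> 'a set"
    proof -
      obtain Y where Y: "\<And>i. Y i \<in> sets ?D" "\<And>i. g -` W i \<subseteq> Y i"
        "\<And>i. emeasure ?D (Y i) \<le> ennreal (c powr - e) * ennreal (enn2real (set_diam d (W i)) powr e)"
      proof -
        have "\<forall>i. \<exists>Y. Y \<in> sets ?D \<and> g -` W i \<subseteq> Y \<and>
          emeasure ?D Y \<le> ennreal (c powr - e) * ennreal (enn2real (set_diam d (W i)) powr e)"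
          using cover[OF W(1) e] by blast
        from choice[OF this] show thesis using that by blast
      qed
      have "1 = emeasure ?D (\<Union>i. Y i)"
      proof -
        have "UNIV \<subseteq> (\<Union>i. g -` W i)"
        proof
          fix x show "x \<in> (\<Union>i. g -` W i)" using subsetD[OF W(2) gA[of x]] by simp
        qed
        then have "UNIV \<subseteq> (\<Union>i. Y i)" using Y(2) by blast
        then have "(\<Union>i. Y i) = space ?D" by (simp add: sp top.extremum_uniqueI)
        then show ?thesis using P.emeasure_space_1 by simp
      qed
      also have "\<dots> \<le> (\<Sum>i. emeasure ?D (Y i))" using Y(1) by (intro emeasure_subadditive_countably) auto
      also have "\<dots> \<le> (\<Sum>i. ennreal (c powr - e) * ennreal (enn2real (set_diam d (W i)) powr e))"
        using Y(3) by (intro suminf_le) auto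
      also have "\<dots> = ennreal (c powr - e) * (\<Sum>i. ennreal (enn2real (set_diam d (W i)) powr e))" by simp
      finally have "ennreal (c powr e) * 1 \<le> ennreal (c powr e) * (ennreal (c powr - e) * (\<Sum>i. ennreal (enn2real (set_diam d (W i)) powr e)))"
        by (intro mult_left_mono) auto
      also have "\<dots> = ennreal (c powr e * c powr - e) * (\<Sum>i. ennreal (enn2real (set_diam d (W i)) powr e))"
        by (simp only: ennreal_mult' powr_ge_zero mult.assoc)
      finally have "ennreal (c powr e) \<le> ennreal (c powr e * c powr - e) * (\<Sum>i. ennreal (enn2real (set_diam d (W i)) powr e))"
        by (simp only: mult_1_right)
      moreover have "c powr e * c powr - e = 1" using c by (simp add: powr_add[symmetric])
      ultimately show ?thesis by (simp only: ennreal_1 mult_1_left)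
    qed
    have "ennreal (c powr e) \<le> hausdorff_premeasure M d e 1 A"
      unfolding hausdorff_premeasure_def by (rule INF_greatest) (use low in auto)
    also have "\<dots> \<le> hausdorff_measure M d e A"
      unfolding hausdorff_measure_def by (rule SUP_upper) simp
    finally show ?thesis using c by auto
  qed
  have "ennreal s0 \<le> hausdorff_dim M d A"
    unfolding hausdorff_dim_def
  proof (rule INF_greatest)
    fix e assume "e \<in> {s. 0 < s \<and> hausdorff_measure M d s A = 0}"
    then have "\<not> e \<le> s0" using nonzero by blast
    then show "ennreal s0 \<le> ennreal e" by (intro ennreal_leI) simp
  qed
  then show ?thesis using s0 by (meson ennreal_less_zero_iff less_le_trans)
qed

section \<open>Generalised multinacci numbers\<close>

locale multinacci =
  fixes \<beta> :: real
  assumes multinacci: "generalised_multinacci \<beta>"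
begin

abbreviation N :: nat where "N \<equiv> max_digit \<beta>"

definition upper :: real where "upper = N / (\<beta> - 1)"

text \<open>The larger digit maps every switch region onto \<open>[0, overlap]\<close> and the
  smaller one onto \<open>[1, upper]\<close>; the two images are exchanged by
  \<open>x \<mapsto> upper - x\<close>.\<close>

definition overlap :: real where "overlap = upper - 1"

abbreviation I :: "real set" where "I \<equiv> beta_interval \<beta>"

abbreviation F :: "real set" where "F \<equiv> F_set \<beta>"

section \<open>The greedy orbit of \<open>1\<close> and its arithmetic consequences\<close>

definition orbit1 :: "nat \<Rightarrow> real" where "orbit1 i = (greedy_map \<beta> ^^ i) 1"

abbreviation digit1 :: "nat \<Rightarrow> nat" where "digit1 \<equiv> greedy_expansion \<beta> 1"

definition len1 :: nat where
  "len1 = (SOME n. n \<ge> 2 \<and> (\<forall>j<n. digit1 j \<ge> 1) \<and> (\<forall>j\<ge>n. digit1 j = 0) \<and>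
            1 = (\<Sum>j<n. digit1 j / \<beta> ^ (j + 1)))"

lemma beta_gt1: "\<beta> > 1"
  using multinacci by (simp add: generalised_multinacci_def)

lemma len1: "len1 \<ge> 2" "\<And>j. j < len1 \<Longrightarrow> digit1 j \<ge> 1" "\<And>j. j \<ge> len1 \<Longrightarrow> digit1 j = 0"
  "1 = (\<Sum>j<len1. digit1 j / \<beta> ^ (j + 1))"
proof -
  have "\<exists>n. n \<ge> 2 \<and> (\<forall>j<n. digit1 j \<ge> 1) \<and> (\<forall>j\<ge>n. digit1 j = 0) \<and>
            1 = (\<Sum>j<n. digit1 j / \<beta> ^ (j + 1))"
    using multinacci by (auto simp: generalised_multinacci_def)
  from someI_ex[OF this, folded len1_def]
  show "len1 \<ge> 2" "\<And>j. j < len1 \<Longrightarrow> digit1 j \<ge> 1" "\<And>j. j \<ge> len1 \<Longrightarrow> digit1 j = 0"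
    "1 = (\<Sum>j<len1. digit1 j / \<beta> ^ (j + 1))" by blast+
qed

lemma N_ge1: "N \<ge> 1" and N_le_beta: "real N \<le> \<beta>" and beta_less_Suc: "\<beta> < real N + 1"
proof -
  have "real N = of_int \<lfloor>\<beta>\<rfloor>" using beta_gt1 by (simp add: max_digit_def)
  then have "real N \<le> \<beta>" "\<beta> < real N + 1" by linarith+
  moreover from this have "N \<ge> 1" using beta_gt1 by linarith
  ultimately show "N \<ge> 1" "real N \<le> \<beta>" "\<beta> < real N + 1" by blast+
qed

lemma greedy_digit_eq:
  assumes "k \<le> N" "real k \<le> \<beta> * x" "k < N \<Longrightarrow> \<beta> * x < k + 1" "x \<le> upper"
  shows "greedy_digit \<beta> x = k"
  unfolding greedy_digit_def
proof (rule the_equality)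
  have b: "\<beta> > 0" using beta_gt1 by simp
  show "k \<le> N \<and> x \<in> (if k < N then {real k / \<beta>..<real (k + 1) / \<beta>} else {real k / \<beta>..real k / (\<beta> - 1)})"
    using assms b by (auto simp: field_simps upper_def)
  fix j assume j: "j \<le> N \<and> x \<in> (if j < N then {real j / \<beta>..<real (j + 1) / \<beta>} else {real j / \<beta>..real j / (\<beta> - 1)})"
  have "real j \<le> \<beta> * x" "j < N \<Longrightarrow> \<beta> * x < j + 1"
    using j b by (auto simp: field_simps split: if_splits)
  moreover have "\<not> j < k" "\<not> k < j" using calculation assms j by (linarith, linarith)
  ultimately show "j = k" by simp
qed

lemma upper_gt1: "upper > 1" and overlap_pos: "overlap > 0"
  using beta_gt1 beta_less_Suc by (auto simp: upper_def overlap_def field_simps)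

lemma upper_eq: "\<beta> * upper = N + upper"
  using beta_gt1 by (simp add: upper_def field_simps)

lemma I_eq: "I = {0..upper}" by (simp add: beta_interval_def upper_def)

lemma orbit1_0 [simp]: "orbit1 0 = 1" by (simp add: orbit1_def)

lemma orbit1_Suc: "orbit1 (Suc i) = \<beta> * orbit1 i - digit1 i"
  by (simp add: orbit1_def greedy_expansion_def greedy_map_def)

lemma orbit1_sum: "orbit1 i = \<beta> ^ i * (1 - (\<Sum>j<i. digit1 j / \<beta> ^ (j + 1)))"
proof (induction i)
  case (Suc i)
  show ?case using beta_gt1 by (simp add: orbit1_Suc Suc field_simps)
qed simp

lemma orbit1_len1: "orbit1 len1 = 0"
  using len1(4) by (simp add: orbit1_sum)

lemma digit1_0: "digit1 0 = N"
  unfolding greedy_expansion_def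
  by (simp, rule greedy_digit_eq) (use N_le_beta upper_gt1 in auto)

lemma digit1_le_orbit1_Suc:
  assumes "0 \<le> orbit1 i" "orbit1 i < 1"
  shows "digit1 i \<le> N \<and> 0 \<le> orbit1 (Suc i) \<and> orbit1 (Suc i) < 1"
proof -
  let ?x = "orbit1 i"
  define k where "k = nat \<lfloor>\<beta> * ?x\<rfloor>"
  have nn: "0 \<le> \<beta> * ?x" using assms beta_gt1 by simp
  then have k: "real k \<le> \<beta> * ?x" "\<beta> * ?x < real k + 1" unfolding k_def by linarith+
  have "\<beta> * ?x < \<beta> * 1" using assms beta_gt1 by (intro mult_strict_left_mono) auto
  then have "k \<le> N" using k beta_less_Suc by linarith
  then have "digit1 i = k"
    unfolding greedy_expansion_def orbit1_def[symmetric]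
    using k upper_gt1 assms by (intro greedy_digit_eq) auto
  then show ?thesis using k \<open>k \<le> N\<close> by (simp add: orbit1_Suc)
qed

lemma orbit1_Suc_range: "0 \<le> orbit1 (Suc i) \<and> orbit1 (Suc i) < 1"
proof (induction i)
  case 0
  show ?case using N_le_beta beta_less_Suc by (simp add: orbit1_Suc digit1_0)
next
  case (Suc i)
  then show ?case using digit1_le_orbit1_Suc by blast
qed

lemma digit1_le: "digit1 i \<le> N"
  by (cases i) (use digit1_0 digit1_le_orbit1_Suc orbit1_Suc_range in auto)

lemma orbit1_nonneg: "0 \<le> orbit1 i" and orbit1_le1: "orbit1 i \<le> 1"
  by (cases i; use orbit1_Suc_range in \<open>force simp: less_imp_le\<close>)+

lemma orbit1_ge:
  assumes "i < len1"
  shows "orbit1 i \<ge> 1 / \<beta>"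
proof -
  have "\<beta> * orbit1 i \<ge> 1"
    using len1(2)[OF assms] orbit1_nonneg[of "Suc i"] by (simp add: orbit1_Suc)
  then show ?thesis using beta_gt1 by (simp add: field_simps)
qed

text \<open>The second digit of \<open>1\<close> is positive, so
  \<open>\<beta> - N \<ge> 1 / \<beta>\<close>; dividing
  \<open>N \<le> \<beta> - 1 / \<beta>\<close> by \<open>\<beta> - 1\<close> bounds
  \<open>upper\<close> by \<open>1 + 1 / \<beta>\<close>.\<close>

lemma overlap_le: "overlap \<le> 1 / \<beta>"
proof -
  have "orbit1 1 \<ge> 1 / \<beta>" using len1(1) by (intro orbit1_ge) simp
  then have "real N \<le> \<beta> - 1 / \<beta>" by (simp add: orbit1_Suc digit1_0)
  then have "real N / (\<beta> - 1) \<le> (\<beta> - 1 / \<beta>) / (\<beta> - 1)"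
    using beta_gt1 by (intro divide_right_mono) auto
  also have "\<dots> = 1 + 1 / \<beta>" using beta_gt1 by (simp add: field_simps)
  finally show ?thesis by (simp add: overlap_def upper_def)
qed

lemma overlap_less1: "overlap < 1"
proof -
  have "1 / \<beta> < 1" using beta_gt1 by simp
  then show ?thesis using overlap_le by linarith
qed

lemma beta_not_int: "real N < \<beta>"
proof -
  have "orbit1 1 \<ge> 1 / \<beta>" using len1(1) by (intro orbit1_ge) simp
  moreover have "1 / \<beta> > 0" using beta_gt1 by simp
  ultimately have "orbit1 1 > 0" by linarith
  then have "\<beta> - real N > 0" by (simp add: orbit1_Suc digit1_0)
  then show ?thesis by simp
qed

lemma ceiling_beta: "\<lceil>\<beta>\<rceil> = int N + 1"
  using beta_not_int beta_less_Suc by (simp add: ceiling_eq_iff)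

section \<open>One step of the random transformation\<close>

lemma S_region_eq: "S_region \<beta> k = {x. real k \<le> \<beta> * x \<and> \<beta> * x \<le> k + overlap}"
proof -
  have b: "\<beta> > 0" using beta_gt1 by simp
  have "N / (\<beta> * (\<beta> - 1)) + (real k - 1) / \<beta> = (k + overlap) / \<beta>"
    using beta_gt1 by (simp add: upper_def overlap_def add_divide_distrib diff_divide_distrib mult.commute)
  then show ?thesis using b by (auto simp: S_region_def field_simps)
qed

lemma switch_region_iff:
  "x \<in> switch_region \<beta> \<longleftrightarrow> (\<exists>k. 1 \<le> k \<and> k \<le> N \<and> real k \<le> \<beta> * x \<and> \<beta> * x \<le> k + overlap)"
  by (auto simp: switch_region_def S_region_eq)

lemma E_region_eq:
  assumes "k \<le> N"
  shows "E_region \<beta> k = {x. (if k = 0 then 0 \<le> x else k + overlap < \<beta> * x) \<and>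
            (if k < N then \<beta> * x < k + 1 else x \<le> upper)}"
proof -
  have b: "\<beta> > 0" using beta_gt1 by simp
  have "N / (\<beta> * (\<beta> - 1)) + (real k - 1) / \<beta> = (k + overlap) / \<beta>"
    using beta_gt1 by (simp add: upper_def overlap_def add_divide_distrib diff_divide_distrib mult.commute)
  then show ?thesis using b assms N_ge1 by (auto simp: E_region_def field_simps Let_def upper_def)
qed

text \<open>\<open>d\<close> is an admissible digit at \<open>x\<close> when \<open>y = \<beta> x - d\<close> is again in \<open>I\<close>. Two digits are
  admissible exactly on the switch region.\<close>

lemma random_step_cases:
  assumes "d \<le> N" "y \<in> I" "\<beta> * x = d + y"
  obtains (lower) "x \<in> switch_region \<beta>" "1 \<le> d" "y \<le> overlap"
        "\<And>\<omega>. random_digit \<beta> (\<omega>, x) = d - 1 + of_bool (\<omega> 0)"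
    | (higher) "x \<in> switch_region \<beta>" "d < N" "1 \<le> y"
        "\<And>\<omega>. random_digit \<beta> (\<omega>, x) = d + of_bool (\<omega> 0)"
    | (forced) "x \<notin> switch_region \<beta>" "d = 0 \<or> y > overlap" "d = N \<or> y < 1"
        "\<And>\<omega>. random_digit \<beta> (\<omega>, x) = d"
proof -
  have y: "0 \<le> y" "y \<le> 1 + overlap" using assms by (auto simp: I_eq overlap_def)
  have S_digit: "random_digit \<beta> (\<omega>, x) = k - 1 + of_bool (\<omega> 0)"
    if k: "1 \<le> k" "k \<le> N" "real k \<le> \<beta> * x" "\<beta> * x \<le> k + overlap" for k \<omega>
  proof -
    have "x \<in> switch_region \<beta>" using k by (auto simp: switch_region_iff)
    moreover have "(THE k. k \<in> {1..N} \<and> x \<in> S_region \<beta> k) = k"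
    proof (rule the_equality)
      fix j assume "j \<in> {1..N} \<and> x \<in> S_region \<beta> j"
      then have "real j \<le> \<beta> * x" "\<beta> * x \<le> j + overlap" by (auto simp: S_region_eq)
      then have "real j < k + 1" "real k < j + 1" using k overlap_less1 by linarith+
      then show "j = k" by linarith
    qed (use k in \<open>auto simp: S_region_eq\<close>)
    ultimately show ?thesis by (simp add: random_digit_def)
  qed
  consider "1 \<le> d" "y \<le> overlap" | "d < N" "1 \<le> y" | "d = 0 \<or> y > overlap" "d = N \<or> y < 1"
    using assms(1) by linarith
  then show thesis
  proof cases
    case 1
    then show thesis using assms y S_digit[of d] by (intro lower) (auto simp: switch_region_iff intro!: exI[of _ d])
  next
    case 2
    then show thesis using assms y S_digit[of "d + 1"]
      by (intro higher) (auto simp: switch_region_iff intro!: exI[of _ "d + 1"])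
  next
    case 3
    have nS: "x \<notin> switch_region \<beta>"
    proof
      assume "x \<in> switch_region \<beta>"
      then obtain k where k: "1 \<le> k" "k \<le> N" "real k \<le> d + y" "d + y \<le> k + overlap"
        using assms(3) by (auto simp: switch_region_iff)
      have "real k < real d + 2" "real d < real k + 1" using k y overlap_less1 by linarith+
      then have "k = d \<or> k = d + 1" by linarith
      then show False using 3 k overlap_less1 assms by auto
    qed
    have bx: "x \<le> upper \<longleftrightarrow> d + y \<le> N + upper" "0 \<le> x \<longleftrightarrow> 0 \<le> d + y"
      using upper_eq assms(3)[symmetric] beta_gt1
       mult_le_cancel_left_pos[of \<beta> x upper] by (auto simp: zero_le_mult_iff)
    have bx1: "x \<le> upper" "0 \<le> x" using bx y assms(1) by (auto simp: overlap_def)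
    have "(THE k. k \<le> N \<and> x \<in> E_region \<beta> k) = d"
    proof (rule the_equality)
      show "d \<le> N \<and> x \<in> E_region \<beta> d"
        using assms(1) 3 y bx1 by (auto simp: E_region_eq assms(3))
      fix j assume j: "j \<le> N \<and> x \<in> E_region \<beta> j"
      then have j': "j = 0 \<or> j + overlap < d + y" "j = N \<or> d + y < j + 1"
        using assms(3) by (auto simp: E_region_eq split: if_splits)
      have "\<not> j < d" using j' j y assms(1) by auto
      moreover have "\<not> d < j" using j' j y assms(1) 3 by auto
      ultimately show "j = d" by simp
    qed
    then show thesis using 3 nS by (intro forced) (auto simp: random_digit_def)
  qed
qed

lemma admissible_exists:
  assumes "x \<in> I"
  obtains d y where "d \<le> N" "y \<in> I" "\<beta> * x = d + y"
proof -
  have x: "0 \<le> x" "x \<le> upper" using assms by (auto simp: I_eq)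
  have b: "0 \<le> \<beta> * x" "\<beta> * x \<le> N + upper"
    using x beta_gt1 upper_eq mult_left_mono[of x upper \<beta>] by auto
  show thesis
  proof (cases "\<beta> * x < N")
    case True
    define k where "k = nat \<lfloor>\<beta> * x\<rfloor>"
    have "real k \<le> \<beta> * x" "\<beta> * x < real k + 1" using b unfolding k_def by linarith+
    then show thesis using True upper_gt1 by (intro that[of k "\<beta> * x - k"]) (auto simp: I_eq)
  next
    case False
    then show thesis using b by (intro that[of N "\<beta> * x - N"]) (auto simp: I_eq)
  qed
qed

lemma random_map_eq:
  "random_map \<beta> (\<omega>, x) = (if x \<in> switch_region \<beta> then (\<lambda>n. \<omega> (Suc n)) else \<omega>, \<beta> * x - random_digit \<beta> (\<omega>, x))"
  by (simp add: random_map_def)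

lemma random_map_in_I:
  assumes "x \<in> I"
  shows "snd (random_map \<beta> (\<omega>, x)) \<in> I" "random_digit \<beta> (\<omega>, x) \<le> N"
proof -
  obtain d y where d: "d \<le> N" "y \<in> I" "\<beta> * x = d + y" using admissible_exists assms by blast
  have "snd (random_map \<beta> (\<omega>, x)) \<in> I \<and> random_digit \<beta> (\<omega>, x) \<le> N"
    using d
  proof (cases rule: random_step_cases)
    case lower
    then show ?thesis using d by (cases "\<omega> 0") (auto simp: random_map_eq I_eq overlap_def)
  next
    case higher
    then show ?thesis using d by (cases "\<omega> 0") (auto simp: random_map_eq I_eq overlap_def)
  next
    case forced
    then show ?thesis using d by (auto simp: random_map_eq)
  qed
  then show "snd (random_map \<beta> (\<omega>, x)) \<in> I" "random_digit \<beta> (\<omega>, x) \<le> N" by auto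
qed

lemma random_orbit_in_I: "snd p \<in> I \<Longrightarrow> snd ((random_map \<beta> ^^ n) p) \<in> I"
proof (induction n)
  case (Suc n)
  then show ?case
    using random_map_in_I(1)[of "snd ((random_map \<beta> ^^ n) p)" "fst ((random_map \<beta> ^^ n) p)"] by simp
qed simp

section \<open>The set \<open>F\<close>: explicit form, symmetry, invariance\<close>

definition F_half :: "real set" where
  "F_half = {orbit1 i | i. i < len1} \<union> {real k / \<beta> | k. k \<le> N}"

lemma F_half_eq_nonneg: "0 \<in> F_half" "1 \<in> F_half"
proof -
  have "\<exists>k. 0 = real k / \<beta> \<and> k \<le> N" by (rule exI[of _ 0]) simp
  then show "0 \<in> F_half" by (auto simp: F_half_def)
  have "\<exists>i. 1 = orbit1 i \<and> i < len1" using len1(1) by (intro exI[of _ 0]) simp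
  then show "1 \<in> F_half" by (auto simp: F_half_def)
qed

text \<open>On the greedy orbit an admissible digit is the greedy one or one less. The smaller digit
  leads to \<open>1 + orbit1 (Suc i)\<close>, which must not exceed \<open>upper\<close>; this
  leaves only the images \<open>1\<close> and \<open>upper\<close>.\<close>

lemma F_half_closed:
  assumes "f \<in> F_half" "d \<le> N" "\<beta> * f - d \<in> I"
  shows "\<beta> * f - d \<in> F_half \<union> (\<lambda>x. upper - x) ` F_half"
proof -
  have y: "0 \<le> \<beta> * f - d" "\<beta> * f - d \<le> 1 + overlap" using assms by (auto simp: I_eq overlap_def)
  note F_half_eq_nonneg[simp]
  consider i where "i < len1" "f = orbit1 i" | k where "k \<le> N" "f = k / \<beta>"
    using assms(1) by (auto simp: F_half_def)
  then show ?thesis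
  proof cases
    case 1
    have e: "\<beta> * f = digit1 i + orbit1 (Suc i)" using 1 by (simp add: orbit1_Suc)
    have r: "0 \<le> orbit1 (Suc i)" "orbit1 (Suc i) < 1" using orbit1_Suc_range[of i] by auto
    have "real d < digit1 i + 1" "real (digit1 i) < d + 2" using y e r overlap_less1 by linarith+
    then have "digit1 i = d \<or> digit1 i = d + 1" by linarith
    moreover have in_F_half: "orbit1 (Suc i) \<in> F_half"
    proof (cases "Suc i < len1")
      case False
      then have "Suc i = len1" using 1 by simp
      then show ?thesis by (simp add: orbit1_len1)
    qed (auto simp: F_half_def)
    ultimately consider "digit1 i = d" | "digit1 i = d + 1" "Suc i = len1" | "digit1 i = d + 1" "Suc i < len1"
      using 1 by linarith
    then show ?thesis
    proof cases
      case 1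
      then show ?thesis using e in_F_half by simp
    next
      case 2
      then show ?thesis using e orbit1_len1 by simp
    next
      case 3
      \<comment> \<open>Squeezed by \<open>1 / \<beta> \<le> orbit1 (Suc i) \<le> overlap \<le> 1 /
        \<beta>\<close>.\<close>
      then have "orbit1 (Suc i) = overlap" using orbit1_ge[of "Suc i"] overlap_le y e by simp
      then have "\<beta> * f - d = upper - 0" using e 3 by (simp add: overlap_def)
      then show ?thesis using F_half_eq_nonneg(1) by blast
    qed
  next
    case 2
    then have e: "\<beta> * f = k" using beta_gt1 by simp
    then have "real d \<le> k" "real k < d + 2" using y overlap_less1 by linarith+
    then have "k = d \<or> k = d + 1" by linarith
    then show ?thesis using e by auto
  qed
qed

lemma reflect_image_iff: "x \<in> (\<lambda>x. upper - x) ` A \<longleftrightarrow> upper - x \<in> A"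
proof
  assume "upper - x \<in> A"
  then show "x \<in> (\<lambda>x. upper - x) ` A" by (intro image_eqI[of _ _ "upper - x"]) auto
qed auto

lemma sym_I: "x \<in> I \<longleftrightarrow> upper - x \<in> I" by (auto simp: I_eq)

text \<open>The reflection \<open>x \<mapsto> upper - x\<close> conjugates the branch with digit
  \<open>d\<close> to the one with digit \<open>N - d\<close>.\<close>

lemma F_half_sym_closed:
  assumes "f \<in> F_half \<union> (\<lambda>x. upper - x) ` F_half" "d \<le> N" "\<beta> * f - d \<in> I"
  shows "\<beta> * f - d \<in> F_half \<union> (\<lambda>x. upper - x) ` F_half"
  using assms(1)
proof
  assume "f \<in> F_half"
  then show ?thesis using F_half_closed assms by blast
next
  assume "f \<in> (\<lambda>x. upper - x) ` F_half"
  then obtain g where g: "g \<in> F_half" "f = upper - g" by auto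
  have e: "\<beta> * g - real (N - d) = upper - (\<beta> * f - d)"
    unfolding g(2) right_diff_distrib upper_eq using assms(2) by (simp add: of_nat_diff)
  then have "\<beta> * g - real (N - d) \<in> I" using assms(3) sym_I by metis
  from F_half_closed[OF g(1) _ this] have "upper - (\<beta> * f - d) \<in> F_half \<union> (\<lambda>x. upper - x) ` F_half"
    using e by auto
  then show ?thesis by (auto simp: reflect_image_iff)
qed

lemma one_in_I: "1 \<in> I" "overlap \<in> I"
  using upper_gt1 overlap_pos by (auto simp: I_eq overlap_def)

lemma F_orbit_sub:
  assumes "x \<in> F_half \<union> (\<lambda>x. upper - x) ` F_half" "x \<in> I"
  shows "snd ((random_map \<beta> ^^ n) (\<omega>, x)) \<in> F_half \<union> (\<lambda>x. upper - x) ` F_half"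
proof (induction n)
  case (Suc n)
  obtain \<omega>' y where p: "(random_map \<beta> ^^ n) (\<omega>, x) = (\<omega>', y)" by fastforce
  have "y \<in> I" using random_orbit_in_I[of "(\<omega>, x)" n] p assms by simp
  then show ?case using Suc F_half_sym_closed[of y "random_digit \<beta> (\<omega>', y)"] random_map_in_I[of y \<omega>'] p
    by (simp add: random_map_eq)
qed (use assms in simp)

lemma orbit1_in_I: "orbit1 i \<in> I"
  using orbit1_nonneg[of i] orbit1_le1[of i] upper_gt1 by (auto simp: I_eq)

text \<open>The constant coin \<open>True\<close> always picks the larger digit, which is the greedy
  choice. This realises the points \<open>orbit1 i\<close> inside \<open>F_set\<close>;
  \<open>lazy_orbit\<close> does the same for their reflections.\<close>

lemma greedy_orbit:
  "(random_map \<beta> ^^ i) (\<lambda>_. True, 1) = (\<lambda>_. True, orbit1 i)" if "i \<le> len1"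
  using that
proof (induction i)
  case (Suc i)
  have d: "digit1 i \<le> N" "orbit1 (Suc i) \<in> I" "\<beta> * orbit1 i = digit1 i + orbit1 (Suc i)"
    using digit1_le orbit1_in_I[of "Suc i"] by (auto simp: orbit1_Suc)
  have "random_map \<beta> (\<lambda>_. True, orbit1 i) = (\<lambda>_. True, orbit1 (Suc i))"
    using d
  proof (cases rule: random_step_cases)
    case lower
    then show ?thesis using d by (auto simp: random_map_eq)
  next
    case higher
    then show ?thesis using orbit1_Suc_range[of i] by simp
  next
    case forced
    then show ?thesis using d by (auto simp: random_map_eq)
  qed
  then show ?case using Suc by simp
qed simp

lemma lazy_orbit:
  "(random_map \<beta> ^^ i) (\<lambda>_. False, overlap) = (\<lambda>_. False, upper - orbit1 i)" if "i \<le> len1"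
  using that
proof (induction i)
  case (Suc i)
  have d: "N - digit1 i \<le> N" "upper - orbit1 (Suc i) \<in> I"
    "\<beta> * (upper - orbit1 i) = real (N - digit1 i) + (upper - orbit1 (Suc i))"
    using digit1_le[of i] orbit1_in_I[of "Suc i"] sym_I
    by (auto simp: orbit1_Suc right_diff_distrib upper_eq of_nat_diff)
  have "random_map \<beta> (\<lambda>_. False, upper - orbit1 i) = (\<lambda>_. False, upper - orbit1 (Suc i))"
    using d
  proof (cases rule: random_step_cases)
    case lower
    then show ?thesis using orbit1_Suc_range[of i] by (simp add: overlap_def)
  next
    case higher
    then show ?thesis using d by (auto simp: random_map_eq)
  next
    case forced
    then show ?thesis using d by (auto simp: random_map_eq)
  qed
  then show ?case using Suc by simp
qed (simp add: overlap_def)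

text \<open>Replaces the orbits over all coin sequences by an explicit finite set: no random orbit
  of \<open>1\<close> or \<open>overlap\<close> leaves the right-hand side, and the greedy and lazy
  orbits already exhaust it. Finiteness, invariance and symmetry of \<open>F\<close> are read
  off.\<close>

lemma F_eq: "F = F_half \<union> (\<lambda>x. upper - x) ` F_half"
proof -
  have e1: "N / (\<beta> * (\<beta> - 1)) + real k / \<beta> = upper - real (N - k) / \<beta>" if "k \<le> N" for k
    using that beta_gt1 by (simp add: upper_def of_nat_diff field_simps)
  have "overlap \<in> (\<lambda>x. upper - x) ` F_half" using F_half_eq_nonneg by (auto simp: overlap_def)
  then have sub1: "snd ((random_map \<beta> ^^ n) (\<omega>, 1)) \<in> F_half \<union> (\<lambda>x. upper - x) ` F_half"
    "snd ((random_map \<beta> ^^ n) (\<omega>, overlap)) \<in> F_half \<union> (\<lambda>x. upper - x) ` F_half" for n \<omega>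
    using F_orbit_sub one_in_I F_half_eq_nonneg by blast+
  have sub2: "N / (\<beta> * (\<beta> - 1)) + real k / \<beta> \<in> (\<lambda>x. upper - x) ` F_half" if "k \<le> N" for k
    unfolding e1[OF that] F_half_def by (rule imageI) auto
  have o1: "N / (\<beta> - 1) - 1 = overlap" by (simp add: overlap_def upper_def)
  have sup1: "orbit1 i \<in> F" if "i < len1" for i
    proof -
    have "orbit1 i = snd ((random_map \<beta> ^^ i) (\<lambda>_. True, 1))" using greedy_orbit[of i] that by simp
    then show ?thesis unfolding F_set_def by blast
  qed
  have sup2: "upper - orbit1 i \<in> F" if "i < len1" for i
    proof -
    have "upper - orbit1 i = snd ((random_map \<beta> ^^ i) (\<lambda>_. False, overlap))" using lazy_orbit[of i] that by simp
    then show ?thesis unfolding F_set_def o1 by blast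
  qed
  have sup3: "upper - real k / \<beta> \<in> F" if "k \<le> N" for k
  proof -
    have "upper - real k / \<beta> = N / (\<beta> * (\<beta> - 1)) + real (N - k) / \<beta>" "N - k \<le> N"
      using e1[of "N - k"] that by simp_all
    then show ?thesis unfolding F_set_def by blast
  qed
  have sup4: "real k / \<beta> \<in> F" if "k \<le> N" for k
    using that unfolding F_set_def by auto
  show ?thesis
  proof (rule antisym)
    show "F \<subseteq> F_half \<union> (\<lambda>x. upper - x) ` F_half"
    proof
      fix x assume "x \<in> F"
      then have "(\<exists>n \<omega>. x = snd ((random_map \<beta> ^^ n) (\<omega>, 1))) \<or>
          (\<exists>n \<omega>. x = snd ((random_map \<beta> ^^ n) (\<omega>, overlap))) \<or> (\<exists>k\<le>N. x = real k / \<beta>) \<or>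
          (\<exists>k\<le>N. x = N / (\<beta> * (\<beta> - 1)) + real k / \<beta>)"
        unfolding F_set_def o1 by blast
      moreover have "real k / \<beta> \<in> F_half" if "k \<le> N" for k using that by (auto simp: F_half_def)
      ultimately show "x \<in> F_half \<union> (\<lambda>x. upper - x) ` F_half" using sub1 sub2 by blast
    qed
    show "F_half \<union> (\<lambda>x. upper - x) ` F_half \<subseteq> F"
      using sup1 sup2 sup3 sup4 by (auto simp: F_half_def)
  qed
qed

lemma finite_F: "finite F"
proof -
  have "F_half = orbit1 ` {..<len1} \<union> (\<lambda>k. real k / \<beta>) ` {..N}" by (auto simp: F_half_def)
  then have "finite F_half" by simp
  then show ?thesis by (simp add: F_eq)
qed

lemma F_closed: "f \<in> F \<Longrightarrow> d \<le> N \<Longrightarrow> \<beta> * f - d \<in> I \<Longrightarrow> \<beta> * f - d \<in> F"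
  unfolding F_eq by (rule F_half_sym_closed)

lemma F_sym: "f \<in> F \<longleftrightarrow> upper - f \<in> F"
  by (auto simp: F_eq reflect_image_iff)

lemma zero_in_F: "0 \<in> F" and upper_in_F: "upper \<in> F" and one_in_F: "1 \<in> F" and overlap_in_F: "overlap \<in> F"
  using F_half_eq_nonneg F_sym[of 0] F_sym[of 1] by (auto simp: F_eq overlap_def)

lemma div_beta_in_F: "k \<le> N \<Longrightarrow> real k / \<beta> \<in> F"
  by (auto simp: F_eq F_half_def)

lemma F_half_in_I: "F_half \<subseteq> I"
proof -
  have "real k / \<beta> \<in> I" if "k \<le> N" for k
  proof -
    have "real k / \<beta> \<le> 1" using that beta_not_int beta_gt1 by (simp add: field_simps)
    then have "real k / \<beta> \<le> upper" using upper_gt1 by linarith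
    then show ?thesis using beta_gt1 by (auto simp: I_eq)
  qed
  then show ?thesis using orbit1_in_I by (auto simp: F_half_def)
qed

lemma F_in_I: "F \<subseteq> I"
  using F_half_in_I sym_I by (auto simp: F_eq)

text \<open>This makes the interior of each switch region a single gap of \<open>F\<close>.\<close>

lemma F_gap: "f \<in> F \<Longrightarrow> 0 < f \<Longrightarrow> overlap \<le> f"
proof -
  assume "f \<in> F" "0 < f"
  \<comment> \<open>Points of \<open>F_half\<close> are \<open>0\<close> or at least
    \<open>1 / \<beta>\<close>, hence at least \<open>overlap\<close>; since they are at most
    \<open>1\<close>, their reflections are at least \<open>upper - 1 = overlap\<close>.\<close>
  have a: "f = 0 \<or> 1 / \<beta> \<le> f" if "f \<in> F_half" for f
    using that orbit1_ge beta_gt1 by (auto simp: F_half_def divide_le_cancel)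
  have b: "f \<le> 1" if "f \<in> F_half" for f
    using that orbit1_le1 beta_not_int beta_gt1 by (auto simp: F_half_def divide_le_eq)
  show ?thesis using \<open>f \<in> F\<close> \<open>0 < f\<close> a overlap_le b by (force simp: F_eq overlap_def)
qed

text \<open>The digit \<open>k\<close> would map such a point to a point of \<open>F\<close> in the
  empty interval \<open>(0, overlap)\<close>.\<close>

lemma F_gap_switch:
  assumes "f \<in> F" "k \<le> N"
  shows "\<not> (k < \<beta> * f \<and> \<beta> * f < k + overlap)"
proof
  assume *: "k < \<beta> * f \<and> \<beta> * f < k + overlap"
  then have "\<beta> * f - k \<in> F" using assms overlap_less1 upper_gt1 by (intro F_closed) (auto simp: I_eq)
  then show False using F_gap[of "\<beta> * f - k"] * by simp
qed

lemma switch_end_in_F: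
  assumes "1 \<le> k" "k \<le> N"
  shows "(k + overlap) / \<beta> \<in> F"
proof -
  have "(k + overlap) / \<beta> = upper - real (N - k + 1) / \<beta>"
    using assms upper_eq beta_gt1 by (simp add: of_nat_diff overlap_def field_simps)
  then show ?thesis using assms div_beta_in_F[of "N - k + 1"] F_sym by simp
qed

section \<open>Digit sequences as points with coin tosses\<close>

sublocale digits: uniform_seq_space "{0..N}"
  by unfold_locales auto

abbreviation D :: "(nat \<Rightarrow> nat) measure" where "D \<equiv> uniform_seqs {0..N}"

lemma digit_bernoulli_eq: "digit_bernoulli \<beta> = D"
  by (simp add: digit_bernoulli_def uniform_seqs_def)

lemma space_D: "b \<in> space D \<longleftrightarrow> (\<forall>i. b i \<le> N)"
  by (simp add: digits.space_D)

lemma drop_in_D [simp]: "b \<in> space D \<Longrightarrow> drop_seq n b \<in> space D"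
  by (simp add: space_D)

definition bval :: "(nat \<Rightarrow> nat) \<Rightarrow> real" where
  "bval b = (\<Sum>k. real (b k) / \<beta> ^ (k + 1))"

lemma geometric_sums: "(\<lambda>k. real a / \<beta> ^ (k + 1)) sums (a / (\<beta> - 1))"
proof -
  have b: "\<beta> > 1" by (rule beta_gt1)
  have "(\<lambda>k. (a / \<beta>) * (1 / \<beta>) ^ k) sums ((a / \<beta>) * (1 / (1 - 1 / \<beta>)))"
    using b by (intro sums_mult geometric_sums) (simp add: field_simps)
  also have "(a / \<beta>) * (1 / (1 - 1 / \<beta>)) = a / (\<beta> - 1)" using b by (simp add: field_simps)
  finally show ?thesis by (simp add: power_divide mult.commute)
qed

lemma bval_summable:
  assumes "b \<in> space D"
  shows "summable (\<lambda>k. real (b k) / \<beta> ^ (k + 1))"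
proof (rule summable_comparison_test[OF _ sums_summable[OF geometric_sums[of N]]])
  show "\<exists>M. \<forall>n\<ge>M. norm (real (b n) / \<beta> ^ (n + 1)) \<le> real N / \<beta> ^ (n + 1)"
    using assms beta_gt1 by (auto simp: space_D intro!: divide_right_mono)
qed

lemma bval_in_I:
  assumes "b \<in> space D"
  shows "bval b \<in> I"
proof -
  have "bval b \<le> (\<Sum>k. real N / \<beta> ^ (k + 1))"
    unfolding bval_def using assms beta_gt1
    by (intro suminf_le bval_summable sums_summable[OF geometric_sums]) (auto simp: space_D intro!: divide_right_mono)
  also have "\<dots> = upper" using sums_unique[OF geometric_sums[of N]] by (simp add: upper_def)
  finally have "bval b \<le> upper" .
  moreover have "bval b \<ge> 0"
    unfolding bval_def using assms beta_gt1 by (intro suminf_nonneg bval_summable) auto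
  ultimately show ?thesis by (simp add: I_eq)
qed

lemma bval_step:
  assumes "b \<in> space D"
  shows "\<beta> * bval b = b 0 + bval (drop_seq 1 b)"
proof -
  have s: "summable (\<lambda>k. real (b k) / \<beta> ^ k)"
    using summable_mult[OF bval_summable[OF assms], of \<beta>] beta_gt1 by simp
  have "\<beta> * bval b = (\<Sum>k. \<beta> * (real (b k) / \<beta> ^ (k + 1)))"
    unfolding bval_def by (rule suminf_mult[OF bval_summable[OF assms], symmetric])
  also have "\<dots> = (\<Sum>k. real (b k) / \<beta> ^ k)" using beta_gt1 by simp
  also have "\<dots> = b 0 + (\<Sum>k. real (b (Suc k)) / \<beta> ^ Suc k)"
    using suminf_split_head[OF s] by simp
  also have "(\<Sum>k. real (b (Suc k)) / \<beta> ^ Suc k) = bval (drop_seq 1 b)"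
    by (simp add: bval_def)
  finally show ?thesis .
qed

text \<open>Expansiveness: the difference of two solutions of the digit recursion is multiplied by
  \<open>\<beta>\<close> at every step, yet stays bounded by \<open>upper\<close>.\<close>

lemma bval_unique:
  assumes b: "b \<in> space D" and x: "\<And>n. x n \<in> I" "\<And>n. \<beta> * x n = b n + x (Suc n)"
  shows "x 0 = bval b"
proof -
  have e: "x 0 - bval b = (x n - bval (drop_seq n b)) / \<beta> ^ n" for n
  proof (induction n)
    case (Suc n)
    have "\<beta> * bval (drop_seq n b) = b n + bval (drop_seq (Suc n) b)"
      using bval_step[of "drop_seq n b"] b by simp
    then have "x (Suc n) - bval (drop_seq (Suc n) b) = \<beta> * (x n - bval (drop_seq n b))"
      using x(2)[of n] by (simp add: right_diff_distrib)
    then show ?case using Suc beta_gt1 by (simp del: drop_seq_nth)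
  qed simp
  have bd: "\<bar>x n - bval (drop_seq n b)\<bar> \<le> upper" for n
    using x(1)[of n] bval_in_I[of "drop_seq n b"] b by (auto simp: I_eq)
  have lim: "(\<lambda>n. upper / \<beta> ^ n) \<longlonglongrightarrow> 0"
    using LIMSEQ_divide_realpow_zero[OF beta_gt1] .
  have "\<bar>x 0 - bval b\<bar> \<le> upper / \<beta> ^ n" for n
    using bd[of n] beta_gt1 by (subst e[of n]) (simp add: abs_divide power_abs divide_right_mono)
  then have "\<bar>x 0 - bval b\<bar> \<le> 0" by (intro LIMSEQ_le_const[OF lim]) auto
  then show ?thesis by simp
qed

lemma is_beta_expansion_iff: "is_beta_expansion \<beta> x b \<longleftrightarrow> b \<in> space D \<and> bval b = x"
  unfolding is_beta_expansion_def space_D[symmetric] bval_def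
  using bval_summable sums_unique summable_sums by blast

lemma bval_reflect:
  assumes "b \<in> space D"
  shows "bval (\<lambda>i. N - b i) = upper - bval b"
proof -
  let ?r = "\<lambda>b i. N - b i"
  have "upper - bval (drop_seq 0 b) = bval (?r b)"
  proof (rule bval_unique[where x = "\<lambda>n. upper - bval (drop_seq n b)"])
    show "?r b \<in> space D" by (simp add: space_D)
    show "upper - bval (drop_seq n b) \<in> I" for n using bval_in_I[of "drop_seq n b"] assms sym_I by simp
    show "\<beta> * (upper - bval (drop_seq n b)) = real (N - b n) + (upper - bval (drop_seq (Suc n) b))" for n
      using bval_step[of "drop_seq n b"] assms
      by (simp add: right_diff_distrib upper_eq of_nat_diff space_D)
  qed
  then show ?thesis by simp
qed

abbreviation visit :: "(nat \<Rightarrow> nat) \<Rightarrow> bool" where "visit b \<equiv> bval b \<in> switch_region \<beta>"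

definition hit :: "(nat \<Rightarrow> nat) \<Rightarrow> nat" where "hit b = (LEAST n. visit (drop_seq n b))"

text \<open>At a visit the coin is \<open>1\<close> iff the larger of the two admissible digits is used, i.e. iff the next
  point lies in \<open>[0, overlap]\<close> rather than in \<open>[1, upper]\<close>. For sequences without further visits
  \<open>hit\<close> and \<open>coins\<close> are junk.\<close>

primrec coins :: "(nat \<Rightarrow> nat) \<Rightarrow> nat \<Rightarrow> bool" where
  "coins b 0 = (bval (drop_seq (Suc (hit b)) b) < 1)"
| "coins b (Suc i) = coins (drop_seq (Suc (hit b)) b) i"

definition recurrent :: "(nat \<Rightarrow> nat) \<Rightarrow> bool" where
  "recurrent b \<longleftrightarrow> (\<exists>\<^sub>\<infinity>n. visit (drop_seq n b))"

lemma recurrent_drop [simp]: "recurrent (drop_seq n b) \<longleftrightarrow> recurrent b"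
  unfolding recurrent_def drop_seq_drop_seq by (rule INFM_shift)

lemma recurrent_ex_visit: "recurrent b \<Longrightarrow> \<exists>n. visit (drop_seq n b)"
  unfolding recurrent_def using INFM_EX by blast

lemma hit_visit [simp]: "visit b \<Longrightarrow> hit b = 0"
  by (simp add: hit_def)

lemma hit_not_visit:
  assumes "recurrent b" "\<not> visit b"
  shows "hit b = Suc (hit (drop_seq 1 b))"
proof -
  obtain n where "visit (drop_seq n b)" using recurrent_ex_visit assms by blast
  then have "(LEAST n. visit (drop_seq n b)) = Suc (LEAST m. visit (drop_seq (Suc m) b))"
    by (rule Least_Suc) (use assms in simp)
  then show ?thesis by (simp add: hit_def)
qed

lemma coins_visit: "visit b \<Longrightarrow> coins b 0 = (bval (drop_seq 1 b) < 1)"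
  "visit b \<Longrightarrow> (\<lambda>i. coins b (Suc i)) = coins (drop_seq 1 b)"
  by simp_all

lemma coins_not_visit:
  assumes "recurrent b" "\<not> visit b"
  shows "coins b = coins (drop_seq 1 b)"
proof
  fix i show "coins b i = coins (drop_seq 1 b) i"
    by (cases i) (simp_all add: hit_not_visit assms)
qed

text \<open>The inverse of the map \<open>\<phi>\<close>, see \<open>random_expansion_image\<close>.\<close>

definition decode :: "(nat \<Rightarrow> nat) \<Rightarrow> (nat \<Rightarrow> bool) \<times> real" where
  "decode b = (coins b, bval b)"

lemma digit_cases:
  assumes "b \<in> space D"
  obtains (lower) "visit b" "1 \<le> b 0" "bval (drop_seq 1 b) \<le> overlap"
        "\<And>\<omega>. random_digit \<beta> (\<omega>, bval b) = b 0 - 1 + of_bool (\<omega> 0)"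
    | (higher) "visit b" "b 0 < N" "1 \<le> bval (drop_seq 1 b)"
        "\<And>\<omega>. random_digit \<beta> (\<omega>, bval b) = b 0 + of_bool (\<omega> 0)"
    | (forced) "\<not> visit b" "b 0 = 0 \<or> bval (drop_seq 1 b) > overlap" "b 0 = N \<or> bval (drop_seq 1 b) < 1"
        "\<And>\<omega>. random_digit \<beta> (\<omega>, bval b) = b 0"
  using random_step_cases[of "b 0" "bval (drop_seq 1 b)" "bval b"] bval_step[OF assms] bval_in_I[of "drop_seq 1 b"] assms
  by (metis drop_in_D space_D)

lemma random_digit_decode:
  assumes b: "b \<in> space D"
  shows "random_digit \<beta> (decode b) = b 0"
  using assms
proof (cases rule: digit_cases)
  case lower
  then have "coins b 0" using overlap_less1 by (simp add: coins_visit)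
  then show ?thesis using lower by (simp add: decode_def)
next
  case higher
  then have "\<not> coins b 0" by (simp add: coins_visit)
  then show ?thesis using higher by (simp add: decode_def)
next
  case forced
  then show ?thesis by (simp add: decode_def)
qed

text \<open>\<open>decode\<close> conjugates the left shift to the random map. At a visit both sides
  drop one coin; otherwise recurrence guarantees a later visit, so the waiting time falls by one and
  the coins are unchanged.\<close>

lemma random_map_decode:
  assumes b: "b \<in> space D" and r: "recurrent b"
  shows "random_map \<beta> (decode b) = decode (drop_seq 1 b)"
proof -
  have "\<beta> * bval b - random_digit \<beta> (decode b) = bval (drop_seq 1 b)"
    using random_digit_decode[OF b] bval_step[OF b] by simp
  then show ?thesis
    using coins_visit(2)[of b] coins_not_visit[OF r] by (auto simp: decode_def random_map_eq)
qed

lemma random_orbit_decode: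
  assumes b: "b \<in> space D" and r: "recurrent b"
  shows "(random_map \<beta> ^^ n) (decode b) = decode (drop_seq n b)"
proof (induction n)
  case (Suc n)
  then show ?case using random_map_decode[of "drop_seq n b"] assms by (simp del: drop_seq_nth)
qed simp

lemma random_expansion_decode:
  assumes b: "b \<in> space D" and r: "recurrent b"
  shows "random_expansion \<beta> (decode b) = b"
  unfolding random_expansion_def fun_eq_iff
  using random_orbit_decode[OF b r] random_digit_decode[of "drop_seq _ b"] b by simp

section \<open>Digit expansions of random orbits, and the inverse of \<open>decode\<close>\<close>

lemma random_expansion_in_D:
  assumes "snd p \<in> I"
  shows "random_expansion \<beta> p \<in> space D"
  using random_map_in_I(2)[OF random_orbit_in_I[OF assms]] unfolding space_D random_expansion_def
  by (metis prod.collapse)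

lemma random_map_snd: "snd (random_map \<beta> p) = \<beta> * snd p - random_digit \<beta> p"
  by (cases p) (simp add: random_map_eq)

lemma random_map_fst: "fst (random_map \<beta> p) = (if snd p \<in> switch_region \<beta> then (\<lambda>n. fst p (Suc n)) else fst p)"
  by (cases p) (simp add: random_map_eq)

lemma random_expansion_drop: "drop_seq n (random_expansion \<beta> p) = random_expansion \<beta> ((random_map \<beta> ^^ n) p)"
  by (simp add: random_expansion_def fun_eq_iff funpow_add)

lemma bval_random_expansion:
  assumes "snd p \<in> I"
  shows "bval (random_expansion \<beta> p) = snd p"
proof -
  have "snd ((random_map \<beta> ^^ 0) p) = bval (random_expansion \<beta> p)"
    by (rule bval_unique[where x="\<lambda>n. snd ((random_map \<beta> ^^ n) p)"])
      (use assms random_orbit_in_I random_expansion_in_D in \<open>auto simp: random_map_snd random_expansion_def\<close>)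
  then show ?thesis by simp
qed

lemma bval_drop_random_expansion:
  assumes "snd p \<in> I"
  shows "bval (drop_seq n (random_expansion \<beta> p)) = snd ((random_map \<beta> ^^ n) p)"
  using bval_random_expansion[OF random_orbit_in_I[OF assms]] by (simp add: random_expansion_drop)

lemma recurrent_set_iff: "p \<in> recurrent_set \<beta> \<longleftrightarrow> snd p \<in> I \<and> recurrent (random_expansion \<beta> p)"
proof -
  have "p \<in> recurrent_set \<beta> \<longleftrightarrow> snd p \<in> I \<and> (\<exists>\<^sub>\<infinity>n. snd ((random_map \<beta> ^^ n) p) \<in> switch_region \<beta>)"
    by (cases p) (simp add: recurrent_set_def frequently_cofinite)
  then show ?thesis by (auto simp: recurrent_def bval_drop_random_expansion)
qed

text \<open>At a visit the digit reveals the coin (\<open>step\<close>). Induction over the waiting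
  time carries this to the next visit (\<open>first\<close>), and induction over the coin index then
  reaches all later visits.\<close>

lemma coins_random_expansion:
  assumes "snd p \<in> I" "recurrent (random_expansion \<beta> p)"
  shows "coins (random_expansion \<beta> p) = fst p"
proof -
  have step: "coins (random_expansion \<beta> p) 0 = fst p 0"
    if p: "snd p \<in> I" "visit (random_expansion \<beta> p)" for p
  proof -
    let ?b = "random_expansion \<beta> p"
    have b: "?b \<in> space D" using random_expansion_in_D p by blast
    have v: "bval ?b = snd p" by (rule bval_random_expansion[OF p(1)])
    have e: "random_digit \<beta> (fst p, bval ?b) = ?b 0" unfolding v by (simp add: random_expansion_def)
    show ?thesis
      using b
    proof (cases rule: digit_cases)
      case lower
      then have "fst p 0" using e by (cases "fst p 0") auto
      then show ?thesis using lower overlap_less1 by simp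
    next
      case higher
      then have "\<not> fst p 0" using e by (cases "fst p 0") auto
      then show ?thesis using higher by simp
    next
      case forced
      then show ?thesis using p by simp
    qed
  qed
  have first: "\<forall>p. hit (random_expansion \<beta> p) = n \<longrightarrow> snd p \<in> I \<longrightarrow> recurrent (random_expansion \<beta> p) \<longrightarrow>
      coins (random_expansion \<beta> p) 0 = fst p 0 \<and>
      fst ((random_map \<beta> ^^ Suc (hit (random_expansion \<beta> p))) p) = (\<lambda>i. fst p (Suc i))" for n
  proof (induction n)
    case 0
    have "visit (random_expansion \<beta> p)" if "hit (random_expansion \<beta> p) = 0" "recurrent (random_expansion \<beta> p)" for p
      using hit_not_visit that by force
    moreover have "fst ((random_map \<beta> ^^ Suc 0) p) = (\<lambda>i. fst p (Suc i))"
      if "visit (random_expansion \<beta> p)" "snd p \<in> I" for p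
      using that by (simp add: random_map_fst bval_random_expansion)
    ultimately show ?case using step by metis
  next
    case (Suc n)
    show ?case
    proof (intro allI impI)
      fix p assume *: "hit (random_expansion \<beta> p) = Suc n" "snd p \<in> I" "recurrent (random_expansion \<beta> p)"
      let ?q = "random_map \<beta> p" and ?b = "random_expansion \<beta> p"
      have nv: "\<not> visit ?b" using * by auto
      then have f: "fst ?q = fst p" using * by (simp add: random_map_fst bval_random_expansion)
      have d: "drop_seq 1 ?b = random_expansion \<beta> ?q" by (simp add: random_expansion_drop)
      have h: "hit ?b = Suc (hit (random_expansion \<beta> ?q))" using hit_not_visit[of ?b] * nv d by simp
      have "snd ?q \<in> I" using random_orbit_in_I[of p 1] * by simp
      moreover have "recurrent (random_expansion \<beta> ?q)" using *(3) d recurrent_drop by metis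
      ultimately have "coins (random_expansion \<beta> ?q) 0 = fst ?q 0 \<and>
          fst ((random_map \<beta> ^^ Suc (hit (random_expansion \<beta> ?q))) ?q) = (\<lambda>i. fst ?q (Suc i))"
        using Suc[rule_format, of ?q] *(1) h by simp
      then show "coins ?b 0 = fst p 0 \<and> fst ((random_map \<beta> ^^ Suc (hit ?b)) p) = (\<lambda>i. fst p (Suc i))"
        using coins_not_visit[of ?b] * nv d h f by (metis funpow_Suc_right o_apply)
    qed
  qed
  have "coins (random_expansion \<beta> p) i = fst p i" if "snd p \<in> I" "recurrent (random_expansion \<beta> p)" for i p
    using that
  proof (induction i arbitrary: p)
    case 0
    then show ?case using first by blast
  next
    case (Suc i)
    let ?b = "random_expansion \<beta> p"
    let ?q = "(random_map \<beta> ^^ Suc (hit ?b)) p"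
    have d: "drop_seq (Suc (hit ?b)) ?b = random_expansion \<beta> ?q" by (rule random_expansion_drop)
    have "coins (random_expansion \<beta> ?q) i = fst ?q i"
    proof (rule Suc.IH)
      show "snd ?q \<in> I" using random_orbit_in_I Suc.prems by blast
      show "recurrent (random_expansion \<beta> ?q)" using Suc.prems(2) d recurrent_drop by metis
    qed
    moreover have "fst ?q = (\<lambda>i. fst p (Suc i))" using first Suc.prems by blast
    ultimately show ?case using d by simp
  qed
  then show ?thesis using assms by blast
qed

lemma decode_random_expansion:
  assumes "snd p \<in> I" "recurrent (random_expansion \<beta> p)"
  shows "decode (random_expansion \<beta> p) = p"
  by (simp add: decode_def coins_random_expansion[OF assms] bval_random_expansion[OF assms(1)])

text \<open>Turns an image under \<phi> into a preimage under \<open>decode\<close>, so that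
  measurability of the images and countable additivity of \<open>nu\<close> become questions about
  \<open>decode\<close>.\<close>

lemma random_expansion_image:
  "random_expansion \<beta> ` (X \<inter> recurrent_set \<beta>) = {b \<in> space D. recurrent b \<and> decode b \<in> X}"
proof (intro set_eqI iffI)
  fix b assume "b \<in> random_expansion \<beta> ` (X \<inter> recurrent_set \<beta>)"
  then show "b \<in> {b \<in> space D. recurrent b \<and> decode b \<in> X}"
    by (auto simp: recurrent_set_iff decode_random_expansion random_expansion_in_D)
next
  fix b assume b: "b \<in> {b \<in> space D. recurrent b \<and> decode b \<in> X}"
  then have "snd (decode b) \<in> I" using bval_in_I by (simp add: decode_def)
  then have "decode b \<in> X \<inter> recurrent_set \<beta>" using b by (simp add: recurrent_set_iff random_expansion_decode)
  then show "b \<in> random_expansion \<beta> ` (X \<inter> recurrent_set \<beta>)"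
    using random_expansion_decode[of b] b by (metis (no_types, lifting) image_eqI mem_Collect_eq)
qed

section \<open>Measurability of values, hitting times and coins\<close>

lemma borel_bval [measurable]: "bval \<in> borel_measurable D"
proof -
  have [measurable]: "(\<lambda>b. real (b k)) \<in> borel_measurable D" for k
    by (rule measurable_compose[OF digits.measurable_nth]) simp
  show ?thesis unfolding bval_def by measurable
qed

lemma sets_switch_region [measurable]: "switch_region \<beta> \<in> sets borel"
  by (auto simp: switch_region_def S_region_def)

lemma measurable_drop [measurable]: "drop_seq n \<in> D \<rightarrow>\<^sub>M D"
  by (rule digits.measurable_drop_seq)

lemma measurable_visit [measurable]: "Measurable.pred D visit"
  by measurable

lemma measurable_hit [measurable]: "hit \<in> D \<rightarrow>\<^sub>M count_space UNIV"
  unfolding hit_def by measurable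

lemma measurable_drop_hit [measurable]: "(\<lambda>b. drop_seq (Suc (hit b)) b) \<in> D \<rightarrow>\<^sub>M D"
  by (rule measurable_compose_countable) measurable

lemma measurable_coins [measurable]: "Measurable.pred D (\<lambda>b. coins b i)"
proof (induction i)
  case 0
  have "Measurable.pred D (\<lambda>b. bval (drop_seq (Suc (hit b)) b) < 1)" by measurable
  then show ?case by simp
next
  case (Suc i)
  have "Measurable.pred D (\<lambda>b. coins (drop_seq (Suc (hit b)) b) i)"
    by (rule measurable_compose[OF measurable_drop_hit Suc])
  then show ?case by simp
qed

lemma measurable_recurrent [measurable]: "Measurable.pred D recurrent"
  unfolding recurrent_def INFM_nat_le by measurable

section \<open>Fairness of the coin tosses\<close>

text \<open>Such sequences visit the switch region infinitely often, and since \<open>F\<close> is closed under the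
  dynamics and has no point in \<open>(0, overlap)\<close>, their orbits avoid \<open>F\<close>.\<close>

definition good :: "(nat \<Rightarrow> nat) \<Rightarrow> bool" where
  "good b \<longleftrightarrow> (\<exists>\<^sub>\<infinity>n. b n \<ge> 1 \<and> 0 < bval (drop_seq (Suc n) b) \<and> bval (drop_seq (Suc n) b) < overlap)"

lemma good_drop [simp]: "good (drop_seq n b) \<longleftrightarrow> good b"
  using INFM_shift[of "\<lambda>n. b n \<ge> 1 \<and> 0 < bval (drop_seq (Suc n) b) \<and> bval (drop_seq (Suc n) b) < overlap" n]
  by (simp add: good_def)

lemma good_recurrent:
  assumes "b \<in> space D" "good b"
  shows "recurrent b"
  using assms(2) unfolding good_def recurrent_def
proof (rule INFM_mono)
  fix n assume *: "b n \<ge> 1 \<and> 0 < bval (drop_seq (Suc n) b) \<and> bval (drop_seq (Suc n) b) < overlap"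
  have "drop_seq n b \<in> space D" using assms by simp
  then show "visit (drop_seq n b)" by (cases rule: digit_cases) (use * overlap_less1 in auto)
qed

lemma good_not_F:
  assumes b: "b \<in> space D" "good b"
  shows "bval b \<notin> F"
proof
  assume F: "bval b \<in> F"
  have "bval (drop_seq n b) \<in> F" for n
  proof (induction n)
    case (Suc n)
    have e: "\<beta> * bval (drop_seq n b) - b n = bval (drop_seq (Suc n) b)"
      using bval_step[of "drop_seq n b"] b by simp
    have "b n \<le> N" "bval (drop_seq (Suc n) b) \<in> I" using b(1) bval_in_I[OF drop_in_D[OF b(1)], of "Suc n"]
      by (simp_all only: space_D)
    then show ?case using F_closed[OF Suc, of "b n"] by (simp only: e)
  qed (use F in simp)
  moreover obtain n where "0 < bval (drop_seq (Suc n) b)" "bval (drop_seq (Suc n) b) < overlap"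
    using INFM_EX[OF b(2)[unfolded good_def]] by blast
  ultimately show False using F_gap not_le by blast
qed

lemma good_in_I_F: "b \<in> space D \<Longrightarrow> good b \<Longrightarrow> bval b \<in> I - F"
  using bval_in_I good_not_F by blast

lemma measurable_good [measurable]: "Measurable.pred D good"
  unfolding good_def INFM_nat_le by measurable

lemma bval_zeros:
  assumes "b \<in> space D" "\<And>i. i < R \<Longrightarrow> b i = 0"
  shows "bval b = bval (drop_seq R b) / \<beta> ^ R"
  using assms(2)
proof (induction R)
  case (Suc R)
  have "\<beta> * bval (drop_seq R b) = bval (drop_seq (Suc R) b)"
    using bval_step[of "drop_seq R b"] assms Suc.prems[of R] by simp
  then show ?case using Suc beta_gt1 by (simp del: drop_seq_nth add: field_simps)
qed simp

lemma bval_first_pos: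
  assumes "b \<in> space D" "b 0 \<ge> 1"
  shows "bval b > 0"
proof -
  have "\<beta> * bval b > 0" using bval_step[OF assms(1)] bval_in_I[of "drop_seq 1 b"] assms by (simp add: I_eq)
  then show ?thesis using beta_gt1 by (simp add: zero_less_mult_iff)
qed

lemma ex_small_scale:
  assumes "e > 0"
  shows "\<exists>R. upper / \<beta> ^ R < e"
proof -
  have "(\<lambda>n. upper / \<beta> ^ n) \<longlonglongrightarrow> 0"
    using LIMSEQ_divide_realpow_zero[OF beta_gt1] .
  then have "\<forall>\<^sub>F n in sequentially. upper / \<beta> ^ n < e" using assms by (rule order_tendstoD)
  then show ?thesis using eventually_happens' sequentially_bot by blast
qed

lemma small_tail:
  assumes b: "b \<in> space D" and R: "upper / \<beta> ^ R < e" and z: "\<And>i. i < R \<Longrightarrow> b i = 0"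
  shows "bval b < e"
proof -
  have "bval b \<le> upper / \<beta> ^ R"
    using bval_in_I[of "drop_seq R b"] b beta_gt1 by (subst bval_zeros[OF b z]) (auto simp: I_eq divide_right_mono)
  then show ?thesis using R by simp
qed

text \<open>Uses the word consisting of 1, then R zeros, then 1. The zeros press the value after the
  first 1 below \<open>overlap\<close>, and the final 1 keeps it positive.\<close>

lemma AE_good: "AE b in D. good b"
proof -
  obtain R where R: "upper / \<beta> ^ R < overlap" using ex_small_scale overlap_pos by blast
  define d :: "nat \<Rightarrow> nat" where "d i = (if i = 0 \<or> i = Suc R then 1 else 0)" for i
  have "AE b in D. \<exists>\<^sub>\<infinity>k. \<forall>i<R + 2. b (i + k) = d i"
    using N_ge1 by (intro digits.AE_word_infinitely_often) (auto simp: d_def)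
  then show ?thesis
  proof (rule AE_mp, intro AE_I2 impI)
    fix b assume b: "b \<in> space D" "\<exists>\<^sub>\<infinity>k. \<forall>i<R + 2. b (i + k) = d i"
    show "good b"
      using b(2) unfolding good_def
    proof (rule INFM_mono)
      fix k assume k: "\<forall>i<R + 2. b (i + k) = d i"
      let ?c = "drop_seq (Suc k) b"
      have c: "?c \<in> space D" using b by simp
      have z: "?c i = 0" if "i < R" for i using k[rule_format, of "Suc i"] that by (simp add: d_def)
      have "bval (drop_seq R ?c) > 0"
        using k[rule_format, of "Suc R"] b by (intro bval_first_pos) (auto simp: d_def)
      moreover have "\<beta> ^ R > 0" using beta_gt1 by simp
      moreover have "bval ?c = bval (drop_seq R ?c) / \<beta> ^ R" by (rule bval_zeros[OF c z])
      ultimately have "bval ?c > 0" by (metis divide_pos_pos)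
      moreover have "b k \<ge> 1" using k[rule_format, of 0] by (simp add: d_def)
      ultimately show "b k \<ge> 1 \<and> 0 < bval ?c \<and> bval ?c < overlap"
        using small_tail[OF c R z] by blast
    qed
  qed
qed

section \<open>Gaps of \<open>F\<close>, saturated sets and inverse branches\<close>

definition same_gap :: "real \<Rightarrow> real \<Rightarrow> bool" where
  "same_gap x y \<longleftrightarrow> (\<forall>f\<in>F. f < x \<longleftrightarrow> f < y)"

text \<open>Unions of gaps, up to points of \<open>F\<close>. Unlike single gaps, this class is
  stable under removing the switch region and under pulling back along a branch, which the induction
  in \<open>coin_event_fair\<close> requires.\<close>

definition saturated :: "real set \<Rightarrow> bool" where
  "saturated P \<longleftrightarrow> P \<in> sets borel \<and> (\<forall>x\<in>I - F. \<forall>y\<in>I - F. same_gap x y \<longrightarrow> (x \<in> P \<longleftrightarrow> y \<in> P))"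

lemma saturated_borel: "saturated P \<Longrightarrow> P \<in> sets borel"
  by (simp add: saturated_def)

lemma branch_in_I_F:
  assumes "y \<in> I - F" "d \<le> N"
  shows "(d + y) / \<beta> \<in> I - F"
proof -
  have b: "\<beta> * ((d + y) / \<beta>) - d = y" using beta_gt1 by simp
  have "d + y \<le> \<beta> * upper" using assms upper_eq by (auto simp: I_eq)
  then have "(d + y) / \<beta> \<in> I" using assms beta_gt1 by (auto simp: I_eq field_simps)
  moreover have "(d + y) / \<beta> \<notin> F" using F_closed[of "(d + y) / \<beta>" d] b assms by auto
  ultimately show ?thesis by blast
qed

text \<open>The Markov property: an endpoint of a gap separating the two images would be mapped by the
  admissible digit \<open>d\<close> to a point of \<open>F\<close> separating \<open>y\<close> and \<open>y'\<close>.\<close>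

lemma same_gap_branch:
  assumes "y \<in> I - F" "y' \<in> I - F" "d \<le> N" "same_gap y y'"
  shows "same_gap ((d + y) / \<beta>) ((d + y') / \<beta>)"
proof -
  have *: "f < (d + y') / \<beta>" if "f \<in> F" "f < (d + y) / \<beta>" "y \<in> I - F" "y' \<in> I - F" "same_gap y y'" for f y y' :: real
  proof (rule ccontr)
    assume "\<not> f < (d + y') / \<beta>"
    then have b: "y' \<le> \<beta> * f - d" "\<beta> * f - d < y" using that beta_gt1 by (auto simp: field_simps)
    then have "\<beta> * f - d \<in> F" using that assms(3) by (intro F_closed) (auto simp: I_eq)
    then show False using b that(5) by (auto simp: same_gap_def)
  qed
  have "same_gap y' y" using assms by (simp add: same_gap_def)
  then have "f < (d + y) / \<beta> \<longleftrightarrow> f < (d + y') / \<beta>" if "f \<in> F" for f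
    using *[OF that _ assms(1,2,4)] *[OF that _ assms(2,1)] by blast
  then show ?thesis by (simp add: same_gap_def)
qed

lemma saturated_branch:
  assumes "saturated P" "d \<le> N"
  shows "saturated {y. (d + y) / \<beta> \<in> P}"
proof -
  have [measurable]: "P \<in> sets borel" using assms saturated_borel by blast
  have "(\<lambda>y::real. (d + y) / \<beta>) \<in> borel_measurable borel"
    by (rule borel_measurable_divide[OF borel_measurable_add[OF borel_measurable_const measurable_ident_sets[OF refl]] borel_measurable_const])
  from measurable_sets[OF this, of P] have "{y::real. (d + y) / \<beta> \<in> P} \<in> sets borel" by (simp add: vimage_def)
  moreover have "(d + x) / \<beta> \<in> P \<longleftrightarrow> (d + y) / \<beta> \<in> P" if "x \<in> I - F" "y \<in> I - F" "same_gap x y" for x y :: real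
    using assms(1) branch_in_I_F[OF that(1) assms(2)] branch_in_I_F[OF that(2) assms(2)]
      same_gap_branch[OF that(1,2) assms(2) that(3)] unfolding saturated_def by blast
  ultimately show ?thesis by (simp add: saturated_def)
qed

lemma saturated_Diff: "saturated P \<Longrightarrow> saturated Q \<Longrightarrow> saturated (P - Q)"
  unfolding saturated_def by (auto intro: sets.Diff)

lemma saturated_interval:
  assumes "a \<in> F" "b \<in> F"
  shows "saturated {a<..<b}"
proof -
  have "y \<in> {a<..<b}" if "x \<in> {a<..<b}" "x \<notin> F" "y \<notin> F" "same_gap x y" for x y
  proof -
    have "a < x \<longleftrightarrow> a < y" "b < x \<longleftrightarrow> b < y" "y \<noteq> b" using that assms by (auto simp: same_gap_def)
    then show ?thesis using that(1) by auto
  qed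
  moreover have "same_gap y x" if "same_gap x y" for x y using that by (simp add: same_gap_def)
  ultimately have "\<forall>x\<in>I - F. \<forall>y\<in>I - F. same_gap x y \<longrightarrow> (x \<in> {a<..<b} \<longleftrightarrow> y \<in> {a<..<b})"
    by blast
  then show ?thesis unfolding saturated_def by simp
qed

lemma switch_strict:
  assumes "x \<in> I - F" "x \<in> switch_region \<beta>"
  obtains k where "1 \<le> k" "k \<le> N" "real k < \<beta> * x" "\<beta> * x < k + overlap"
proof -
  obtain k where k: "1 \<le> k" "k \<le> N" "real k \<le> \<beta> * x" "\<beta> * x \<le> k + overlap"
    using assms switch_region_iff by blast
  have "x \<noteq> k / \<beta>" "x \<noteq> (k + overlap) / \<beta>" using assms div_beta_in_F switch_end_in_F k by blast+
  then have "real k \<noteq> \<beta> * x" "\<beta> * x \<noteq> k + overlap" using beta_gt1 by (auto simp: field_simps)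
  then show thesis using that k by force
qed

text \<open>A point of \<open>F\<close> separating \<open>x\<close> from \<open>y\<close> would lie
  in the interior of a switch region, against \<open>F_gap_switch\<close>.\<close>

lemma same_gap_switch:
  assumes "k \<le> N" "real k < \<beta> * x" "\<beta> * x < k + overlap" "real k < \<beta> * y" "\<beta> * y < k + overlap"
  shows "same_gap x y"
proof -
  have *: "f < y" if "f \<in> F" "f < x" "\<beta> * x < k + overlap" "real k < \<beta> * y" for f x y
  proof (rule ccontr)
    assume "\<not> f < y"
    then have "\<beta> * y \<le> \<beta> * f" "\<beta> * f < \<beta> * x" using that beta_gt1 by auto
    then show False using F_gap_switch[OF that(1) assms(1)] that by simp
  qed
  then show ?thesis using assms unfolding same_gap_def by blast
qed

lemma saturated_switch: "saturated (switch_region \<beta>)"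
proof -
  have "y \<in> switch_region \<beta>" if x: "x \<in> I - F" "x \<in> switch_region \<beta>" and y: "y \<in> I - F" "same_gap x y" for x y :: real
  proof -
    obtain k where k: "1 \<le> k" "k \<le> N" "real k < \<beta> * x" "\<beta> * x < k + overlap" using switch_strict x by blast
    have "k / \<beta> < x" "\<not> (k + overlap) / \<beta> < x" using k beta_gt1 by (auto simp: field_simps)
    then have "k / \<beta> < y" "\<not> (k + overlap) / \<beta> < y"
      using y div_beta_in_F[of k] switch_end_in_F[of k] k unfolding same_gap_def by blast+
    then show ?thesis unfolding switch_region_iff using k beta_gt1 by (intro exI[of _ k]) (auto simp: field_simps)
  qed
  moreover have "same_gap y x" if "same_gap x y" for x y using that by (simp add: same_gap_def)
  ultimately show ?thesis unfolding saturated_def using sets_switch_region by blast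
qed

definition coin_event :: "real set \<Rightarrow> (nat \<Rightarrow> bool) \<Rightarrow> nat \<Rightarrow> (nat \<Rightarrow> nat) set" where
  "coin_event P \<omega> l = {b \<in> space D. good b \<and> bval b \<in> P \<and> (\<forall>i<l. coins b i = \<omega> i)}"

lemma sets_coin_event [measurable]:
  assumes [measurable]: "P \<in> sets borel"
  shows "coin_event P \<omega> l \<in> sets D"
  unfolding coin_event_def by measurable

lemma sets_coin_event_hit [measurable]:
  assumes [measurable]: "P \<in> sets borel"
  shows "{b \<in> coin_event P \<omega> l. hit b = t} \<in> sets D"
proof -
  have "{b \<in> coin_event P \<omega> l. hit b = t} = {b \<in> space D. b \<in> coin_event P \<omega> l \<and> hit b = t}"
    by (auto simp: coin_event_def)
  also have "\<dots> \<in> sets D" by measurable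
  finally show ?thesis .
qed

abbreviation pr :: "(nat \<Rightarrow> nat) set \<Rightarrow> real" where "pr \<equiv> measure D"

sublocale prob_D: prob_space D by (rule digits.prob_space_D)

lemma pr_first_digit:
  assumes K: "K \<subseteq> {0..N}" and X: "\<And>d. d \<in> K \<Longrightarrow> X d \<in> sets D"
  shows "pr (\<Union>d\<in>K. {b \<in> space D. b 0 = d \<and> drop_seq 1 b \<in> X d}) = (\<Sum>d\<in>K. pr (X d) / (N + 1))"
proof -
  have fin: "finite K" using K finite_subset by blast
  have m: "{b \<in> space D. b 0 = d \<and> drop_seq 1 b \<in> X d} \<in> sets D" if "d \<in> K" for d
  proof -
    have [measurable]: "X d \<in> sets D" using X that .
    show ?thesis by measurable
  qed
  have "pr (\<Union>d\<in>K. {b \<in> space D. b 0 = d \<and> drop_seq 1 b \<in> X d}) = (\<Sum>d\<in>K. pr {b \<in> space D. b 0 = d \<and> drop_seq 1 b \<in> X d})"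
    by (rule prob_D.finite_measure_finite_Union[OF fin]) (use m in \<open>auto simp: disjoint_family_on_def\<close>)
  also have "\<dots> = (\<Sum>d\<in>K. pr (X d) / (N + 1))"
  proof (rule sum.cong[OF refl])
    fix d assume d: "d \<in> K"
    show "pr {b \<in> space D. b 0 = d \<and> drop_seq 1 b \<in> X d} = pr (X d) / (N + 1)"
      using digits.emeasure_first_digit[of d "X d"] d K X by (auto simp: measure_def enn2real_mult)
  qed
  finally show ?thesis .
qed

lemma pr_coin_event_Collect:
  assumes [measurable]: "P \<in> sets borel"
  shows "pr (coin_event P \<omega> 0) = pr {b \<in> space D. bval b \<in> P}"
  by (rule prob_D.finite_measure_eq_AE) (use AE_good in \<open>auto simp: coin_event_def\<close>)

text \<open>The digit reflection preserves \<open>D\<close> and sends \<open>bval b\<close> to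
  \<open>upper - bval b\<close>, exchanging the two images of a switch region.\<close>

lemma pr_reflect:
  "pr (coin_event {0<..<overlap} \<omega> 0) = pr (coin_event {1<..<upper} \<omega>' 0)"
proof -
  have bij: "bij_betw (\<lambda>a. N - a) {0..N} {0..N}"
    by (rule bij_betw_byWitness[where f'="\<lambda>a. N - a"]) auto
  have m: "{b \<in> space D. bval b \<in> {0<..<overlap}} \<in> sets D" by measurable
  have "{b \<in> space D. (\<lambda>i. N - b i) \<in> {b \<in> space D. bval b \<in> {0<..<overlap}}} = {b \<in> space D. bval b \<in> {1<..<upper}}"
    by (auto simp: bval_reflect space_D overlap_def)
  then have "emeasure D {b \<in> space D. bval b \<in> {1<..<upper}} = emeasure D {b \<in> space D. bval b \<in> {0<..<overlap}}"
    using digits.emeasure_map_bij[OF bij m] by simp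
  then have "pr {b \<in> space D. bval b \<in> {1<..<upper}} = pr {b \<in> space D. bval b \<in> {0<..<overlap}}"
    by (simp only: measure_def)
  then show ?thesis using pr_coin_event_Collect[of "{1<..<upper}" \<omega>'] pr_coin_event_Collect[of "{0<..<overlap}" \<omega>]
    by simp
qed

text \<open>\<open>q\<close> is the number of switch regions in \<open>P\<close> divided by
  \<open>N + 1\<close>: for either coin each region is left by exactly one digit, and all regions
  have the same image. The point is that \<open>q\<close> depends on neither \<open>\<omega>\<close>
  nor \<open>l\<close>.\<close>

lemma coin_event_visit:
  assumes P: "saturated P"
  obtains q where "\<And>\<omega> l. pr {b \<in> coin_event P \<omega> (Suc l). hit b = 0} =
     q * pr (coin_event (if \<omega> 0 then {0<..<overlap} else {1<..<upper}) (\<lambda>i. \<omega> (Suc i)) l)"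
proof -
  let ?J = "\<lambda>c. if c then {0<..<overlap} else {1<..<upper}"
  \<comment> \<open>The interior of a switch region is one gap, so a saturated \<open>P\<close> that
    meets it contains all its points outside \<open>F\<close>.\<close>
  define K where "K = {k \<in> {1..N}. \<exists>x \<in> P \<inter> (I - F). real k < \<beta> * x \<and> \<beta> * x < k + overlap}"
  have KN: "K \<subseteq> {1..N}" by (auto simp: K_def)
  have set_eq: "{b \<in> coin_event P \<omega> (Suc l). hit b = 0} =
    (\<Union>d\<in>(\<lambda>k. k - 1 + of_bool (\<omega> 0)) ` K. {b \<in> space D. b 0 = d \<and> drop_seq 1 b \<in> coin_event (?J (\<omega> 0)) (\<lambda>i. \<omega> (Suc i)) l})"
    (is "?L = ?R") for \<omega> l
  proof (intro set_eqI iffI)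
    fix b assume "b \<in> ?L"
    then have b: "b \<in> space D" "good b" "bval b \<in> P" "\<And>i. i < Suc l \<Longrightarrow> coins b i = \<omega> i" "hit b = 0"
      by (auto simp: coin_event_def)
    have rec: "recurrent b" using b good_recurrent by blast
    let ?c = "drop_seq 1 b"
    have c: "?c \<in> space D" "good ?c" using b(1,2) by simp_all
    have v: "visit b" using hit_not_visit[OF rec] b(5) by auto
    have y: "bval ?c \<in> I - F" using good_in_I_F[OF c] .
    have bx: "bval b \<in> P \<inter> (I - F)" using b(1-3) good_in_I_F by blast
    have "bval ?c \<noteq> 0" "bval ?c \<noteq> overlap" "bval ?c \<noteq> 1" "bval ?c \<noteq> upper"
      using y zero_in_F overlap_in_F one_in_F upper_in_F by auto
    then have ne: "bval ?c > 0" "bval ?c < upper" "bval ?c \<noteq> overlap" "bval ?c \<noteq> 1"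
      using y by (auto simp: I_eq)
    have co: "coins ?c i = \<omega> (Suc i)" if "i < l" for i
      using b(4)[of "Suc i"] that b(5) by simp
    show "b \<in> ?R"
      using b(1)
    proof (cases rule: digit_cases)
      case lower
      have "\<omega> 0" using b(4)[of 0] coins_visit(1)[OF v] lower overlap_less1 by simp
      moreover have "b 0 \<in> K" unfolding K_def using lower b(1) ne bval_step[OF b(1)] bx
        by (auto simp: space_D intro!: bexI[of _ "bval b"])
      moreover have "?c \<in> coin_event (?J True) (\<lambda>i. \<omega> (Suc i)) l"
        using c lower ne co unfolding coin_event_def by auto
      ultimately show ?thesis using b(1) lower by (auto intro!: bexI[of _ "b 0"])
    next
      case higher
      have "\<not> \<omega> 0" using b(4)[of 0] coins_visit(1)[OF v] higher by simp
      moreover have "Suc (b 0) \<in> K" unfolding K_def using higher b(1) ne bval_step[OF b(1)] bx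
        by (auto simp: space_D overlap_def intro!: bexI[of _ "bval b"])
      moreover have "?c \<in> coin_event (?J False) (\<lambda>i. \<omega> (Suc i)) l"
        using c higher ne co unfolding coin_event_def by auto
      ultimately show ?thesis using b(1) higher by (auto intro!: bexI[of _ "Suc (b 0)"])
    next
      case forced
      then show ?thesis using v by simp
    qed
  next
    fix b assume "b \<in> ?R"
    then obtain k where k: "k \<in> K" "b \<in> space D" "b 0 = k - 1 + of_bool (\<omega> 0)"
      "drop_seq 1 b \<in> coin_event (?J (\<omega> 0)) (\<lambda>i. \<omega> (Suc i)) l"
      by blast
    obtain x where x: "x \<in> P \<inter> (I - F)" "real k < \<beta> * x" "\<beta> * x < k + overlap" and k1: "1 \<le> k" "k \<le> N"
      using k(1) by (auto simp: K_def)
    let ?c = "drop_seq 1 b"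
    have c: "good ?c" "bval ?c \<in> ?J (\<omega> 0)" "\<And>i. i < l \<Longrightarrow> coins ?c i = \<omega> (Suc i)"
      using k(4) unfolding coin_event_def by blast+
    have g: "good b" using c(1) by (simp del: drop_seq_nth)
    have e: "real k < \<beta> * bval b \<and> \<beta> * bval b < k + overlap"
      using bval_step[OF k(2)] k(3) c(2) k1 by (cases "\<omega> 0") (auto simp: of_nat_diff overlap_def)
    then have v: "visit b" unfolding switch_region_iff using k1 by (auto intro!: exI[of _ k])
    have "same_gap x (bval b)" using same_gap_switch k1 x e by blast
    then have "bval b \<in> P" using P x(1) good_in_I_F[OF k(2) g] unfolding saturated_def by blast
    moreover have "coins b i = \<omega> i" if "i < Suc l" for i
      using c(2,3) that v overlap_less1 by (cases i) (auto split: if_splits)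
    ultimately show "b \<in> ?L" using k(2) g v by (simp add: coin_event_def)
  qed
  show thesis
  proof (rule that)
    fix \<omega> :: "nat \<Rightarrow> bool" and l
    have inj: "inj_on (\<lambda>k. k - 1 + of_bool (\<omega> 0)) K"
    proof (rule inj_onI)
      fix j k assume "j \<in> K" "k \<in> K" and e: "j - 1 + of_bool (\<omega> 0) = k - 1 + of_bool (\<omega> 0)"
      then have "1 \<le> j" "1 \<le> k" using KN by auto
      then show "j = k" using e by linarith
    qed
    have "pr {b \<in> coin_event P \<omega> (Suc l). hit b = 0} = (\<Sum>d\<in>(\<lambda>k. k - 1 + of_bool (\<omega> 0)) ` K. pr (coin_event (?J (\<omega> 0)) (\<lambda>i. \<omega> (Suc i)) l) / (N + 1))"
      unfolding set_eq by (rule pr_first_digit) (use KN in \<open>auto simp: subset_iff\<close>)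
    also have "\<dots> = real (card K) / (N + 1) * pr (coin_event (?J (\<omega> 0)) (\<lambda>i. \<omega> (Suc i)) l)"
      using card_image[OF inj] by simp
    finally show "pr {b \<in> coin_event P \<omega> (Suc l). hit b = 0} = real (card K) / (N + 1) * pr (coin_event (?J (\<omega> 0)) (\<lambda>i. \<omega> (Suc i)) l)" .
  qed
qed

text \<open>Conditioning on the first digit. Without a visit at time 0 the coins survive the shift,
  and the condition on the starting point becomes one on the next point, again given by a saturated
  set.\<close>

lemma coin_event_hit_Suc:
  assumes P: "saturated P"
  shows "pr {b \<in> coin_event P \<omega> l. hit b = Suc t} =
    (\<Sum>d\<in>{0..N}. pr {b \<in> coin_event {y. (d + y) / \<beta> \<in> P - switch_region \<beta>} \<omega> l. hit b = t} / (N + 1))"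
proof -
  have [measurable]: "P \<in> sets borel" using P saturated_borel by blast
  have "{b \<in> coin_event P \<omega> l. hit b = Suc t} =
    (\<Union>d\<in>{0..N}. {b \<in> space D. b 0 = d \<and> drop_seq 1 b \<in> {b \<in> coin_event {y. (d + y) / \<beta> \<in> P - switch_region \<beta>} \<omega> l. hit b = t}})"
    (is "?L = ?R")
  proof (intro set_eqI)
    fix b
    have "b \<in> ?L \<longleftrightarrow> b \<in> ?R" if b: "b \<in> space D" "good b"
    proof -
      have e: "(b 0 + bval (drop_seq 1 b)) / \<beta> = bval b" using bval_step[OF b(1)] beta_gt1 by (simp add: field_simps)
      have h: "hit b = Suc t \<longleftrightarrow> \<not> visit b \<and> hit (drop_seq 1 b) = t"
        using hit_not_visit[OF good_recurrent[OF b]] hit_visit[of b] by (cases "visit b") auto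
      have c: "\<not> visit b \<Longrightarrow> coins b = coins (drop_seq 1 b)"
        using coins_not_visit[OF good_recurrent[OF b]] by blast
      have "b 0 \<in> {0..N}" "drop_seq 1 b \<in> space D" "good (drop_seq 1 b)" using b by (auto simp: space_D)
      then show ?thesis using b e h c unfolding coin_event_def by auto
    qed
    moreover have "b \<in> space D \<and> good b" if "b \<in> ?L \<or> b \<in> ?R"
      using that good_drop[of 1 b] unfolding coin_event_def by blast
    ultimately show "b \<in> ?L \<longleftrightarrow> b \<in> ?R" by blast
  qed
  then show ?thesis
    by (simp only:) (rule pr_first_digit, auto)
qed

lemma coin_event_sums_hit:
  assumes P: "P \<in> sets borel"
  shows "(\<lambda>t. pr {b \<in> coin_event P \<omega> l. hit b = t}) sums pr (coin_event P \<omega> l)"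
proof -
  have "(\<lambda>t. pr {b \<in> coin_event P \<omega> l. hit b = t}) sums pr (\<Union>t. {b \<in> coin_event P \<omega> l. hit b = t})"
    by (rule prob_D.finite_measure_UNION) (use P in \<open>auto simp: disjoint_family_on_def\<close>)
  moreover have "(\<Union>t. {b \<in> coin_event P \<omega> l. hit b = t}) = coin_event P \<omega> l" by auto
  ultimately show ?thesis by simp
qed

text \<open>The coin tosses are fair and independent of the gap containing \<open>x\<close>: at the first visit to the
  switch region the two digits lead to reflected gaps, so both have the same probability.\<close>

lemma coin_event_fair:
  assumes "saturated P"
  shows "pr (coin_event P \<omega> l) = (1 / 2) ^ l * pr (coin_event P \<omega> 0)"
  using assms
proof (induction l arbitrary: P \<omega>)
  case (Suc l)
  let ?J = "\<lambda>c. if c then {0<..<overlap} else {1<..<upper}"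
  define r where "r = pr (coin_event {0<..<overlap} \<omega> 0)"
  have J: "pr (coin_event (?J c) \<omega>' 0) = r" for c \<omega>'
    using pr_reflect[of \<omega>' \<omega>'] pr_reflect[of \<omega> \<omega>'] unfolding r_def
    by (cases c) (simp_all only: if_True if_False)
  have J': "pr (coin_event (?J c) \<omega>' l) = (1 / 2) ^ l * r" for c \<omega>'
  proof -
    have "saturated (?J c)"
      using saturated_interval zero_in_F overlap_in_F one_in_F upper_in_F by (cases c) (simp_all only: if_True if_False)
    then show ?thesis using Suc.IH[of "?J c" \<omega>'] J[of c \<omega>'] by (simp only:)
  qed
  \<comment> \<open>Inner induction over the time of the first visit, with \<open>P\<close>
    arbitrary because each step without a visit replaces it by branch preimages.\<close>
  have "pr {b \<in> coin_event P \<omega> (Suc l). hit b = t} = (1 / 2) ^ Suc l * pr {b \<in> coin_event P \<omega> 0. hit b = t}"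
    if "saturated P" for t P
    using that
  proof (induction t arbitrary: P)
    case 0
    have [measurable]: "P \<in> sets borel" using 0 saturated_borel by blast
    obtain q where q: "\<And>\<omega> l. pr {b \<in> coin_event P \<omega> (Suc l). hit b = 0} =
       q * pr (coin_event (?J (\<omega> 0)) (\<lambda>i. \<omega> (Suc i)) l)" using coin_event_visit[OF 0] by blast
    \<comment> \<open>First visit at time 0 with coin \<open>c\<close>. The two events have equal
      probability \<open>q * r\<close> and together give the event without coin conditions; this is
      where the factor 1/2 arises.\<close>
    define V where "V c = {b \<in> coin_event P (\<lambda>_. c) (Suc 0). hit b = 0}" for c
    have V: "pr (V c) = q * r" for c
      unfolding V_def q[of "\<lambda>_. c" 0] J ..
    have coin: "coins b 0 = c" if "b \<in> V c" for b c
      using that unfolding V_def coin_event_def by blast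
    have sets: "V c \<in> sets D" for c
      unfolding V_def by (rule sets_coin_event_hit) measurable
    have "{b \<in> coin_event P \<omega> 0. hit b = 0} = V True \<union> V False"
      unfolding V_def coin_event_def by (auto simp: less_Suc_eq simp del: coins.simps)
    then have "pr {b \<in> coin_event P \<omega> 0. hit b = 0} = pr (V True \<union> V False)" by (rule arg_cong)
    moreover have "pr (V True \<union> V False) = pr (V True) + pr (V False)"
      by (rule prob_D.finite_measure_Union[OF sets sets]) (use coin in blast)
    ultimately have "pr {b \<in> coin_event P \<omega> 0. hit b = 0} = 2 * (q * r)" unfolding V by linarith
    moreover have "pr {b \<in> coin_event P \<omega> (Suc l). hit b = 0} = q * ((1 / 2) ^ l * r)"
      unfolding q[of \<omega> l] J' ..
    ultimately show ?case by (simp only: power_Suc) simp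
  next
    case (Suc t)
    have "saturated {y. (d + y) / \<beta> \<in> P - switch_region \<beta>}" if "d \<in> {0..N}" for d
      using saturated_branch[OF saturated_Diff[OF Suc.prems saturated_switch], of d] that by simp
    then have "pr {b \<in> coin_event P \<omega> (Suc l). hit b = Suc t} =
        (\<Sum>d\<in>{0..N}. (1 / 2) ^ Suc l * (pr {b \<in> coin_event {y. (d + y) / \<beta> \<in> P - switch_region \<beta>} \<omega> 0. hit b = t} / (N + 1)))"
      unfolding coin_event_hit_Suc[OF Suc.prems, of \<omega> "Suc l" t]
      by (intro sum.cong refl) (simp only: Suc.IH times_divide_eq_right)
    also have "\<dots> = (1 / 2) ^ Suc l * pr {b \<in> coin_event P \<omega> 0. hit b = Suc t}"
      unfolding coin_event_hit_Suc[OF Suc.prems, of \<omega> 0 t] by (rule sum_distrib_left[symmetric])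
    finally show ?case .
  qed
  from this[OF Suc.prems] have "(\<lambda>t. (1 / 2) ^ Suc l * pr {b \<in> coin_event P \<omega> 0. hit b = t}) sums pr (coin_event P \<omega> (Suc l))"
    using coin_event_sums_hit[OF saturated_borel[OF Suc.prems], of \<omega> "Suc l"] by (simp only:)
  moreover have "(\<lambda>t. (1 / 2) ^ Suc l * pr {b \<in> coin_event P \<omega> 0. hit b = t}) sums ((1 / 2) ^ Suc l * pr (coin_event P \<omega> 0))"
    by (intro sums_mult coin_event_sums_hit[OF saturated_borel[OF Suc.prems]])
  ultimately show ?case by (rule sums_unique2)
qed simp

section \<open>The gap coding and the metric\<close>

abbreviation L :: nat where "L \<equiv> num_intervals \<beta>"

abbreviation F_nth :: "nat \<Rightarrow> real" where "F_nth i \<equiv> sorted_list_of_set F ! i"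

lemma length_F: "length (sorted_list_of_set F) = Suc L"
proof -
  have "card F > 0" using finite_F zero_in_F by (auto simp: card_gt_0_iff)
  then show ?thesis by (simp add: num_intervals_def)
qed

lemma F_nth_in: "i \<le> L \<Longrightarrow> F_nth i \<in> F"
  using nth_mem[of i "sorted_list_of_set F"] length_F finite_F by simp

lemma F_nth_ex: "f \<in> F \<Longrightarrow> \<exists>i\<le>L. F_nth i = f"
  using in_set_conv_nth[of f "sorted_list_of_set F"] length_F finite_F by (auto simp: less_Suc_eq_le)

lemma F_nth_less: "i < j \<Longrightarrow> j \<le> L \<Longrightarrow> F_nth i < F_nth j"
  using sorted_wrt_nth_less[OF strict_sorted_list_of_set, of i j F] length_F by simp

lemma F_nth_less_iff: "i \<le> L \<Longrightarrow> j \<le> L \<Longrightarrow> F_nth i < F_nth j \<longleftrightarrow> i < j"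
  using F_nth_less by (metis linorder_neqE_nat not_less_iff_gr_or_eq)

lemma F_nth_0: "F_nth 0 = 0"
proof -
  obtain i where i: "i \<le> L" "F_nth i = 0" using F_nth_ex zero_in_F by blast
  have "F_nth 0 \<ge> 0" using F_nth_in[of 0] F_in_I by (auto simp: I_eq)
  then show ?thesis using i F_nth_less[of 0 i] by (cases "i = 0") auto
qed

lemma F_nth_L: "F_nth L = upper"
proof -
  obtain i where i: "i \<le> L" "F_nth i = upper" using F_nth_ex upper_in_F by blast
  have "F_nth L \<le> upper" using F_nth_in[of L] F_in_I by (auto simp: I_eq)
  then show ?thesis using i F_nth_less[of i L] by (cases "i = L") auto
qed

lemma L_ge1: "L \<ge> 1"
  using F_nth_0 F_nth_L upper_gt1 by (cases L) auto

lemma C_eq: "C_interval \<beta> k = {F_nth (k - 1)<..<F_nth k}"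
  by (simp add: C_interval_def)

lemma C_ex:
  assumes "x \<in> I - F"
  shows "\<exists>k\<in>{1..L}. x \<in> C_interval \<beta> k"
proof -
  have x: "0 < x" "x < upper" using assms zero_in_F upper_in_F by (auto simp: I_eq less_le)
  define k where "k = (LEAST k. x < F_nth k)"
  have xL: "x < F_nth L" using x F_nth_L by simp
  have k: "x < F_nth k" "k \<le> L"
    unfolding k_def by (rule LeastI[of "\<lambda>k. x < F_nth k", OF xL], rule Least_le[of "\<lambda>k. x < F_nth k", OF xL])
  have k1: "k \<ge> 1" using k(1) x F_nth_0 by (cases k) auto
  then have "\<not> x < F_nth (k - 1)" using not_less_Least[of "k - 1" "\<lambda>k. x < F_nth k", folded k_def] by simp
  moreover have "k - 1 \<le> L" using k(2) by linarith
  then have "F_nth (k - 1) \<noteq> x" using F_nth_in[of "k - 1"] assms by blast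
  ultimately show ?thesis using k k1 by (auto simp: C_eq intro!: bexI[of _ k])
qed

lemma C_props:
  assumes "k \<in> {1..L}"
  shows "C_interval \<beta> k \<subseteq> I - F" "F_nth (k - 1) < F_nth k"
proof -
  show "F_nth (k - 1) < F_nth k" using assms by (intro F_nth_less) auto
  have "0 \<le> F_nth (k - 1)" "F_nth k \<le> upper"
    using F_nth_in[of "k - 1"] F_nth_in[of k] F_in_I assms by (force simp: I_eq)+
  moreover have "x \<notin> F" if x: "x \<in> C_interval \<beta> k" for x
  proof
    assume "x \<in> F"
    then obtain i where i: "i \<le> L" "F_nth i = x" using F_nth_ex by blast
    then have "k - 1 < i" "i < k" using x assms F_nth_less_iff by (auto simp: C_eq)
    then show False by simp
  qed
  ultimately show "C_interval \<beta> k \<subseteq> I - F" by (auto simp: C_eq I_eq)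
qed

lemma C_saturated: "k \<in> {1..L} \<Longrightarrow> saturated (C_interval \<beta> k)"
  unfolding C_eq by (intro saturated_interval F_nth_in) auto

lemma C_same_gap:
  assumes "k \<in> {1..L}" "x \<in> C_interval \<beta> k" "y \<in> C_interval \<beta> k"
  shows "same_gap x y"
proof -
  have *: "f < y" if "f \<in> F" "f < x" "x \<in> C_interval \<beta> k" "y \<in> C_interval \<beta> k" for f x y
  proof -
    obtain i where i: "i \<le> L" "F_nth i = f" using F_nth_ex \<open>f \<in> F\<close> by blast
    have "F_nth i < F_nth k" using i that by (auto simp: C_eq)
    then have "i \<le> k - 1" using F_nth_less_iff[of i k] i assms(1) by auto
    then have "f \<le> F_nth (k - 1)" using F_nth_less[of i "k - 1"] i(2) \<open>i \<le> k - 1\<close> assms(1)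
      by (cases "i = k - 1") (auto simp: less_imp_le simp del: One_nat_def)
    then show ?thesis using that(4) by (auto simp: C_eq)
  qed
  then show ?thesis using assms unfolding same_gap_def by blast
qed

lemma C_same_gap_iff:
  assumes "k \<in> {1..L}" "x \<in> C_interval \<beta> k" "y \<in> I - F" "same_gap x y"
  shows "y \<in> C_interval \<beta> k"
  using C_saturated[OF assms(1)] C_props(1)[OF assms(1)] assms(2-) unfolding saturated_def by blast

lemma C_unique:
  assumes "k \<in> {1..L}" "j \<in> {1..L}" "x \<in> C_interval \<beta> k" "x \<in> C_interval \<beta> j"
  shows "k = j"
proof -
  have "F_nth (k - 1) < F_nth j" "F_nth (j - 1) < F_nth k" using assms(3,4) by (auto simp: C_eq)
  then have "k - 1 < j" "j - 1 < k" using F_nth_less_iff assms(1,2) by auto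
  then show ?thesis using assms(1,2) by auto
qed

definition mid :: "nat \<Rightarrow> real" where "mid k = (F_nth (k - 1) + F_nth k) / 2"

lemma mid_in_C: "k \<in> {1..L} \<Longrightarrow> mid k \<in> C_interval \<beta> k"
  using C_props(2)[of k] by (simp add: mid_def C_eq)

section \<open>Codes of the points of \<open>X_star\<close>\<close>

lemma X_set_iff: "p \<in> X_set \<beta> \<longleftrightarrow> snd p \<in> I \<and> (\<forall>n. snd ((random_map \<beta> ^^ n) p) \<notin> F)"
proof -
  have "(\<exists>n. (random_map \<beta> ^^ n) p \<in> UNIV \<times> F) \<longleftrightarrow> (\<exists>n. snd ((random_map \<beta> ^^ n) p) \<in> F)"
    by (simp add: mem_Times_iff)
  then show ?thesis by (simp add: X_set_def mem_Times_iff)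
qed

lemma X_star_iff: "p \<in> X_star \<beta> \<longleftrightarrow> p \<in> X_set \<beta> \<or> snd p = 0 \<or> snd p = upper"
  by (cases p) (auto simp: X_star_def upper_def)

lemma X_set_orbit: "p \<in> X_set \<beta> \<Longrightarrow> snd ((random_map \<beta> ^^ n) p) \<in> I - F"
  using random_orbit_in_I by (auto simp: X_set_iff)

lemma alpha_X:
  assumes "p \<in> X_set \<beta>"
  shows "alpha \<beta> p j \<in> {1..L}" "snd ((random_map \<beta> ^^ j) p) \<in> C_interval \<beta> (alpha \<beta> p j)"
proof -
  have "snd p \<in> I - F" using X_set_orbit[OF assms, of 0] by simp
  then have ne: "snd p \<noteq> 0" "snd p \<noteq> N / (\<beta> - 1)" using zero_in_F upper_in_F by (auto simp: upper_def)
  let ?P = "\<lambda>k. k \<in> {1..L} \<and> snd ((random_map \<beta> ^^ j) p) \<in> C_interval \<beta> k"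
  have "\<exists>!k. ?P k" using C_ex[OF X_set_orbit[OF assms]] C_unique by blast
  then have "?P (THE k. ?P k)" by (rule theI')
  then show "alpha \<beta> p j \<in> {1..L}" "snd ((random_map \<beta> ^^ j) p) \<in> C_interval \<beta> (alpha \<beta> p j)"
    using ne by (simp_all add: alpha_def)
qed

lemma alpha_eq_iff:
  assumes "p \<in> X_set \<beta>" "a \<in> {1..L}"
  shows "alpha \<beta> p j = a \<longleftrightarrow> snd ((random_map \<beta> ^^ j) p) \<in> C_interval \<beta> a"
  using alpha_X[OF assms(1)] C_unique assms(2) by blast

lemma alpha_0: "snd p = 0 \<Longrightarrow> alpha \<beta> p j = 1" and alpha_upper: "snd p = upper \<Longrightarrow> alpha \<beta> p j = L"
  using upper_gt1 by (auto simp: alpha_def upper_def)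

lemma alpha_range: "p \<in> X_star \<beta> \<Longrightarrow> alpha \<beta> p j \<in> {1..L}"
proof -
  assume "p \<in> X_star \<beta>"
  then consider "p \<in> X_set \<beta>" | "snd p = 0" | "snd p = upper" using X_star_iff by blast
  then show ?thesis
  proof cases
    case 1
    then show ?thesis by (rule alpha_X(1))
  next
    case 2
    then show ?thesis using alpha_0 L_ge1 by simp
  next
    case 3
    then show ?thesis using alpha_upper L_ge1 by simp
  qed
qed

lemma forced_digit_0:
  assumes "0 \<le> x" "x < 1 / \<beta>"
  shows "random_digit \<beta> (\<omega>, x) = 0 \<and> x \<notin> switch_region \<beta>"
proof -
  have y: "0 \<le> \<beta> * x" "\<beta> * x < 1" using assms beta_gt1 by (auto simp: field_simps)
  then have "0 \<le> N" "\<beta> * x \<in> I" "\<beta> * x = real 0 + \<beta> * x" using upper_gt1 by (auto simp: I_eq)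
  then show ?thesis by (cases rule: random_step_cases) (use y in auto)
qed

lemma forced_digit_N:
  assumes "x \<le> upper" "(N + overlap) / \<beta> < x"
  shows "random_digit \<beta> (\<omega>, x) = N \<and> x \<notin> switch_region \<beta>"
proof -
  have y: "overlap < \<beta> * x - N" "\<beta> * x - N \<le> upper"
    using assms beta_gt1 upper_eq mult_left_mono[of x upper \<beta>] by (auto simp: field_simps)
  then have "N \<le> N" "\<beta> * x - N \<in> I" "\<beta> * x = N + (\<beta> * x - N)" using overlap_pos by (auto simp: I_eq)
  then show ?thesis by (cases rule: random_step_cases) (use y in auto)
qed

lemma upper_gt_switch: "(N + overlap) / \<beta> < upper"
  using upper_eq beta_gt1 by (simp add: field_simps overlap_def)

lemma random_map_0:
  assumes "snd p = 0"
  shows "random_map \<beta> p = p" "random_expansion \<beta> p n = 0" "0 \<notin> switch_region \<beta>"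
proof -
  have *: "random_digit \<beta> (\<omega>, 0) = 0" "0 \<notin> switch_region \<beta>" for \<omega>
    using forced_digit_0[of 0] beta_gt1 by auto
  then show r: "random_map \<beta> p = p" "0 \<notin> switch_region \<beta>" using assms by (cases p; simp add: random_map_eq)+
  have "(random_map \<beta> ^^ n) p = p" for n by (induction n) (simp_all add: r)
  then show "random_expansion \<beta> p n = 0" using * assms by (cases p) (simp add: random_expansion_def)
qed

lemma random_map_upper:
  assumes "snd p = upper"
  shows "random_map \<beta> p = p" "random_expansion \<beta> p n = N" "upper \<notin> switch_region \<beta>"
proof -
  have *: "random_digit \<beta> (\<omega>, upper) = N" "upper \<notin> switch_region \<beta>" for \<omega>
    using forced_digit_N[of upper] upper_gt_switch by auto
  then show r: "random_map \<beta> p = p" "upper \<notin> switch_region \<beta>"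
    using assms upper_eq by (cases p; simp add: random_map_eq)+
  have "(random_map \<beta> ^^ n) p = p" for n by (induction n) (simp_all add: r)
  then show "random_expansion \<beta> p n = N" using * assms by (cases p) (simp add: random_expansion_def)
qed

lemma X_star_in_I: "p \<in> X_star \<beta> \<Longrightarrow> snd p \<in> I"
  using upper_gt1 by (auto simp: X_star_iff X_set_iff I_eq)

lemma X_star_map: "p \<in> X_star \<beta> \<Longrightarrow> random_map \<beta> p \<in> X_star \<beta>"
proof -
  assume "p \<in> X_star \<beta>"
  moreover have "random_map \<beta> p \<in> X_set \<beta>" if "p \<in> X_set \<beta>"
  proof -
    have "snd ((random_map \<beta> ^^ n) (random_map \<beta> p)) \<notin> F" for n
      using that X_set_iff[of p] funpow_Suc_right[of n "random_map \<beta>"] by (metis comp_apply)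
    then show ?thesis using that random_orbit_in_I[of p 1] by (simp add: X_set_iff)
  qed
  ultimately show ?thesis using random_map_0(1)[of p] random_map_upper(1)[of p] by (auto simp: X_star_iff)
qed

lemma alpha_map: "p \<in> X_star \<beta> \<Longrightarrow> alpha \<beta> (random_map \<beta> p) j = alpha \<beta> p (Suc j)"
proof -
  assume p: "p \<in> X_star \<beta>"
  then consider "p \<in> X_set \<beta>" | "snd p = 0" | "snd p = upper" using X_star_iff by blast
  then show ?thesis
  proof cases
    case 1
    then have "snd (random_map \<beta> p) \<in> I - F" "snd p \<in> I - F"
      using X_set_orbit[OF 1, of 1] X_set_orbit[OF 1, of 0] by auto
    then have "snd (random_map \<beta> p) \<noteq> 0" "snd (random_map \<beta> p) \<noteq> N / (\<beta> - 1)"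
        "snd p \<noteq> 0" "snd p \<noteq> N / (\<beta> - 1)"
      using zero_in_F upper_in_F by (auto simp: upper_def)
    then show ?thesis unfolding alpha_def by (simp add: funpow_swap1)
  next
    case 2
    then show ?thesis using random_map_0 alpha_0 by simp
  next
    case 3
    then show ?thesis using random_map_upper alpha_upper by simp
  qed
qed

text \<open>A digit \<open>d\<close> is admissible exactly on
  \<open>[d / \<beta>, (d + upper) / \<beta>]\<close>, whose ends belong to \<open>F\<close>. So on
  a gap off the switch region the digit is constant, and on a switch region only the coin
  matters.\<close>

lemma same_gap_digit:
  assumes "x \<in> I - F" "x' \<in> I - F" "same_gap x x'"
  shows "x \<in> switch_region \<beta> \<longleftrightarrow> x' \<in> switch_region \<beta>"
    "(x \<in> switch_region \<beta> \<Longrightarrow> \<omega> 0 = \<omega>' 0) \<Longrightarrow> random_digit \<beta> (\<omega>, x) = random_digit \<beta> (\<omega>', x')"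
proof -
  show S: "x \<in> switch_region \<beta> \<longleftrightarrow> x' \<in> switch_region \<beta>"
    using assms saturated_switch unfolding saturated_def by blast
  assume w: "x \<in> switch_region \<beta> \<Longrightarrow> \<omega> 0 = \<omega>' 0"
  show "random_digit \<beta> (\<omega>, x) = random_digit \<beta> (\<omega>', x')"
  proof (cases "x \<in> switch_region \<beta>")
    case True
    have dig: "random_digit \<beta> (\<omega>, x) = k - 1 + of_bool (\<omega> 0)"
      if k: "1 \<le> k" "k \<le> N" "real k \<le> \<beta> * x" "\<beta> * x \<le> k + overlap" for k x \<omega>
    proof -
      have "k \<le> N" "\<beta> * x - k \<in> I" "\<beta> * x = k + (\<beta> * x - k)" using k upper_gt1 by (auto simp: I_eq overlap_def)
      then show ?thesis by (cases rule: random_step_cases) (use k overlap_less1 in auto)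
    qed
    obtain k where k: "1 \<le> k" "k \<le> N" "real k < \<beta> * x" "\<beta> * x < k + overlap" using switch_strict assms(1) True by blast
    have "k / \<beta> < x" "\<not> (k + overlap) / \<beta> < x" using k beta_gt1 by (auto simp: field_simps)
    then have "k / \<beta> < x'" "\<not> (k + overlap) / \<beta> < x'"
      using assms(3) div_beta_in_F[of k] switch_end_in_F[of k] k unfolding same_gap_def by blast+
    then have "real k < \<beta> * x'" "\<beta> * x' \<le> k + overlap" using beta_gt1 by (auto simp: field_simps)
    then show ?thesis using dig[of k x \<omega>] dig[of k x' \<omega>'] k w[OF True] by simp
  next
    case False
    obtain d y where d: "d \<le> N" "y \<in> I" "\<beta> * x = d + y" using admissible_exists assms by blast
    have e: "random_digit \<beta> (\<omega>, x) = d" using d by (cases rule: random_step_cases) (use False in auto)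
    have adm: "\<beta> * x' - d \<in> I"
    proof -
      have "d / \<beta> \<le> x" "x \<le> (d + upper) / \<beta>" using d beta_gt1 by (auto simp: field_simps I_eq)
      moreover have f: "d / \<beta> \<in> F" "(d + upper) / \<beta> \<in> F"
      proof -
        show "d / \<beta> \<in> F" using d div_beta_in_F by simp
        show "(d + upper) / \<beta> \<in> F"
        proof (cases "d = N")
          case True
          then have "(d + upper) / \<beta> = upper" using upper_eq beta_gt1 by (simp add: field_simps)
          then show ?thesis using upper_in_F by simp
        next
          case False
          then show ?thesis using switch_end_in_F[of "Suc d"] d by (simp add: overlap_def)
        qed
      qed
      moreover have "d / \<beta> \<noteq> x" using f assms by auto
      ultimately have "d / \<beta> < x'" "\<not> (d + upper) / \<beta> < x'" using assms(3) unfolding same_gap_def by (force, force)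
      then show ?thesis using beta_gt1 by (auto simp: field_simps I_eq)
    qed
    have "\<beta> * x' = d + (\<beta> * x' - d)" by simp
    with d(1) adm have "random_digit \<beta> (\<omega>', x') = d" by (cases rule: random_step_cases) (use False S in auto)
    then show ?thesis using e by simp
  qed
qed

text \<open>Treats \<open>X_set\<close> and the two fixed endpoints uniformly. An endpoint lies in
  \<open>F\<close>, outside the gap that codes it by convention; therefore everything is asserted
  for points of the coding gap instead of for \<open>p\<close>.\<close>

lemma itinerary:
  assumes p: "p \<in> X_star \<beta>"
  defines "C \<equiv> C_interval \<beta> (alpha \<beta> p 0)" and "d \<equiv> random_digit \<beta> p"
  shows itinerary_branch: "\<And>y :: real. y \<in> C_interval \<beta> (alpha \<beta> p 1) \<Longrightarrow> (d + y) / \<beta> \<in> C"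
    and itinerary_switch: "\<And>x. x \<in> C \<Longrightarrow> x \<in> switch_region \<beta> \<longleftrightarrow> snd p \<in> switch_region \<beta>"
    and itinerary_digit: "\<And>x \<omega>. x \<in> C \<Longrightarrow> (x \<in> switch_region \<beta> \<Longrightarrow> \<omega> 0 = fst p 0) \<Longrightarrow> random_digit \<beta> (\<omega>, x) = d"
proof -
  \<comment> \<open>As \<open>1 / \<beta>\<close> is in \<open>F\<close>, the first gap lies left of
    all switch regions and the digit 0 is forced there, just as at the endpoint 0; \<open>CL\<close>
    is the counterpart at \<open>upper\<close>.\<close>
  have C1: "x < 1 / \<beta>" "x > 0" if "x \<in> C_interval \<beta> 1" for x
  proof -
    obtain i where i: "i \<le> L" "F_nth i = 1 / \<beta>" using F_nth_ex div_beta_in_F[of 1] N_ge1 by auto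
    have "i \<noteq> 0" using i F_nth_0 beta_gt1 by (metis divide_pos_pos less_numeral_extra(3) less_trans zero_less_one)
    then have "F_nth 1 \<le> 1 / \<beta>" using i F_nth_less[of 1 i] by (cases "i = 1") auto
    then show "x < 1 / \<beta>" "x > 0" using that F_nth_0 by (auto simp: C_eq)
  qed
  have CL: "x > (N + overlap) / \<beta>" "x < upper" if "x \<in> C_interval \<beta> L" for x
  proof -
    obtain i where i: "i \<le> L" "F_nth i = (N + overlap) / \<beta>" using F_nth_ex switch_end_in_F[of N] N_ge1 by auto
    have "i \<noteq> L" using i F_nth_L upper_gt_switch by auto
    then have "(N + overlap) / \<beta> \<le> F_nth (L - 1)" using i F_nth_less[of i "L - 1"] proof (cases "i < L - 1")
      case False
      then have "i = L - 1" using i \<open>i \<noteq> L\<close> by linarith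
      then show ?thesis using i by simp
    qed simp
    then show "x > (N + overlap) / \<beta>" "x < upper" using that F_nth_L by (auto simp: C_eq)
  qed
  have cases3: "p \<in> X_set \<beta> \<or> snd p = 0 \<or> snd p = upper" using p X_star_iff by blast
  have d0: "d = random_expansion \<beta> p 0" by (simp add: d_def random_expansion_def)
  show "(d + y) / \<beta> \<in> C" if y: "y \<in> C_interval \<beta> (alpha \<beta> p 1)" for y :: real
    using cases3
  proof (elim disjE)
    assume X: "p \<in> X_set \<beta>"
    let ?z = "snd (random_map \<beta> p)"
    have z: "?z \<in> C_interval \<beta> (alpha \<beta> p 1)" using alpha_X(2)[OF X, of 1] by simp
    have sg: "same_gap ?z y" using C_same_gap[OF alpha_X(1)[OF X] z y] .
    have zy: "?z \<in> I - F" "y \<in> I - F" using C_props(1)[OF alpha_X(1)[OF X, of 1]] z y by auto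
    have dN: "d \<le> N" using random_map_in_I(2)[of "snd p" "fst p"] X by (simp add: d_def X_set_iff)
    have "(d + ?z) / \<beta> = snd p" using beta_gt1 by (simp add: random_map_snd d_def)
    then have "same_gap (snd p) ((d + y) / \<beta>)" using same_gap_branch[OF zy dN sg] by simp
    moreover have "(d + y) / \<beta> \<in> I - F" using branch_in_I_F[OF zy(2) dN] .
    moreover have "snd p \<in> C" using alpha_X(2)[OF X, of 0] by (simp add: C_def)
    ultimately show ?thesis unfolding C_def using C_same_gap_iff alpha_X(1)[OF X] by blast
  next
    assume z: "snd p = 0"
    \<comment> \<open>The inverse branch contracts towards its fixed point 0 and so maps the
      adjacent gap into itself.\<close>
    have "0 < y" "y < F_nth 1" using y F_nth_0 by (auto simp: alpha_0[OF z] C_eq)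
    moreover have "y / \<beta> < y" using \<open>0 < y\<close> beta_gt1 by (simp add: field_simps)
    ultimately have "0 < y / \<beta>" "y / \<beta> < F_nth 1" using beta_gt1 by auto
    then show ?thesis using F_nth_0 by (simp add: C_def alpha_0[OF z] C_eq d0 random_map_0[OF z])
  next
    assume z: "snd p = upper"
    have y: "F_nth (L - 1) < y" "y < upper" using y F_nth_L by (auto simp: alpha_upper[OF z] C_eq)
    have "\<beta> * y < N + y" using y(2) beta_gt1 by (simp add: upper_def field_simps)
    then have "y < (N + y) / \<beta>" using beta_gt1 by (simp add: field_simps)
    moreover have "(N + y) / \<beta> < upper" using y upper_eq beta_gt1 by (simp add: field_simps)
    ultimately show ?thesis using y F_nth_L by (simp add: C_def alpha_upper[OF z] C_eq d0 random_map_upper[OF z])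
  qed
  have X: "snd p \<in> I - F \<and> x \<in> I - F \<and> same_gap (snd p) x" if "p \<in> X_set \<beta>" "x \<in> C" for x
    using C_props(1)[OF alpha_X(1)[OF that(1), of 0]] C_same_gap[OF alpha_X(1)[OF that(1), of 0]]
      alpha_X(2)[OF that(1), of 0] that(2) by (auto simp: C_def)
  have end0: "random_digit \<beta> (\<omega>, x) = d \<and> x \<notin> switch_region \<beta>" if "snd p = 0" "x \<in> C" for x \<omega>
    using forced_digit_0[of x \<omega>] C1[of x] that by (auto simp: C_def alpha_0 d0 random_map_0)
  have endL: "random_digit \<beta> (\<omega>, x) = d \<and> x \<notin> switch_region \<beta>" if "snd p = upper" "x \<in> C" for x \<omega>
    using forced_digit_N[of x \<omega>] CL[of x] that by (auto simp: C_def alpha_upper d0 random_map_upper)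
  show "x \<in> switch_region \<beta> \<longleftrightarrow> snd p \<in> switch_region \<beta>" if "x \<in> C" for x
    using cases3
  proof (elim disjE)
    assume "p \<in> X_set \<beta>"
    then show ?thesis using X[OF _ that] same_gap_digit(1) by blast
  next
    assume z: "snd p = 0"
    then show ?thesis using end0[OF z that] random_map_0(3)[OF z] by simp
  next
    assume z: "snd p = upper"
    then show ?thesis using endL[OF z that] random_map_upper(3)[OF z] by simp
  qed
  show "random_digit \<beta> (\<omega>, x) = d" if "x \<in> C" and w: "x \<in> switch_region \<beta> \<Longrightarrow> \<omega> 0 = fst p 0" for x \<omega>
    using cases3
  proof (elim disjE)
    assume "p \<in> X_set \<beta>"
    note x = X[OF this that(1)]
    have "random_digit \<beta> (fst p, snd p) = random_digit \<beta> (\<omega>, x)"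
      by (rule same_gap_digit(2)) (use x w same_gap_digit(1)[of "snd p" x] in auto)
    then show ?thesis by (simp add: d_def)
  next
    assume z: "snd p = 0"
    then show ?thesis using end0[OF z that(1)] by simp
  next
    assume z: "snd p = upper"
    then show ?thesis using endL[OF z that(1)] by simp
  qed
qed

definition visits :: "(nat \<Rightarrow> bool) \<times> real \<Rightarrow> nat \<Rightarrow> nat" where
  "visits p n = card {k. k < n \<and> snd ((random_map \<beta> ^^ k) p) \<in> switch_region \<beta>}"

lemma visits_0 [simp]: "visits p 0 = 0" by (simp add: visits_def)

lemma visits_Suc: "visits p (Suc n) = of_bool (snd p \<in> switch_region \<beta>) + visits (random_map \<beta> p) n"
proof -
  let ?P = "\<lambda>p k. snd ((random_map \<beta> ^^ k) p) \<in> switch_region \<beta>"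
  have "{k. k < Suc n \<and> ?P p k} = (if ?P p 0 then {0} else {}) \<union> Suc ` {k. k < n \<and> ?P (random_map \<beta> p) k}"
    by (auto simp: less_Suc_eq_0_disj funpow_swap1 image_iff)
  also have "card \<dots> = of_bool (?P p 0) + card {k. k < n \<and> ?P (random_map \<beta> p) k}"
    by (subst card_Un_disjoint) (auto simp: card_image)
  finally show ?thesis by (simp add: visits_def)
qed

lemma visits_le: "visits p n \<le> n"
proof (induction n arbitrary: p)
  case (Suc n)
  show ?case using Suc[of "random_map \<beta> p"] by (simp add: visits_Suc)
qed simp

text \<open>The midpoint of the common coding gap is a proxy at which both digits can be read off,
  even if one of the points is an endpoint. Both points also agree on whether a coin is consumed, so
  the coding condition passes to the images with \<open>n\<close> lowered by one.\<close>

lemma same_code_expansion: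
  assumes "p \<in> X_star \<beta>" "q \<in> X_star \<beta>" "\<And>k. k < n \<Longrightarrow> fst p k = fst q k" "\<And>k. k < n \<Longrightarrow> alpha \<beta> p k = alpha \<beta> q k"
    "k < n"
  shows "random_expansion \<beta> p k = random_expansion \<beta> q k"
  using assms
proof (induction k arbitrary: p q n)
  case 0
  let ?m = "mid (alpha \<beta> p 0)"
  have m: "?m \<in> C_interval \<beta> (alpha \<beta> p 0)" "?m \<in> C_interval \<beta> (alpha \<beta> q 0)"
    using mid_in_C[OF alpha_range[OF 0(1), of 0]] 0(4)[of 0] 0(5) by auto
  have "random_digit \<beta> (fst p, ?m) = random_digit \<beta> p" using itinerary_digit[OF 0(1) m(1)] by blast
  moreover have "random_digit \<beta> (fst p, ?m) = random_digit \<beta> q" using itinerary_digit[OF 0(2) m(2)] 0(3,5) by blast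
  ultimately show ?case by (simp add: random_expansion_def)
next
  case (Suc k)
  let ?m = "mid (alpha \<beta> p 0)"
  have m: "?m \<in> C_interval \<beta> (alpha \<beta> p 0)" "?m \<in> C_interval \<beta> (alpha \<beta> q 0)"
    using mid_in_C[OF alpha_range[OF Suc(2), of 0]] Suc(5)[of 0] Suc(6) by auto
  have v: "snd p \<in> switch_region \<beta> \<longleftrightarrow> snd q \<in> switch_region \<beta>"
    using itinerary_switch[OF Suc(2) m(1)] itinerary_switch[OF Suc(3) m(2)] by blast
  obtain n' where n': "n = Suc n'" using Suc(6) by (cases n) auto
  have "random_expansion \<beta> (random_map \<beta> p) k = random_expansion \<beta> (random_map \<beta> q) k"
  proof (rule Suc.IH)
    show "random_map \<beta> p \<in> X_star \<beta>" "random_map \<beta> q \<in> X_star \<beta>" using X_star_map Suc by auto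
    show "k < n'" using Suc(6) n' by simp
    show "fst (random_map \<beta> p) j = fst (random_map \<beta> q) j" if "j < n'" for j
      using Suc(4)[of j] Suc(4)[of "Suc j"] that n' v by (auto simp: random_map_fst)
    show "alpha \<beta> (random_map \<beta> p) j = alpha \<beta> (random_map \<beta> q) j" if "j < n'" for j
      using Suc(5)[of "Suc j"] that n' alpha_map Suc(2,3) by auto
  qed
  then show ?case by (simp add: random_expansion_def funpow_swap1)
qed

text \<open>Makes the \<open>LEAST\<close> in \<open>rho\<close> meaningful: equal codes give equal
  digits, and digits determine the point.\<close>

lemma separated:
  assumes "p \<in> X_star \<beta>" "q \<in> X_star \<beta>" "p \<noteq> q"
  shows "\<exists>k. fst p k \<noteq> fst q k \<or> alpha \<beta> p k \<noteq> alpha \<beta> q k"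
proof (rule ccontr)
  assume *: "\<not> ?thesis"
  have "random_expansion \<beta> p = random_expansion \<beta> q"
  proof
    fix k show "random_expansion \<beta> p k = random_expansion \<beta> q k"
      by (rule same_code_expansion[where n="Suc k"]) (use * assms in auto)
  qed
  then have "snd p = snd q" using bval_random_expansion X_star_in_I assms by metis
  moreover have "fst p = fst q" using * by auto
  ultimately show False using assms(3) by (simp add: prod_eq_iff)
qed

section \<open>Cylinders of the coding and their probabilities\<close>

definition cyl :: "(nat \<Rightarrow> bool) \<times> real \<Rightarrow> nat \<Rightarrow> ((nat \<Rightarrow> bool) \<times> real) set" where
  "cyl p n = {q \<in> X_star \<beta>. \<forall>k<n. fst p k = fst q k \<and> alpha \<beta> p k = alpha \<beta> q k}"

lemma rho_less_iff:
  assumes p: "p \<in> X_star \<beta>" and q: "q \<in> X_star \<beta>" and r: "r > 0" and n: "\<And>m. \<beta> powr - real m < r \<longleftrightarrow> n \<le> m"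
  shows "rho \<beta> p q < r \<longleftrightarrow> q \<in> cyl p n"
proof (cases "p = q")
  case True
  then show ?thesis using r q by (simp add: rho_def cyl_def)
next
  case False
  define m where "m = (LEAST k. fst p k \<noteq> fst q k \<or> alpha \<beta> p k \<noteq> alpha \<beta> q k)"
  have m: "fst p m \<noteq> fst q m \<or> alpha \<beta> p m \<noteq> alpha \<beta> q m"
    unfolding m_def using separated[OF p q False] by (rule LeastI_ex)
  have m': "fst p k = fst q k \<and> alpha \<beta> p k = alpha \<beta> q k" if "k < m" for k
    using not_less_Least that unfolding m_def by blast
  have "rho \<beta> p q < r \<longleftrightarrow> n \<le> m" using n False by (simp add: rho_def m_def)
  also have "\<dots> \<longleftrightarrow> q \<in> cyl p n" using m m' q unfolding cyl_def by (auto simp: not_less)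
  finally show ?thesis .
qed

lemma rho_metric: "Metric_space (X_star \<beta>) (rho \<beta>)"
proof
  fix p q u
  show "0 \<le> rho \<beta> p q" by (simp add: rho_def)
  have "(\<lambda>k. fst p k \<noteq> fst q k \<or> alpha \<beta> p k \<noteq> alpha \<beta> q k) = (\<lambda>k. fst q k \<noteq> fst p k \<or> alpha \<beta> q k \<noteq> alpha \<beta> p k)"
    unfolding fun_eq_iff by (simp only: eq_commute[of "fst p _" "fst q _"] eq_commute[of "alpha \<beta> p _" "alpha \<beta> q _"] simp_thms)
  then show "rho \<beta> p q = rho \<beta> q p" unfolding rho_def by (simp only: eq_commute[of p q])
  show "rho \<beta> p q = 0 \<longleftrightarrow> p = q" if "p \<in> X_star \<beta>" "q \<in> X_star \<beta>" using beta_gt1 by (auto simp: rho_def)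
  show "rho \<beta> p u \<le> rho \<beta> p q + rho \<beta> q u" if "p \<in> X_star \<beta>" "q \<in> X_star \<beta>" "u \<in> X_star \<beta>"
  proof (cases "p = q \<or> q = u \<or> p = u")
    case True
    then show ?thesis by (auto simp: rho_def)
  next
    case False
    let ?D = "\<lambda>p q k. fst p k \<noteq> fst q k \<or> alpha \<beta> p k \<noteq> alpha \<beta> q k"
    have "?D p u (LEAST k. ?D p u k)" using separated[of p u] that False by (intro LeastI_ex[of "?D p u"]) simp
    then have "?D p q (LEAST k. ?D p u k) \<or> ?D q u (LEAST k. ?D p u k)" by auto
    then have "(LEAST k. ?D p q k) \<le> (LEAST k. ?D p u k) \<or> (LEAST k. ?D q u k) \<le> (LEAST k. ?D p u k)"
      using Least_le[of "?D p q"] Least_le[of "?D q u"] by blast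
    moreover have "\<beta> powr - real j \<le> \<beta> powr - real i" if "i \<le> j" for i j
      using that beta_gt1 by (intro powr_mono) auto
    moreover have "p \<noteq> q" "q \<noteq> u" "p \<noteq> u" using False by auto
    ultimately have "rho \<beta> p u \<le> rho \<beta> p q \<or> rho \<beta> p u \<le> rho \<beta> q u"
      unfolding rho_def by (elim disjE) (simp_all only: if_False simp_thms)
    moreover have "0 \<le> rho \<beta> p q" "0 \<le> rho \<beta> q u" by (auto simp: rho_def)
    ultimately show ?thesis by linarith
  qed
qed

text \<open>Gaps and coins are counted separately, since one step of the orbit always uses up a gap
  but uses up a coin only at a visit.\<close>

definition cyl_event :: "(nat \<Rightarrow> bool) \<times> real \<Rightarrow> nat \<Rightarrow> nat \<Rightarrow> (nat \<Rightarrow> nat) set" where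
  "cyl_event p n l = {b \<in> space D. good b \<and> (\<forall>k<n. bval (drop_seq k b) \<in> C_interval \<beta> (alpha \<beta> p k)) \<and> (\<forall>i<l. coins b i = fst p i)}"

lemma sets_C [measurable]: "C_interval \<beta> k \<in> sets borel" by (simp add: C_eq)

lemma sets_cyl_event [measurable]: "cyl_event p n l \<in> sets D"
  unfolding cyl_event_def by measurable

text \<open>Each of the \<open>n\<close> transitions between gaps amounts to prescribing one digit,
  at the price \<open>1 / (N + 1)\<close>, and absorbs one coin if it starts at a visit. The coins
  left over are fair given the last gap, by \<open>coin_event_fair\<close>; \<open>n \<le> l\<close>
  ensures that no visit finds the prescribed coins used up.\<close>

lemma pr_cyl_event:
  assumes "p \<in> X_star \<beta>" "n \<le> l"
  shows "pr (cyl_event p (Suc n) l) =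
    (1 / (N + 1)) ^ n * (1 / 2) ^ (l - visits p n) * pr (coin_event (C_interval \<beta> (alpha \<beta> p n)) (\<lambda>_. True) 0)"
  using assms
proof (induction n arbitrary: p l)
  case 0
  have "cyl_event p (Suc 0) l = coin_event (C_interval \<beta> (alpha \<beta> p 0)) (fst p) l"
    by (simp add: cyl_event_def coin_event_def)
  moreover have "coin_event (C_interval \<beta> (alpha \<beta> p 0)) (fst p) 0 = coin_event (C_interval \<beta> (alpha \<beta> p 0)) (\<lambda>_. True) 0"
    by (simp add: coin_event_def)
  ultimately show ?case
    using coin_event_fair[OF C_saturated[OF alpha_range[OF 0(1), of 0]], of "fst p" l]
    by (simp only: power_0 visits_0 diff_zero mult_1_left)
next
  case (Suc n)
  let ?d = "random_digit \<beta> p" and ?q = "random_map \<beta> p"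
  let ?v = "snd p \<in> switch_region \<beta>"
  define l' where "l' = l - of_bool ?v"
  have l: "1 \<le> l" "n \<le> l'" using Suc.prems(2) by (auto simp: l'_def)
  have q: "?q \<in> X_star \<beta>" using X_star_map Suc.prems by blast
  have dN: "?d \<le> N" using random_map_in_I(2)[of "snd p" "fst p"] X_star_in_I[OF Suc.prems(1)] by simp
  have set_eq: "cyl_event p (Suc (Suc n)) l = {b \<in> space D. b 0 = ?d \<and> drop_seq 1 b \<in> cyl_event ?q (Suc n) l'}"
  proof (intro set_eqI)
    fix b
    have "b \<in> cyl_event p (Suc (Suc n)) l \<longleftrightarrow> b 0 = ?d \<and> drop_seq 1 b \<in> cyl_event ?q (Suc n) l'"
      if b: "b \<in> space D" "good b"
    proof -
      have rec: "recurrent b" using good_recurrent b by blast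
      have tail: "(\<forall>k<Suc (Suc n). bval (drop_seq k b) \<in> C_interval \<beta> (alpha \<beta> p k)) \<longleftrightarrow>
         bval b \<in> C_interval \<beta> (alpha \<beta> p 0) \<and> (\<forall>k<Suc n. bval (drop_seq k (drop_seq 1 b)) \<in> C_interval \<beta> (alpha \<beta> ?q k))"
        using alpha_map[OF Suc.prems(1)] by (subst All_less_Suc2) (simp del: drop_seq_nth)
      have coin: "(\<forall>i<l. coins b i = fst p i) \<longleftrightarrow> (?v \<longrightarrow> coins b 0 = fst p 0) \<and> (\<forall>i<l'. coins (drop_seq 1 b) i = fst ?q i)"
        if "visit b \<longleftrightarrow> ?v"
      proof (cases ?v)
        case True
        then have c: "coins (drop_seq 1 b) i = coins b (Suc i)" for i using that by simp
        obtain l0 where l0: "l = Suc l0" using l by (cases l) auto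
        have "(\<forall>i<l. coins b i = fst p i) \<longleftrightarrow> coins b 0 = fst p 0 \<and> (\<forall>i<l0. coins b (Suc i) = fst p (Suc i))"
          unfolding l0 by (rule All_less_Suc2)
        then show ?thesis using True l0 unfolding c by (simp add: random_map_fst l'_def del: coins.simps)
      next
        case False
        then have "coins b = coins (drop_seq 1 b)" using that coins_not_visit[OF rec] by blast
        then show ?thesis using False by (simp add: random_map_fst l'_def)
      qed
      have inC: "visit b \<longleftrightarrow> ?v" if "bval b \<in> C_interval \<beta> (alpha \<beta> p 0)"
        using itinerary_switch[OF Suc.prems(1) that] .
      \<comment> \<open>Inside the gap the first digit and the first coin carry the same information
        at a visit; elsewhere the digit is forced and both sides hold.\<close>
      have digit: "b 0 = ?d \<longleftrightarrow> (?v \<longrightarrow> coins b 0 = fst p 0)" if c: "bval b \<in> C_interval \<beta> (alpha \<beta> p 0)"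
      proof -
        have e: "random_digit \<beta> (fst p, bval b) = ?d" using itinerary_digit[OF Suc.prems(1) c] by blast
        show ?thesis
          using b(1)
        proof (cases rule: digit_cases)
          case lower
          have "coins b 0" using coins_visit(1)[OF lower(1)] lower overlap_less1 by simp
          then show ?thesis using e lower inC[OF c] by (cases "fst p 0") auto
        next
          case higher
          have "\<not> coins b 0" using coins_visit(1)[OF higher(1)] higher by simp
          then show ?thesis using e higher inC[OF c] by (cases "fst p 0") auto
        next
          case forced
          then show ?thesis using e inC[OF c] by auto
        qed
      qed
      \<comment> \<open>The Markov property: digit and next gap already imply the current gap, so
        the current gap need not be prescribed after the shift.\<close>
      have branch: "bval b \<in> C_interval \<beta> (alpha \<beta> p 0)" if "b 0 = ?d" "bval (drop_seq 1 b) \<in> C_interval \<beta> (alpha \<beta> ?q 0)"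
      proof -
        have "(?d + bval (drop_seq 1 b)) / \<beta> = bval b" using bval_step[OF b(1)] that(1) beta_gt1 by (simp add: field_simps)
        then show ?thesis using itinerary_branch[OF Suc.prems(1), of "bval (drop_seq 1 b)"] that(2) alpha_map[OF Suc.prems(1), of 0] by simp
      qed
      have l1: "b \<in> cyl_event p (Suc (Suc n)) l \<longleftrightarrow> (\<forall>k<Suc (Suc n). bval (drop_seq k b) \<in> C_interval \<beta> (alpha \<beta> p k)) \<and> (\<forall>i<l. coins b i = fst p i)"
        using b by (simp add: cyl_event_def)
      have l2: "drop_seq 1 b \<in> cyl_event ?q (Suc n) l' \<longleftrightarrow> (\<forall>k<Suc n. bval (drop_seq k (drop_seq 1 b)) \<in> C_interval \<beta> (alpha \<beta> ?q k)) \<and> (\<forall>i<l'. coins (drop_seq 1 b) i = fst ?q i)"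
        unfolding cyl_event_def using b good_drop[of 1 b] drop_in_D[of b 1] by blast
      have l3: "bval (drop_seq 1 b) \<in> C_interval \<beta> (alpha \<beta> ?q 0)" if "drop_seq 1 b \<in> cyl_event ?q (Suc n) l'"
      proof -
        have "bval (drop_seq 0 (drop_seq 1 b)) \<in> C_interval \<beta> (alpha \<beta> ?q 0)" using that unfolding l2 by blast
        then show ?thesis by (simp only: drop_seq_0)
      qed
      show ?thesis
      proof
        assume "b \<in> cyl_event p (Suc (Suc n)) l"
        then have C: "bval b \<in> C_interval \<beta> (alpha \<beta> p 0)"
          and 1: "\<forall>k<Suc n. bval (drop_seq k (drop_seq 1 b)) \<in> C_interval \<beta> (alpha \<beta> ?q k)"
          and 2: "\<forall>i<l. coins b i = fst p i" unfolding l1 tail by blast+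
        then show "b 0 = ?d \<and> drop_seq 1 b \<in> cyl_event ?q (Suc n) l'"
          using coin[OF inC[OF C]] digit[OF C] unfolding l2 by blast
      next
        assume *: "b 0 = ?d \<and> drop_seq 1 b \<in> cyl_event ?q (Suc n) l'"
        then have C: "bval b \<in> C_interval \<beta> (alpha \<beta> p 0)" using branch l3 by blast
        then show "b \<in> cyl_event p (Suc (Suc n)) l"
          using * coin[OF inC[OF C]] digit[OF C] unfolding l1 l2 tail by blast
      qed
    qed
    moreover have "b \<in> space D \<and> good b" if "b \<in> cyl_event p (Suc (Suc n)) l \<or> b \<in> space D \<and> drop_seq 1 b \<in> cyl_event ?q (Suc n) l'"
      using that good_drop[of 1 b] unfolding cyl_event_def by blast
    ultimately show "b \<in> cyl_event p (Suc (Suc n)) l \<longleftrightarrow> b \<in> {b \<in> space D. b 0 = ?d \<and> drop_seq 1 b \<in> cyl_event ?q (Suc n) l'}"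
      by blast
  qed
  have "pr (cyl_event p (Suc (Suc n)) l) = pr (cyl_event ?q (Suc n) l') / (N + 1)"
    using pr_first_digit[of "{?d}" "\<lambda>_. cyl_event ?q (Suc n) l'"] dN unfolding set_eq by simp
  moreover have "pr (cyl_event ?q (Suc n) l') / (N + 1) = (1 / (N + 1)) ^ n * (1 / 2) ^ (l' - visits ?q n) * pr (coin_event (C_interval \<beta> (alpha \<beta> ?q n)) (\<lambda>_. True) 0) / (N + 1)"
    by (simp only: Suc.IH[OF q l(2)])
  moreover have "l' - visits ?q n = l - visits p (Suc n)" by (simp add: l'_def visits_Suc)
  ultimately show ?case by (simp add: alpha_map[OF Suc.prems(1)])
qed

section \<open>The measure of balls\<close>

abbreviation state_space :: "((nat \<Rightarrow> bool) \<times> real) measure" where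
  "state_space \<equiv> PiM UNIV (\<lambda>_. count_space UNIV) \<Otimes>\<^sub>M restrict_space borel I"

lemma space_state_space: "space state_space = UNIV \<times> I"
  by (simp add: space_pair_measure space_PiM space_restrict_space PiE_UNIV_domain)

lemma measurable_state_space_coin [measurable]: "(\<lambda>p. fst p n) \<in> state_space \<rightarrow>\<^sub>M count_space UNIV"
  by (rule measurable_compose[OF measurable_fst measurable_component_singleton]) simp

lemma measurable_state_space_snd [measurable]: "snd \<in> state_space \<rightarrow>\<^sub>M borel"
  by (rule measurable_compose[OF measurable_snd measurable_restrict_space1[OF measurable_ident, unfolded id_def]])

text \<open>A closed formula in place of the \<open>THE\<close> description, to get measurability.
  The floor yields the larger admissible digit; the cap is needed because \<open>\<beta> * x\<close>
  can be as large as \<open>N + upper\<close>, which exceeds \<open>N + 1\<close>.\<close>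

lemma random_digit_floor:
  assumes "x \<in> I"
  shows "real (random_digit \<beta> (\<omega>, x)) = min (real N) (of_int \<lfloor>\<beta> * x\<rfloor>) - of_bool (x \<in> switch_region \<beta> \<and> \<not> \<omega> 0)"
proof -
  obtain d y where d: "d \<le> N" "y \<in> I" "\<beta> * x = d + y" using admissible_exists assms by blast
  have y: "0 \<le> y" "y \<le> 1 + overlap" using d by (auto simp: I_eq overlap_def)
  have fl: "\<lfloor>\<beta> * x\<rfloor> = int d + \<lfloor>y\<rfloor>" unfolding d(3) by simp
  show ?thesis
    using d
  proof (cases rule: random_step_cases)
    case lower
    then have "\<lfloor>y\<rfloor> = 0" using y overlap_less1 by (simp add: floor_eq_iff)
    then show ?thesis using lower fl d by (auto simp: of_nat_diff)
  next
    case higher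
    then have "\<lfloor>y\<rfloor> = 1" using y overlap_less1 by (simp add: floor_eq_iff)
    then show ?thesis using higher fl d by auto
  next
    case forced
    show ?thesis
    proof (cases "d = N")
      case True
      have "0 \<le> \<lfloor>y\<rfloor>" using y by simp
      then show ?thesis using True fl forced by (simp add: min_def)
    next
      case False
      then have "\<lfloor>y\<rfloor> = 0" using y forced by (simp add: floor_eq_iff)
      then show ?thesis using forced fl d by simp
    qed
  qed
qed

lemma measurable_random_map [measurable]: "random_map \<beta> \<in> state_space \<rightarrow>\<^sub>M state_space"
proof (rule measurable_pair)
  have "(\<lambda>p. fst (random_map \<beta> p)) \<in> state_space \<rightarrow>\<^sub>M PiM UNIV (\<lambda>_. count_space UNIV)"
  proof (rule measurable_PiM_single')
    fix n
    have "(\<lambda>p. if snd p \<in> switch_region \<beta> then fst p (Suc n) else fst p n) \<in> state_space \<rightarrow>\<^sub>M count_space UNIV"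
      by measurable
    moreover have "(\<lambda>p. fst (random_map \<beta> p) n) = (\<lambda>p. if snd p \<in> switch_region \<beta> then fst p (Suc n) else fst p n)"
      by (simp add: random_map_fst fun_eq_iff)
    ultimately show "(\<lambda>p. fst (random_map \<beta> p) n) \<in> state_space \<rightarrow>\<^sub>M count_space UNIV" by simp
  qed (simp add: PiE_UNIV_domain)
  then show "fst \<circ> random_map \<beta> \<in> state_space \<rightarrow>\<^sub>M PiM UNIV (\<lambda>_. count_space UNIV)" by (simp add: comp_def)
  have "(\<lambda>p. \<beta> * snd p - (min (real N) (of_int \<lfloor>\<beta> * snd p\<rfloor>) - (if snd p \<in> switch_region \<beta> \<and> \<not> fst p 0 then 1 else 0))) \<in> state_space \<rightarrow>\<^sub>M borel"
    by measurable
  moreover have "snd (random_map \<beta> p) = \<beta> * snd p - (min (real N) (of_int \<lfloor>\<beta> * snd p\<rfloor>) - (if snd p \<in> switch_region \<beta> \<and> \<not> fst p 0 then 1 else 0))"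
    if "p \<in> space state_space" for p
    using that random_digit_floor[of "snd p" "fst p"] by (auto simp: space_state_space random_map_snd)
  ultimately have "(\<lambda>p. snd (random_map \<beta> p)) \<in> state_space \<rightarrow>\<^sub>M borel"
    by (subst measurable_cong)
  then have "(\<lambda>p. snd (random_map \<beta> p)) \<in> state_space \<rightarrow>\<^sub>M restrict_space borel I"
    using random_map_in_I(1) by (intro measurable_restrict_space2) (auto simp: space_state_space)
  then show "snd \<circ> random_map \<beta> \<in> state_space \<rightarrow>\<^sub>M restrict_space borel I" by (simp add: comp_def)
qed

lemma measurable_random_orbit [measurable]: "(random_map \<beta> ^^ n) \<in> state_space \<rightarrow>\<^sub>M state_space"
proof (induction n)
  case (Suc n)
  then show ?case using measurable_comp[OF Suc measurable_random_map] by simp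
qed (simp add: id_def)

lemma measurable_snd_orbit [measurable]: "(\<lambda>p. snd ((random_map \<beta> ^^ n) p)) \<in> state_space \<rightarrow>\<^sub>M borel"
  by (rule measurable_compose[OF measurable_random_orbit measurable_state_space_snd])

lemma sets_cyl:
  assumes p: "p \<in> X_star \<beta>"
  shows "cyl p n \<in> sets state_space"
proof -
  have [measurable]: "F \<in> sets borel" using finite_F by (intro borel_closed finite_imp_closed)
  \<comment> \<open>On \<open>X_set\<close> the code is expressed by membership of orbit points in
    gaps (\<open>A\<close>); on the two endpoint fibres it is constant (\<open>B\<close>). Both
    descriptions are visibly measurable.\<close>
  define A where "A = {q \<in> space state_space. (\<forall>k. snd ((random_map \<beta> ^^ k) q) \<notin> F) \<and> (\<forall>k<n. fst p k = fst q k \<and> snd ((random_map \<beta> ^^ k) q) \<in> C_interval \<beta> (alpha \<beta> p k))}"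
  define B where "B z a = {q \<in> space state_space. snd q = z \<and> (\<forall>k<n. fst p k = fst q k \<and> alpha \<beta> p k = a)}" for z a
  have "A \<in> sets state_space" "B z a \<in> sets state_space" for z a unfolding A_def B_def by measurable
  moreover have "cyl p n = A \<union> B 0 1 \<union> B upper L"
  proof (intro set_eqI)
    fix q
    have 0: "snd q = 0 \<or> snd q = upper \<Longrightarrow> q \<notin> X_set \<beta>"
      using X_set_orbit[of q 0] zero_in_F upper_in_F by auto
    consider "q \<in> X_set \<beta>" | "snd q = 0" "q \<in> X_star \<beta>" | "snd q = upper" "q \<in> X_star \<beta>" | "q \<notin> X_star \<beta>" using X_star_iff by blast
    then show "q \<in> cyl p n \<longleftrightarrow> q \<in> A \<union> B 0 1 \<union> B upper L"
    proof cases
      case 1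
      then have "q \<in> X_star \<beta>" "snd q \<in> I" "\<And>k. snd ((random_map \<beta> ^^ k) q) \<notin> F" "snd q \<noteq> 0" "snd q \<noteq> upper"
        using X_star_iff X_set_iff 0 by blast+
      moreover have "alpha \<beta> p k = alpha \<beta> q k \<longleftrightarrow> snd ((random_map \<beta> ^^ k) q) \<in> C_interval \<beta> (alpha \<beta> p k)" for k
        using alpha_eq_iff[OF 1 alpha_range[OF p, of k], of k] by metis
      ultimately show ?thesis unfolding cyl_def A_def B_def by (simp add: space_state_space mem_Times_iff)
    next
      case 2
      have "snd q \<in> F" using 2 zero_in_F by simp
      then have "q \<notin> A" unfolding A_def by (auto intro: exI[of _ 0] dest: spec[of _ 0])
      then show ?thesis using 2 upper_gt1 X_star_in_I[OF 2(2)] alpha_0[OF 2(1)]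
        unfolding cyl_def B_def by (auto simp: space_state_space mem_Times_iff)
    next
      case 3
      have "snd q \<in> F" using 3 upper_in_F by simp
      then have "q \<notin> A" unfolding A_def by (auto intro: exI[of _ 0] dest: spec[of _ 0])
      then show ?thesis using 3 upper_gt1 X_star_in_I[OF 3(2)] alpha_upper[OF 3(1)]
        unfolding cyl_def B_def by (auto simp: space_state_space mem_Times_iff)
    next
      case 4
      then have n: "\<not> (snd q \<in> I \<and> (\<forall>n. snd ((random_map \<beta> ^^ n) q) \<notin> F))" "snd q \<noteq> 0" "snd q \<noteq> upper"
        by (auto simp: X_star_iff X_set_iff)
      then show ?thesis using 4 unfolding cyl_def A_def B_def by (auto simp: space_state_space mem_Times_iff)
    qed
  qed
  ultimately show ?thesis by simp
qed

lemma measurable_decode [measurable]: "decode \<in> D \<rightarrow>\<^sub>M state_space"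
  unfolding decode_def
proof (rule measurable_Pair)
  show "coins \<in> D \<rightarrow>\<^sub>M PiM UNIV (\<lambda>_. count_space UNIV)"
    by (rule measurable_PiM_single') (auto simp: PiE_UNIV_domain)
  show "bval \<in> D \<rightarrow>\<^sub>M restrict_space borel I"
    using bval_in_I by (intro measurable_restrict_space2) auto
qed

lemma sets_nu: "sets (nu \<beta>) = sets state_space"
  unfolding nu_def space_state_space[symmetric] by (simp add: sets.sigma_sets_eq)

text \<open>\<open>measure_of\<close> returns the given set function only when it is countably
  additive; \<open>random_expansion_image\<close> reduces this to disjoint preimages under
  \<open>decode\<close>.\<close>

lemma emeasure_nu:
  assumes "X \<in> sets state_space"
  shows "emeasure (nu \<beta>) X = emeasure D {b \<in> space D. recurrent b \<and> decode b \<in> X}"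
proof -
  let ?\<mu> = "\<lambda>A. emeasure (digit_bernoulli \<beta>) (random_expansion \<beta> ` (A \<inter> recurrent_set \<beta>))"
  have mu: "?\<mu> A = emeasure D {b \<in> space D. recurrent b \<and> decode b \<in> A}" for A
    by (simp add: random_expansion_image digit_bernoulli_eq)
  have "emeasure (nu \<beta>) X = ?\<mu> X"
  proof (rule emeasure_measure_of)
    show "nu \<beta> = measure_of (UNIV \<times> I) (sets state_space) ?\<mu>" by (simp add: nu_def)
    show "sets state_space \<subseteq> Pow (UNIV \<times> I)" using sets.space_closed[of state_space] space_state_space by simp
    show "X \<in> sets (nu \<beta>)" using assms sets_nu by simp
    show "positive (sets (nu \<beta>)) ?\<mu>" by (simp add: positive_def)
    show "countably_additive (sets (nu \<beta>)) ?\<mu>"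
    proof (rule countably_additiveI)
      fix A :: "nat \<Rightarrow> _" assume A: "range A \<subseteq> sets (nu \<beta>)" "disjoint_family A"
      have m: "{b \<in> space D. recurrent b \<and> decode b \<in> A i} \<in> sets D" for i
      proof -
        have [measurable]: "A i \<in> sets state_space" using A(1) sets_nu by auto
        show ?thesis by measurable
      qed
      have "(\<Sum>i. emeasure D {b \<in> space D. recurrent b \<and> decode b \<in> A i}) = emeasure D (\<Union>i. {b \<in> space D. recurrent b \<and> decode b \<in> A i})"
        using m A(2) by (intro suminf_emeasure) (auto simp: disjoint_family_on_def)
      also have "(\<Union>i. {b \<in> space D. recurrent b \<and> decode b \<in> A i}) = {b \<in> space D. recurrent b \<and> decode b \<in> (\<Union>i. A i)}" by auto
      finally show "(\<Sum>i. ?\<mu> (A i)) = ?\<mu> (\<Union>i. A i)" unfolding mu .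
    qed
  qed
  then show ?thesis by (simp add: mu)
qed

lemma good_decode_X: "b \<in> space D \<Longrightarrow> good b \<Longrightarrow> decode b \<in> X_set \<beta>"
proof -
  assume b: "b \<in> space D" "good b"
  have "snd ((random_map \<beta> ^^ n) (decode b)) = bval (drop_seq n b)" for n
    using random_orbit_decode[OF b(1) good_recurrent[OF b]] by (simp only: decode_def snd_conv)
  moreover have "bval (drop_seq n b) \<notin> F" for n
    using good_not_F[OF drop_in_D[OF b(1)]] b(2) good_drop by blast
  moreover have "snd (decode b) \<in> I" using bval_in_I[OF b(1)] by (simp add: decode_def)
  ultimately show ?thesis by (simp add: X_set_iff del: drop_seq_nth)
qed

lemma measure_nu_cyl:
  assumes p: "p \<in> X_star \<beta>"
  shows "measure (nu \<beta>) (cyl p n) = pr (cyl_event p n n)"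
proof -
  have [measurable]: "cyl p n \<in> sets state_space" by (rule sets_cyl[OF p])
  have "decode b \<in> cyl p n \<longleftrightarrow> b \<in> cyl_event p n n" if b: "b \<in> space D" "good b" for b
  proof -
    have X: "decode b \<in> X_set \<beta>" using good_decode_X b by blast
    have o: "snd ((random_map \<beta> ^^ k) (decode b)) = bval (drop_seq k b)" for k
      using random_orbit_decode[OF b(1) good_recurrent[OF b]] by (simp only: decode_def snd_conv)
    have "alpha \<beta> p k = alpha \<beta> (decode b) k \<longleftrightarrow> bval (drop_seq k b) \<in> C_interval \<beta> (alpha \<beta> p k)" for k
      using alpha_eq_iff[OF X alpha_range[OF p], of k] o by metis
    moreover have "decode b \<in> X_star \<beta>" using X X_star_iff by blast
    moreover have "fst (decode b) = coins b" by (simp add: decode_def)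
    ultimately show ?thesis using b unfolding cyl_def cyl_event_def by auto
  qed
  then have "AE b in D. b \<in> {b \<in> space D. recurrent b \<and> decode b \<in> cyl p n} \<longleftrightarrow> b \<in> cyl_event p n n"
    using AE_good good_recurrent by auto
  then have "pr {b \<in> space D. recurrent b \<and> decode b \<in> cyl p n} = pr (cyl_event p n n)"
    by (intro prob_D.finite_measure_eq_AE) auto
  then show ?thesis by (simp add: measure_def emeasure_nu)
qed

lemma bval_prefix:
  assumes "b \<in> space D" "b' \<in> space D" "\<And>i. i < n \<Longrightarrow> b i = b' i"
  shows "\<bar>bval b - bval b'\<bar> \<le> upper / \<beta> ^ n"
proof -
  have "bval b - bval b' = (bval (drop_seq n b) - bval (drop_seq n b')) / \<beta> ^ n"
    using assms(3)
  proof (induction n)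
    case (Suc n)
    have "\<beta> * bval (drop_seq n b) = b n + bval (drop_seq (Suc n) b)" "\<beta> * bval (drop_seq n b') = b' n + bval (drop_seq (Suc n) b')"
      using bval_step[of "drop_seq n b"] bval_step[of "drop_seq n b'"] assms by simp_all
    then have "bval (drop_seq (Suc n) b) - bval (drop_seq (Suc n) b') = \<beta> * (bval (drop_seq n b) - bval (drop_seq n b'))"
      using Suc.prems[of n] by (simp add: right_diff_distrib)
    then show ?case using Suc beta_gt1 by (simp del: drop_seq_nth)
  qed simp
  moreover have "\<bar>bval (drop_seq n b) - bval (drop_seq n b')\<bar> \<le> upper"
    using bval_in_I[of "drop_seq n b"] bval_in_I[of "drop_seq n b'"] assms by (auto simp: I_eq)
  ultimately show ?thesis using beta_gt1 by (simp add: abs_divide power_abs divide_right_mono del: drop_seq_nth)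
qed

section \<open>From cylinder probabilities to the local dimension\<close>

abbreviation gap_prob :: "nat \<Rightarrow> real" where
  "gap_prob a \<equiv> pr (coin_event (C_interval \<beta> a) (\<lambda>_. True) 0)"

text \<open>A sufficiently long prefix of the digits of the midpoint forces the value into the gap,
  and every prefix has positive probability.\<close>

lemma gap_prob_pos:
  assumes "a \<in> {1..L}"
  shows "gap_prob a > 0"
proof -
  define b where "b = random_expansion \<beta> (\<lambda>_. True, mid a)"
  have mI: "mid a \<in> I" using mid_in_C[OF assms] C_props(1)[OF assms] by blast
  have b: "b \<in> space D" "bval b = mid a" using random_expansion_in_D bval_random_expansion mI by (auto simp: b_def)
  define e where "e = (F_nth a - F_nth (a - 1)) / 2"
  have "e > 0" using C_props(2)[OF assms] by (simp add: e_def)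
  then obtain n where n: "upper / \<beta> ^ n < e" using ex_small_scale by blast
  have "{b' \<in> space D. \<forall>i<n. b' i = b i} \<subseteq> {b' \<in> space D. bval b' \<in> C_interval \<beta> a}"
  proof safe
    fix b' assume b': "b' \<in> space D" "\<forall>i<n. b' i = b i"
    have "\<bar>bval b' - mid a\<bar> \<le> upper / \<beta> ^ n" using bval_prefix[OF b'(1) b(1)] b'(2) b(2) by metis
    then have "\<bar>bval b' - mid a\<bar> < e" using n by linarith
    then show "bval b' \<in> C_interval \<beta> a" unfolding C_eq mid_def e_def greaterThanLessThan_iff by argo
  qed
  then have "pr {b' \<in> space D. \<forall>i<n. b' i = b i} \<le> pr {b' \<in> space D. bval b' \<in> C_interval \<beta> a}"
    by (intro prob_D.finite_measure_mono) measurable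
  moreover have "pr {b' \<in> space D. \<forall>i<n. b' i = b i} = (1 / card {0..N}) ^ n"
    using digits.emeasure_cylinder[of n b] b(1) by (simp add: measure_def space_D)
  moreover have "(1 / real (card {0..N})) ^ n > 0" by simp
  ultimately show ?thesis using pr_coin_event_Collect[OF sets_C, of a "\<lambda>_. True"] by linarith
qed

lemma mball_eq_cyl:
  assumes p: "p \<in> X_star \<beta>" and r: "r > 0"
  shows "Metric_space.mball (X_star \<beta>) (rho \<beta>) p r = cyl p (nat (\<lfloor>- log \<beta> r\<rfloor> + 1))"
proof -
  \<comment> \<open>The least \<open>n\<close> with \<open>\<beta> powr - real n < r\<close>, strict
    because balls are open. For \<open>r > 1\<close> the argument of \<open>nat\<close> is not
    positive, giving 0 and the whole space.\<close>
  have n: "\<beta> powr - real m < r \<longleftrightarrow> nat (\<lfloor>- log \<beta> r\<rfloor> + 1) \<le> m" for m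
  proof -
    have "\<beta> powr - real m < r \<longleftrightarrow> - real m < log \<beta> r" using r beta_gt1 by (simp add: less_log_iff)
    also have "\<dots> \<longleftrightarrow> - log \<beta> r < real_of_int (int m)" by auto
    also have "\<dots> \<longleftrightarrow> \<lfloor>- log \<beta> r\<rfloor> < int m" by (simp only: floor_less_iff)
    also have "\<dots> \<longleftrightarrow> nat (\<lfloor>- log \<beta> r\<rfloor> + 1) \<le> m" by linarith
    finally show ?thesis .
  qed
  have "Metric_space.mball (X_star \<beta>) (rho \<beta>) p r = {q. p \<in> X_star \<beta> \<and> q \<in> X_star \<beta> \<and> rho \<beta> p q < r}"
    by (rule Metric_space.mball_def[OF rho_metric, THEN meta_eq_to_obj_eq])
  also have "\<dots> = cyl p (nat (\<lfloor>- log \<beta> r\<rfloor> + 1))"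
    using rho_less_iff[OF p _ r n] p by (auto simp: cyl_def)
  finally show ?thesis .
qed

lemma ln_pr_cyl_event:
  assumes p: "p \<in> X_star \<beta>"
  shows "ln (pr (cyl_event p (Suc m) (Suc m))) =
    ln (gap_prob (alpha \<beta> p m)) - m * ln (N + 1) - (Suc m - real (visits p m)) * ln 2"
    "pr (cyl_event p (Suc m) (Suc m)) > 0"
proof -
  have v: "gap_prob (alpha \<beta> p m) > 0" using gap_prob_pos alpha_range p by blast
  have e: "pr (cyl_event p (Suc m) (Suc m)) = (1 / (N + 1)) ^ m * (1 / 2) ^ (Suc m - visits p m) * gap_prob (alpha \<beta> p m)"
    using pr_cyl_event[OF p, of m "Suc m"] by simp
  show pos: "pr (cyl_event p (Suc m) (Suc m)) > 0" unfolding e using v by (intro mult_pos_pos zero_less_power) auto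
  have "real (Suc m - visits p m) = Suc m - real (visits p m)"
    using visits_le[of p m] by (simp add: of_nat_diff)
  then show "ln (pr (cyl_event p (Suc m) (Suc m))) =
    ln (gap_prob (alpha \<beta> p m)) - m * ln (N + 1) - (Suc m - real (visits p m)) * ln 2"
    unfolding e using v by (simp add: ln_mult ln_realpow ln_div)
qed

lemma local_dim:
  assumes p: "p \<in> X_star \<beta>" and lim: "(\<lambda>n. visits p n / n) \<longlonglongrightarrow> \<theta>"
  shows "has_local_dim (X_star \<beta>) (rho \<beta>) (nu \<beta>) p ((ln (N + 1) + (1 - \<theta>) * ln 2) / ln \<beta>)"
proof -
  define n where "n r = nat (\<lfloor>- log \<beta> r\<rfloor> + 1)" for r
  define g where "g k = pr (cyl_event p k k)" for k
  have ball: "measure (nu \<beta>) (Metric_space.mball (X_star \<beta>) (rho \<beta>) p r) = g (n r)" if "r > 0" for r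
    unfolding mball_eq_cyl[OF p that] measure_nu_cyl[OF p] g_def n_def ..
  have pos: "g k > 0" for k
  proof (cases k)
    case 0
    have "pr (cyl_event p (Suc 0) (Suc 0)) \<le> g 0"
      unfolding g_def by (intro prob_D.finite_measure_mono) (auto simp: cyl_event_def)
    then show ?thesis using ln_pr_cyl_event(2)[OF p, of 0] 0 by simp
  next
    case (Suc m)
    then show ?thesis using ln_pr_cyl_event(2)[OF p, of m] by (simp add: g_def)
  qed
  define \<Lambda> where "\<Lambda> = ln (N + 1) + (1 - \<theta>) * ln 2"
  have lim_g: "(\<lambda>k. - ln (g k) / k) \<longlonglongrightarrow> \<Lambda>"
  proof (rule LIMSEQ_imp_Suc)
    define B where "B = Max ((\<lambda>a. \<bar>ln (gap_prob a)\<bar>) ` {1..L})"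
    have B: "\<bar>ln (gap_prob (alpha \<beta> p m))\<bar> \<le> B" for m
      unfolding B_def using alpha_range[OF p] by (intro Max_ge) auto
    have l0: "(\<lambda>m. ln (gap_prob (alpha \<beta> p m)) / Suc m) \<longlonglongrightarrow> 0"
    proof (rule Lim_null_comparison)
      show "\<forall>\<^sub>F m in sequentially. norm (ln (gap_prob (alpha \<beta> p m)) / Suc m) \<le> B * inverse (real (Suc m))"
        using B by (intro always_eventually allI) (simp add: divide_inverse abs_mult mult_right_mono)
      show "(\<lambda>m. B * inverse (real (Suc m))) \<longlonglongrightarrow> 0"
        using tendsto_mult[OF tendsto_const LIMSEQ_inverse_real_of_nat, of B] by simp
    qed
    have l1: "(\<lambda>m. real m / Suc m) \<longlonglongrightarrow> 1" using LIMSEQ_n_over_Suc_n .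
    have l2: "(\<lambda>m. visits p m / m * (real m / Suc m)) \<longlonglongrightarrow> \<theta> * 1" by (intro tendsto_mult lim l1)
    have "visits p m / m * (real m / Suc m) = visits p m / Suc m" for m
      by (cases m) (simp_all add: visits_def)
    then have l3: "(\<lambda>m. visits p m / Suc m) \<longlonglongrightarrow> \<theta>" using l2 by simp
    have "(\<lambda>m. (real m / Suc m) * ln (N + 1) + (1 - visits p m / Suc m) * ln 2 - ln (gap_prob (alpha \<beta> p m)) / Suc m)
       \<longlonglongrightarrow> 1 * ln (N + 1) + (1 - \<theta>) * ln 2 - 0"
      by (intro tendsto_intros l0 l1 l3)
    moreover have "- ln (g (Suc m)) / Suc m = (real m / Suc m) * ln (N + 1) + (1 - visits p m / Suc m) * ln 2 - ln (gap_prob (alpha \<beta> p m)) / Suc m" for m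
    proof -
      have "- (v - a * A - (s - V) * B) / s = a / s * A + (1 - V / s) * B - v / s" if "s \<noteq> 0" for v a A s V B :: real
        using that by (simp add: field_simps)
      then show ?thesis unfolding g_def ln_pr_cyl_event(1)[OF p] by simp
    qed
    ultimately show "(\<lambda>m. - ln (g (Suc m)) / Suc m) \<longlonglongrightarrow> \<Lambda>" by (simp add: \<Lambda>_def)
  qed
  define t where "t r = - log \<beta> r" for r
  have lnb: "ln \<beta> > 0" using beta_gt1 by simp
  have t_top: "filterlim t at_top (at_right 0)"
  proof -
    have "filterlim (\<lambda>r :: real. (1 / ln \<beta>) * - ln r) at_top (at_right 0)"
      using lnb by (intro filterlim_tendsto_pos_mult_at_top[where c="1 / ln \<beta>"] tendsto_const
          filterlim_compose[OF filterlim_uminus_at_top_at_bot ln_at_0]) auto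
    then show ?thesis by (simp add: t_def[abs_def] log_def)
  qed
  have n_eq: "real (n r) = of_int \<lfloor>t r\<rfloor> + 1" if "t r > 0" for r
    using that by (simp add: n_def t_def)
  have ev: "\<forall>\<^sub>F r in at_right 0. t r > 1" using t_top by (simp add: filterlim_at_top_dense)
  have n_top: "filterlim n at_top (at_right 0)"
  proof -
    have "filterlim (\<lambda>r. real (n r)) at_top (at_right 0)"
    proof (rule filterlim_at_top_mono[OF t_top])
      show "\<forall>\<^sub>F r in at_right 0. t r \<le> real (n r)"
        using ev by eventually_elim (use n_eq in \<open>force simp: less_imp_le\<close>)
    qed
    then show ?thesis by (simp only: filterlim_sequentially_iff_filterlim_real)
  qed
  \<comment> \<open>The integer scale exceeds \<open>- log \<beta> r\<close> by at most 1, so it may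
    replace the latter in the limit.\<close>
  have ratio: "((\<lambda>r. n r / t r) \<longlongrightarrow> 1) (at_right 0)"
  proof (rule tendsto_sandwich)
    have inv: "((\<lambda>r. inverse (t r)) \<longlongrightarrow> 0) (at_right 0)"
      by (rule tendsto_inverse_0_at_top[OF t_top])
    show "\<forall>\<^sub>F r in at_right 0. 1 \<le> n r / t r"
      using ev
    proof eventually_elim
      case (elim r)
      then have "real (n r) = of_int \<lfloor>t r\<rfloor> + 1" using n_eq by simp
      then have "t r \<le> n r" by linarith
      then show ?case using elim by (simp add: field_simps)
    qed
    show "\<forall>\<^sub>F r in at_right 0. n r / t r \<le> 1 + inverse (t r)"
      using ev
    proof eventually_elim
      case (elim r)
      then have "real (n r) = of_int \<lfloor>t r\<rfloor> + 1" using n_eq by simp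
      then have "n r \<le> t r + 1" by linarith
      then show ?case using elim by (simp add: field_simps)
    qed
    show "((\<lambda>r. 1 + inverse (t r)) \<longlongrightarrow> 1) (at_right 0)" using tendsto_add[OF tendsto_const inv, of 1] by simp
  qed simp
  have "((\<lambda>r. (- ln (g (n r)) / n r) * (n r / t r) / ln \<beta>) \<longlongrightarrow> \<Lambda> * 1 / ln \<beta>) (at_right 0)"
    using lnb by (intro tendsto_intros ratio filterlim_compose[OF lim_g n_top]) simp
  moreover have "\<forall>\<^sub>F r in at_right 0. (- ln (g (n r)) / n r) * (n r / t r) / ln \<beta> =
      ln (measure (nu \<beta>) (Metric_space.mball (X_star \<beta>) (rho \<beta>) p r)) / ln r"
    using ev eventually_at_right_less[of 0]
  proof eventually_elim
    case (elim r)
    have "real (n r) \<noteq> 0" using n_eq[of r] elim(1) by linarith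
    moreover have "ln r = - t r * ln \<beta>" using lnb by (simp add: t_def log_def)
    ultimately show ?case using elim lnb by (simp add: ball field_simps)
  qed
  ultimately have "((\<lambda>r. ln (measure (nu \<beta>) (Metric_space.mball (X_star \<beta>) (rho \<beta>) p r)) / ln r) \<longlongrightarrow> \<Lambda> / ln \<beta>) (at_right 0)"
    by (simp add: tendsto_cong)
  then show ?thesis unfolding has_local_dim_def \<Lambda>_def using ball pos by auto
qed

section \<open>Points with a unique expansion\<close>

lemma switch_digit_ne:
  assumes "x \<in> I" "x \<in> switch_region \<beta>" "\<omega> 0 \<noteq> \<omega>' 0"
  shows "random_digit \<beta> (\<omega>, x) \<noteq> random_digit \<beta> (\<omega>', x)"
proof -
  obtain d y where d: "d \<le> N" "y \<in> I" "\<beta> * x = d + y" using admissible_exists assms by blast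
  then show ?thesis by (cases rule: random_step_cases) (use assms in auto)
qed

lemma fst_orbit_no_visit:
  assumes "\<And>k. k < n \<Longrightarrow> snd ((random_map \<beta> ^^ k) p) \<notin> switch_region \<beta>"
  shows "fst ((random_map \<beta> ^^ n) p) = fst p"
  using assms by (induction n) (simp_all add: random_map_fst)

text \<open>Compare \<open>\<omega>\<close> with its complement. Before a first visit no coin is
  consumed, so there the opposite coins would choose different digits and produce two expansions of
  \<open>x\<close>.\<close>

lemma unique_no_visit:
  assumes x: "x \<in> unique_expansion_points \<beta>"
  shows "snd ((random_map \<beta> ^^ n) (\<omega>, x)) \<notin> switch_region \<beta>"
proof (induction n rule: less_induct)
  case (less n)
  let ?\<omega>' = "\<lambda>i. \<not> \<omega> i"
  have xI: "x \<in> I" using x by (simp add: unique_expansion_points_def)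
  have exp: "random_expansion \<beta> (\<omega>, x) = random_expansion \<beta> (?\<omega>', x)"
    using x is_beta_expansion_iff random_expansion_in_D[of "(\<omega>, x)"] random_expansion_in_D[of "(?\<omega>', x)"]
      bval_random_expansion[of "(\<omega>, x)"] bval_random_expansion[of "(?\<omega>', x)"] xI
    unfolding unique_expansion_points_def by auto
  have orb: "snd ((random_map \<beta> ^^ k) (\<omega>, x)) = snd ((random_map \<beta> ^^ k) (?\<omega>', x))" for k
    using bval_drop_random_expansion[of "(\<omega>, x)" k] bval_drop_random_expansion[of "(?\<omega>', x)" k] xI exp by simp
  have f: "fst ((random_map \<beta> ^^ n) (\<omega>, x)) = \<omega>" "fst ((random_map \<beta> ^^ n) (?\<omega>', x)) = ?\<omega>'"
    using fst_orbit_no_visit[of n "(\<omega>, x)"] fst_orbit_no_visit[of n "(?\<omega>', x)"] less orb by simp_all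
  show ?case
  proof
    let ?y = "snd ((random_map \<beta> ^^ n) (\<omega>, x))"
    assume "?y \<in> switch_region \<beta>"
    then have "random_digit \<beta> (\<omega>, ?y) \<noteq> random_digit \<beta> (?\<omega>', ?y)"
      using random_orbit_in_I[of "(\<omega>, x)" n] xI by (intro switch_digit_ne) auto
    moreover have "(random_map \<beta> ^^ n) (\<omega>, x) = (\<omega>, ?y)" "(random_map \<beta> ^^ n) (?\<omega>', x) = (?\<omega>', ?y)"
      using f orb[of n] by (auto simp: prod_eq_iff)
    ultimately show False using fun_cong[OF exp, of n] by (simp add: random_expansion_def)
  qed
qed

lemma no_visit_step:
  assumes "d \<le> N" "y \<in> I" "\<beta> * snd p = d + y" "snd p \<notin> switch_region \<beta>"
  shows "snd (random_map \<beta> p) = y" "d = 0 \<or> y > overlap" "d = N \<or> y < 1"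
proof -
  have "snd (random_map \<beta> p) = y \<and> (d = 0 \<or> y > overlap) \<and> (d = N \<or> y < 1)"
    using assms(1-3)
  proof (cases rule: random_step_cases)
    case forced
    then show ?thesis using forced(4)[of "fst p"] assms(3) by (simp add: random_map_snd)
  qed (use assms in auto)
  then show "snd (random_map \<beta> p) = y" "d = 0 \<or> y > overlap" "d = N \<or> y < 1" by auto
qed

text \<open>Without visits every step is forced, so from \<open>orbit1 i\<close> the orbit follows
  the greedy one up to the point before \<open>0\<close>. There the digit is at least 1 and the next
  value \<open>0\<close> is at most \<open>overlap\<close>, which is a visit after all. The
  reflected orbit is treated symmetrically.\<close>

lemma orbit1_visits:
  assumes "\<And>n. snd ((random_map \<beta> ^^ n) p) \<notin> switch_region \<beta>" "i < len1"
  shows "snd p \<noteq> orbit1 i \<and> snd p \<noteq> upper - orbit1 i"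
  using assms
proof (induction "len1 - i" arbitrary: i p)
  case (Suc m)
  have nv: "snd p \<notin> switch_region \<beta>" using Suc.prems(1)[of 0] by simp
  have q: "snd ((random_map \<beta> ^^ n) (random_map \<beta> p)) \<notin> switch_region \<beta>" for n
    using Suc.prems(1)[of "Suc n"] by (simp add: funpow_swap1)
  have e1: "\<beta> * orbit1 i = digit1 i + orbit1 (Suc i)" by (simp add: orbit1_Suc)
  have e2: "\<beta> * (upper - orbit1 i) = real (N - digit1 i) + (upper - orbit1 (Suc i))"
    using digit1_le[of i] by (simp add: orbit1_Suc right_diff_distrib upper_eq of_nat_diff)
  have I1: "orbit1 (Suc i) \<in> I" "upper - orbit1 (Suc i) \<in> I" using orbit1_in_I sym_I by blast+
  have d: "digit1 i \<ge> 1" "digit1 i \<le> N" using len1(2) Suc.prems(2) digit1_le by auto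
  show ?case
  proof (cases "Suc i < len1")
    case True
    have ih: "snd (random_map \<beta> p) \<noteq> orbit1 (Suc i) \<and> snd (random_map \<beta> p) \<noteq> upper - orbit1 (Suc i)"
      by (rule Suc.hyps(1)) (use Suc.hyps(2) q True in auto)
    show ?thesis
    proof (intro conjI notI)
      assume "snd p = orbit1 i"
      then show False using no_visit_step(1)[of "digit1 i" "orbit1 (Suc i)" p] d I1 e1 nv ih by simp
    next
      assume "snd p = upper - orbit1 i"
      then show False using no_visit_step(1)[of "N - digit1 i" "upper - orbit1 (Suc i)" p] d I1 e2 nv ih by simp
    qed
  next
    case False
    then have z: "orbit1 (Suc i) = 0" using Suc.prems(2) orbit1_len1 by (metis Suc_lessI)
    show ?thesis
    proof (intro conjI notI)
      assume "snd p = orbit1 i"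
      then show False using no_visit_step(2)[of "digit1 i" "orbit1 (Suc i)" p] d I1 e1 nv z overlap_pos by simp
    next
      assume "snd p = upper - orbit1 i"
      then have "N - digit1 i = N \<or> upper - orbit1 (Suc i) < 1"
        using no_visit_step(3)[of "N - digit1 i" "upper - orbit1 (Suc i)" p] I1 e2 nv by simp
      then show False using d z upper_gt1 by simp
    qed
  qed
qed simp

lemma no_visit_F:
  assumes nv: "\<And>n. snd ((random_map \<beta> ^^ n) p) \<notin> switch_region \<beta>" and "snd p \<in> F"
  shows "snd p = 0 \<or> snd p = upper"
proof -
  have nv0: "snd p \<notin> switch_region \<beta>" using nv[of 0] by simp
  have I1: "0 \<in> I" "upper \<in> I" using upper_gt1 by (auto simp: I_eq)
  consider i where "i < len1" "snd p = orbit1 i \<or> snd p = upper - orbit1 i"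
    | k where "k \<le> N" "snd p = k / \<beta>" | k where "k \<le> N" "snd p = upper - k / \<beta>"
    using assms(2) unfolding F_eq F_half_def by auto
  then show ?thesis
  proof cases
    case 1
    then show ?thesis using orbit1_visits[OF nv] by blast
  next
    case 2
    then have "k = 0" using no_visit_step(2)[of k 0 p] I1 nv0 beta_gt1 overlap_pos by simp
    then show ?thesis using 2 by simp
  next
    case 3
    then have "\<beta> * snd p = real (N - k) + upper" using beta_gt1 upper_eq by (simp add: right_diff_distrib of_nat_diff)
    then have "N - k = N" using no_visit_step(3)[of "N - k" upper p] I1 nv0 upper_gt1 by simp
    then have "k = 0" using 3 N_ge1 by simp
    then show ?thesis using 3 by simp
  qed
qed

text \<open>Places the points with a unique expansion in the metric space. By
  \<open>no_visit_F\<close> a visit-free orbit can meet \<open>F\<close> only at an endpoint of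
  \<open>I\<close>, and such an endpoint is reached from another point only through a visit.\<close>

lemma no_visit_X_star:
  assumes nv: "\<And>n. snd ((random_map \<beta> ^^ n) p) \<notin> switch_region \<beta>" and p: "snd p \<in> I"
  shows "p \<in> X_star \<beta>"
proof (cases "snd p = 0 \<or> snd p = upper")
  case True
  then show ?thesis using X_star_iff by blast
next
  case False
  have "snd ((random_map \<beta> ^^ n) p) \<noteq> 0 \<and> snd ((random_map \<beta> ^^ n) p) \<noteq> upper" for n
  proof (induction n)
    case (Suc n)
    let ?p = "(random_map \<beta> ^^ n) p"
    have I1: "snd (random_map \<beta> ?p) \<in> I" "random_digit \<beta> ?p \<le> N"
      using random_map_in_I[of "snd ?p" "fst ?p"] random_orbit_in_I[OF p, of n] by simp_all
    have e: "\<beta> * snd ?p = random_digit \<beta> ?p + snd (random_map \<beta> ?p)" by (simp add: random_map_snd)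
    note st = no_visit_step[OF I1(2,1) e nv[of n]]
    show ?case
    proof (rule ccontr)
      assume "\<not> ?case"
      then consider "snd (random_map \<beta> ?p) = 0" | "snd (random_map \<beta> ?p) = upper" by auto
      then show False
      proof cases
        case 1
        then have "\<beta> * snd ?p = 0" using st(2) e overlap_pos by simp
        then show False using Suc beta_gt1 by simp
      next
        case 2
        then have "\<beta> * snd ?p = \<beta> * upper" using st(3) e upper_gt1 upper_eq by simp
        then show False using Suc beta_gt1 by simp
      qed
    qed
  qed (use False in simp)
  moreover have "snd ((random_map \<beta> ^^ k) ((random_map \<beta> ^^ n) p)) \<notin> switch_region \<beta>" for k n
    using nv[of "k + n"] by (simp add: funpow_add)
  ultimately have "snd ((random_map \<beta> ^^ n) p) \<notin> F" for n using no_visit_F by blast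
  then show ?thesis using p X_set_iff X_star_iff by blast
qed

lemma local_dim_no_visit:
  assumes nv: "\<And>n. snd ((random_map \<beta> ^^ n) p) \<notin> switch_region \<beta>" and p: "snd p \<in> I"
  shows "has_local_dim (X_star \<beta>) (rho \<beta>) (nu \<beta>) p ((ln (N + 1) + ln 2) / ln \<beta>)"
proof -
  have "visits p n = 0" for n using nv by (simp add: visits_def)
  then have "(\<lambda>n. visits p n / n) \<longlonglongrightarrow> 0" by simp
  from local_dim[OF no_visit_X_star[OF assms] this] show ?thesis by simp
qed

section \<open>Sparse digit sequences\<close>

definition sparse_seq :: "nat \<Rightarrow> (nat \<Rightarrow> bool) \<Rightarrow> nat \<Rightarrow> nat" where
  "sparse_seq l s n = of_bool (n mod l = of_bool (s (n div l)))"

lemma sparse_seq_digit: "sparse_seq l s n = 0 \<or> sparse_seq l s n = 1"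
  by (simp add: sparse_seq_def)

lemma sparse_seq_block:
  assumes "j < l"
  shows "sparse_seq l s (m * l + j) = of_bool (j = of_bool (s m))"
  using assms by (simp add: sparse_seq_def)

lemma sparse_seq_one_iff:
  assumes "2 \<le> l"
  shows "sparse_seq l s n = 1 \<longleftrightarrow> (\<exists>m. n = m * l + of_bool (s m))"
proof
  assume "sparse_seq l s n = 1"
  then have "n mod l = of_bool (s (n div l))" unfolding sparse_seq_def by (metis of_bool_eq(1) zero_neq_one)
  then show "\<exists>m. n = m * l + of_bool (s m)" by (metis div_mult_mod_eq)
next
  assume "\<exists>m. n = m * l + of_bool (s m)"
  then obtain m where "n = m * l + of_bool (s m)" by blast
  then show "sparse_seq l s n = 1" using sparse_seq_block[of "of_bool (s m)" l s m] assms by simp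
qed

text \<open>The reason for the block length \<open>R + 2\<close>: ones in consecutive blocks are at
  least \<open>R + 1\<close> positions apart, even when the offset drops from 1 to 0.\<close>

lemma sparse_seq_zeros:
  assumes "sparse_seq (R + 2) s n = 1" "i < R"
  shows "sparse_seq (R + 2) s (i + Suc n) = 0"
proof -
  obtain m where n: "n = m * (R + 2) + of_bool (s m)" using sparse_seq_one_iff assms(1) by auto
  let ?j = "of_bool (s m) + Suc i"
  have "of_bool (s m) \<le> (1 :: nat)" by simp
  then have "?j < R + 2" using assms(2) by linarith
  from sparse_seq_block[OF this, of s m] have "sparse_seq (R + 2) s (m * (R + 2) + ?j) = 0" by simp
  moreover have "i + Suc n = m * (R + 2) + ?j" using n by linarith
  ultimately show ?thesis by (simp only:)
qed

lemma sparse_seq_card: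
  assumes l: "2 \<le> l"
  shows "card {k. k < m * l \<and> sparse_seq l s k = 1} = m"
proof -
  let ?f = "\<lambda>i. i * l + of_bool (s i)"
  have lt: "?f i < m * l \<longleftrightarrow> i < m" for i
  proof
    assume "i < m"
    then have "Suc i * l \<le> m * l" by (intro mult_le_mono1) simp
    then have "i * l + l \<le> m * l" by simp
    moreover have "of_bool (s i) < l" using l by (cases "s i") auto
    ultimately show "?f i < m * l" by linarith
  next
    assume "?f i < m * l"
    then have "i * l < m * l" by linarith
    then show "i < m" by simp
  qed
  have "{k. k < m * l \<and> sparse_seq l s k = 1} = ?f ` {..<m}"
  proof (intro set_eqI iffI)
    fix k assume "k \<in> {k. k < m * l \<and> sparse_seq l s k = 1}"
    then obtain i where "k = ?f i" "k < m * l" using sparse_seq_one_iff[OF l] by blast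
    then show "k \<in> ?f ` {..<m}" using lt[of i] by blast
  next
    fix k assume "k \<in> ?f ` {..<m}"
    then obtain i where "i < m" "k = ?f i" by blast
    then show "k \<in> {k. k < m * l \<and> sparse_seq l s k = 1}" using lt[of i] sparse_seq_one_iff[OF l] by blast
  qed
  moreover have "inj ?f"
  proof (rule injI)
    fix i j assume "?f i = ?f j"
    then have "?f i div l = ?f j div l" by simp
    then show "i = j" using l by simp
  qed
  ultimately show ?thesis by (simp add: card_image inj_on_subset)
qed

text \<open>Each complete block contains exactly one 1, so the count differs from
  \<open>n / l\<close> by at most 1.\<close>

lemma sparse_seq_density:
  assumes l: "2 \<le> l"
  shows "(\<lambda>n. card {k. k < n \<and> sparse_seq l s k = 1} / n) \<longlonglongrightarrow> 1 / l"
proof -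
  let ?c = "\<lambda>n. card {k. k < n \<and> sparse_seq l s k = 1}"
  have mono: "?c n \<le> ?c m" if "n \<le> m" for n m using that by (intro card_mono) auto
  have "\<bar>real (?c n) / n - 1 / l\<bar> \<le> 1 / n" if n: "n > 0" for n
  proof -
    have lo: "(n div l) * l \<le> n" and hi: "n \<le> Suc (n div l) * l"
      using l by (auto simp: dividend_less_times_div less_imp_le mult.commute)
    have c: "n div l \<le> ?c n" "?c n \<le> Suc (n div l)"
      using mono[OF lo] mono[OF hi] sparse_seq_card[OF l] by metis+
    have "real (n div l) * l \<le> n" "real n \<le> (real (n div l) + 1) * l"
      using lo hi by (simp_all only: of_nat_mult[symmetric] of_nat_le_iff of_nat_Suc[symmetric] add.commute)
    then have "real (n div l) \<le> n / l" "real n / l \<le> n div l + 1" using l by (auto simp: field_simps)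
    then have "\<bar>real (?c n) - n / l\<bar> \<le> 1" using c by linarith
    moreover have "real (?c n) / n - 1 / l = (real (?c n) - n / l) / n" using n by (simp add: diff_divide_distrib)
    ultimately show ?thesis using n by (simp add: abs_divide divide_right_mono)
  qed
  then have ev: "\<forall>\<^sub>F n in sequentially. norm (real (?c n) / n - 1 / l) \<le> 1 / real n"
    by (intro eventually_sequentiallyI[of 1]) simp
  have "(\<lambda>n. real (?c n) / n - 1 / l) \<longlonglongrightarrow> 0"
    by (rule Lim_null_comparison[OF ev lim_1_over_n])
  then show ?thesis by (simp add: LIM_zero_iff)
qed

lemma sparse_seq_in_D: "sparse_seq l s \<in> space D"
  using N_ge1 by (simp add: space_D sparse_seq_def)

context
  fixes R :: nat
  assumes R: "upper / \<beta> ^ R < overlap" "upper / \<beta> ^ R < \<beta> - 1"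
begin

text \<open>The two bounds have different purposes: a tail below \<open>overlap\<close> makes each
  digit 1 a visit, and a tail below \<open>\<beta> - 1\<close> keeps all values below 1, so that a
  digit 0 is never one.\<close>

lemma sparse_tail_small:
  assumes "sparse_seq (R + 2) s n = 1"
  shows "bval (drop_seq (Suc n) (sparse_seq (R + 2) s)) < min overlap (\<beta> - 1)"
proof -
  have "drop_seq (Suc n) (sparse_seq (R + 2) s) \<in> space D" using sparse_seq_in_D drop_in_D by blast
  moreover have "upper / \<beta> ^ R < min overlap (\<beta> - 1)" using R by simp
  moreover have "drop_seq (Suc n) (sparse_seq (R + 2) s) i = 0" if "i < R" for i
    using sparse_seq_zeros[OF assms that] by simp
  ultimately show ?thesis by (rule small_tail)
qed

lemma sparse_later_one: "\<exists>k. sparse_seq (R + 2) s (k + n) = 1"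
proof -
  let ?m = "n * (R + 2) + of_bool (s n)"
  have "sparse_seq (R + 2) s ?m = 1" using sparse_seq_one_iff[of "R + 2" s ?m] by auto
  moreover have "?m = (?m - n) + n" by (simp add: trans_le_add1)
  ultimately show ?thesis by metis
qed

text \<open>Backwards from the next 1: there the value is \<open>(1 + y) / \<beta>\<close> with
  \<open>y < \<beta> - 1\<close>, and every preceding digit 0 divides it by
  \<open>\<beta>\<close>.\<close>

lemma sparse_tail_less1: "bval (drop_seq n (sparse_seq (R + 2) s)) < 1"
proof -
  let ?b = "sparse_seq (R + 2) s"
  have step: "\<beta> * bval (drop_seq n ?b) = ?b n + bval (drop_seq (Suc n) ?b)" for n
    using bval_step[OF drop_in_D[OF sparse_seq_in_D], of n "R + 2" s] by simp
  have one: "bval (drop_seq n ?b) < 1" if "?b n = 1" for n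
  proof -
    have "\<beta> * bval (drop_seq n ?b) < \<beta> * 1" using step[of n] sparse_tail_small[OF that] that by simp
    then show ?thesis using beta_gt1 by simp
  qed
  have "bval (drop_seq n ?b) < 1" if "?b (k + n) = 1" for k n
    using that
  proof (induction k arbitrary: n)
    case 0
    then show ?case using one[of n] by (simp only: add_0)
  next
    case (Suc k)
    show ?case
    proof (cases "?b n = 1")
      case False
      then have "?b n = 0" using sparse_seq_digit by blast
      then have "\<beta> * bval (drop_seq n ?b) < \<beta> * 1" using step[of n] Suc.IH[of "Suc n"] Suc.prems beta_gt1
        by (simp del: drop_seq_nth)
      then show ?thesis using beta_gt1 by (simp only: mult_less_cancel_left_pos)
    qed (rule one)
  qed
  then show ?thesis using sparse_later_one by blast
qed

lemma sparse_visit_iff: "visit (drop_seq n (sparse_seq (R + 2) s)) \<longleftrightarrow> sparse_seq (R + 2) s n = 1"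
proof -
  let ?b = "sparse_seq (R + 2) s"
  have d: "drop_seq n ?b \<in> space D" using sparse_seq_in_D drop_in_D by blast
  show ?thesis
    using d
  proof (cases rule: digit_cases)
    case lower
    then show ?thesis using sparse_seq_digit[of "R + 2" s n] by auto
  next
    case higher
    then show ?thesis using sparse_tail_less1[of "Suc n" s] by simp
  next
    case forced
    then show ?thesis using sparse_tail_small[of s n] by auto
  qed
qed

lemma sparse_good: "good (sparse_seq (R + 2) s)"
  unfolding good_def INFM_nat_le
proof
  fix m
  let ?b = "sparse_seq (R + 2) s"
  obtain k where k: "?b (k + m) = 1" using sparse_later_one by blast
  have pos: "bval (drop_seq n ?b) > 0" for n
  proof -
    obtain j where j: "?b (j + n) = 1" using sparse_later_one by blast
    have "drop_seq n ?b \<in> space D" using sparse_seq_in_D drop_in_D by blast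
    from bval_summable[OF this] show ?thesis
      unfolding bval_def by (rule suminf_pos2[where i = j]) (use j beta_gt1 in auto)
  qed
  show "\<exists>n\<ge>m. 1 \<le> ?b n \<and> 0 < bval (drop_seq (Suc n) ?b) \<and> bval (drop_seq (Suc n) ?b) < overlap"
    using k pos[of "Suc (k + m)"] sparse_tail_small[OF k] by (intro exI[of _ "k + m"]) simp
qed

text \<open>Visits occur exactly at the ones, whence the frequency \<open>1 / (R + 2)\<close>. For
  the separation, a differing bit \<open>n\<close> changes a digit in block \<open>n\<close>, so the
  codes must differ before the end of that block.\<close>

lemma sparse_point:
  defines "p \<equiv> \<lambda>s. decode (sparse_seq (R + 2) s)"
  shows sparse_X: "p s \<in> X_star \<beta>"
    and sparse_local_dim: "has_local_dim (X_star \<beta>) (rho \<beta>) (nu \<beta>) (p s) ((ln (N + 1) + (1 - 1 / (R + 2)) * ln 2) / ln \<beta>)"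
    and sparse_sep: "s n \<noteq> t n \<Longrightarrow> \<beta> powr - real ((R + 2) * (n + 1)) \<le> rho \<beta> (p s) (p t)"
proof -
  let ?b = "\<lambda>s. sparse_seq (R + 2) s"
  have b: "?b s \<in> space D" "recurrent (?b s)" for s
    using sparse_seq_in_D good_recurrent sparse_good by blast+
  show X: "p s \<in> X_star \<beta>" for s
    unfolding p_def using good_decode_X[OF b(1) sparse_good] X_star_iff by blast
  have "snd ((random_map \<beta> ^^ k) (p s)) = bval (drop_seq k (?b s))" for k
    unfolding p_def random_orbit_decode[OF b] by (simp only: decode_def snd_conv)
  then have "visits (p s) n = card {k. k < n \<and> ?b s k = 1}" for n
    unfolding visits_def using sparse_visit_iff by simp
  then have "(\<lambda>n. visits (p s) n / n) \<longlonglongrightarrow> 1 / (R + 2)"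
    using sparse_seq_density[of "R + 2" s] by simp
  from local_dim[OF X this]
  show "has_local_dim (X_star \<beta>) (rho \<beta>) (nu \<beta>) (p s) ((ln (N + 1) + (1 - 1 / (R + 2)) * ln 2) / ln \<beta>)"
    by simp
  show "\<beta> powr - real ((R + 2) * (n + 1)) \<le> rho \<beta> (p s) (p t)" if st: "s n \<noteq> t n"
  proof -
    let ?D = "\<lambda>k. fst (p s) k \<noteq> fst (p t) k \<or> alpha \<beta> (p s) k \<noteq> alpha \<beta> (p t) k"
    let ?k = "n * (R + 2) + of_bool (s n)"
    have k: "?k < (R + 2) * (n + 1)" by (simp add: algebra_simps)
    \<comment> \<open>\<open>?k\<close> is the position of the 1 of \<open>s\<close> in block
      \<open>n\<close>; \<open>t\<close> has its 1 at the other offset.\<close>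
    have "?b s ?k \<noteq> ?b t ?k"
      using sparse_seq_block[of "of_bool (s n)" "R + 2" s n] sparse_seq_block[of "of_bool (s n)" "R + 2" t n] st by simp
    then have ne: "random_expansion \<beta> (p s) ?k \<noteq> random_expansion \<beta> (p t) ?k"
      unfolding p_def random_expansion_decode[OF b] .
    have "\<exists>k<(R + 2) * (n + 1). ?D k"
    proof (rule ccontr)
      assume "\<not> ?thesis"
      then have "random_expansion \<beta> (p s) ?k = random_expansion \<beta> (p t) ?k"
        using same_code_expansion[OF X X _ _ k, of s t] by blast
      then show False using ne by simp
    qed
    then obtain k where k: "k < (R + 2) * (n + 1)" "?D k" by blast
    have "(LEAST k. ?D k) \<le> k" using k(2) by (rule Least_le)
    then have "real (LEAST k. ?D k) \<le> real ((R + 2) * (n + 1))" using k(1) by (simp only: of_nat_le_iff)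
    then have "\<beta> powr - real ((R + 2) * (n + 1)) \<le> \<beta> powr - real (LEAST k. ?D k)"
      using beta_gt1 by (intro powr_mono) auto
    moreover have "p s \<noteq> p t" using ne by auto
    ultimately show ?thesis by (simp add: rho_def)
  qed
qed

end

lemma multifractal_nu: "multifractal (X_star \<beta>) (rho \<beta>) (nu \<beta>)"
proof -
  let ?Z = "\<lambda>t. {z \<in> X_star \<beta>. has_local_dim (X_star \<beta>) (rho \<beta>) (nu \<beta>) z t}"
  have lnb: "ln \<beta> > 0" using beta_gt1 by simp
  define t1 where "t1 = (ln (N + 1) + ln 2) / ln \<beta>"
  \<comment> \<open>The fibre over the fixed endpoint 0 is never visited by the switch region, and
    the coins alone separate its points at scale \<open>(1 / \<beta>) ^ n\<close>.\<close>
  have dim1: "0 < hausdorff_dim (X_star \<beta>) (rho \<beta>) (?Z t1)"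
  proof (rule hausdorff_dim_pos[where g = "\<lambda>s. (s, 0)" and c = 1 and q = "1 / \<beta>"])
    fix s :: "nat \<Rightarrow> bool"
    have "(random_map \<beta> ^^ n) (s, 0) = (s, 0)" for n
      by (induction n) (simp_all add: random_map_0)
    then have "snd ((random_map \<beta> ^^ n) (s, 0)) \<notin> switch_region \<beta>" for n
      using random_map_0(3)[of "(s, 0)"] by simp
    moreover have "snd (s, 0 :: real) \<in> I" using upper_gt1 by (simp add: I_eq)
    ultimately show "(s, 0) \<in> ?Z t1"
      using local_dim_no_visit[of "(s, 0)"] X_star_iff[of "(s, 0)"] by (simp add: t1_def)
  next
    fix s t :: "nat \<Rightarrow> bool" and n
    assume st: "s n \<noteq> t n"
    have "(LEAST k. fst (s, 0 :: real) k \<noteq> fst (t, 0 :: real) k \<or> alpha \<beta> (s, 0) k \<noteq> alpha \<beta> (t, 0) k) \<le> n"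
      using st by (intro Least_le) simp
    then have "\<beta> powr - real n \<le> \<beta> powr - real (LEAST k. fst (s, 0 :: real) k \<noteq> fst (t, 0 :: real) k \<or> alpha \<beta> (s, 0) k \<noteq> alpha \<beta> (t, 0) k)"
      using beta_gt1 by (intro powr_mono) auto
    moreover have "(s, 0 :: real) \<noteq> (t, 0)" using st by auto
    ultimately have "\<beta> powr - real n \<le> rho \<beta> (s, 0) (t, 0)" by (simp add: rho_def)
    moreover have "\<beta> powr - real n = 1 * (1 / \<beta>) ^ n"
      using beta_gt1 by (simp add: powr_minus powr_realpow power_divide divide_inverse power_inverse)
    ultimately show "1 * (1 / \<beta>) ^ n \<le> rho \<beta> (s, 0) (t, 0)" by simp
  qed (use beta_gt1 in auto)
  have "min overlap (\<beta> - 1) > 0" using overlap_pos beta_gt1 by simp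
  then obtain R where "upper / \<beta> ^ R < min overlap (\<beta> - 1)" using ex_small_scale by blast
  then have R: "upper / \<beta> ^ R < overlap" "upper / \<beta> ^ R < \<beta> - 1" by auto
  define t2 where "t2 = (ln (N + 1) + (1 - 1 / (R + 2)) * ln 2) / ln \<beta>"
  \<comment> \<open>One bit of \<open>s\<close> governs a block of \<open>R + 2\<close> digits,
    hence this ratio per bit; the constant \<open>c = q\<close> accounts for a difference that shows
    only at the end of its block.\<close>
  define q where "q = 1 / \<beta> ^ (R + 2)"
  have q: "0 < q" "q < 1" using beta_gt1 one_less_power[of \<beta> "R + 2"] by (auto simp: q_def field_simps)
  have dim2: "0 < hausdorff_dim (X_star \<beta>) (rho \<beta>) (?Z t2)"
  proof (rule hausdorff_dim_pos[where g = "\<lambda>s. decode (sparse_seq (R + 2) s)" and c = q and q = q])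
    fix s
    show "decode (sparse_seq (R + 2) s) \<in> ?Z t2"
      using sparse_X[OF R] sparse_local_dim[OF R] by (simp add: t2_def)
  next
    fix s t :: "nat \<Rightarrow> bool" and n
    assume st: "s n \<noteq> t n"
    have "q * q ^ n = \<beta> powr - real ((R + 2) * (n + 1))"
    proof -
      have "q * q ^ n = q ^ (n + 1)" by simp
      also have "\<dots> = 1 / \<beta> ^ ((R + 2) * (n + 1))" unfolding q_def power_one_over by (simp only: power_mult)
      also have "\<dots> = \<beta> powr - real ((R + 2) * (n + 1))"
        using beta_gt1 by (simp only: powr_minus powr_realpow divide_inverse mult_1_left)
      finally show ?thesis .
    qed
    then show "q * q ^ n \<le> rho \<beta> (decode (sparse_seq (R + 2) s)) (decode (sparse_seq (R + 2) t))"
      using sparse_sep[OF R, where s = s and t = t and n = n, OF st] by simp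
  qed (use q in auto)
  have "t1 \<noteq> t2"
  proof -
    have "t1 - t2 = (1 / (R + 2) * ln 2) / ln \<beta>" by (simp add: t1_def t2_def diff_divide_distrib[symmetric] left_diff_distrib)
    moreover have "(1 / (R + 2) * ln 2) / ln \<beta> > 0" using lnb by simp
    ultimately show ?thesis by simp
  qed
  then show ?thesis unfolding multifractal_def using dim1 dim2 by blast
qed

end

theorem corollary3p4:
  fixes \<beta> :: real
  assumes "generalised_multinacci \<beta>"
  shows "(\<forall>x \<in> unique_expansion_points \<beta>. \<forall>\<omega> :: nat \<Rightarrow> bool.
            has_local_dim (X_star \<beta>) (rho \<beta>) (nu \<beta>) (\<omega>, x)
              ((ln (real_of_int \<lceil>\<beta>\<rceil>) + ln 2) / ln \<beta>))
         \<and> multifractal (X_star \<beta>) (rho \<beta>) (nu \<beta>)"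
proof -
  interpret multinacci \<beta> by unfold_locales (rule assms)
  have "has_local_dim (X_star \<beta>) (rho \<beta>) (nu \<beta>) (\<omega>, x) ((ln (real_of_int \<lceil>\<beta>\<rceil>) + ln 2) / ln \<beta>)"
    if "x \<in> unique_expansion_points \<beta>" for x \<omega>
    using local_dim_no_visit[of "(\<omega>, x)"] unique_no_visit[OF that] that
    by (simp add: unique_expansion_points_def ceiling_beta add.commute)
  then show ?thesis using multifractal_nu by blast
qed

end
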